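(* Let $f$ be a radial eigencubic in $\mathbb{R}^n$ with the normal form $$f=x_n^3-\tfrac32x_n(2|\xi|^2+|\eta|^2-|\zeta|^2)+\psi_{111}+\psi_{102}+\psi_{012}+\psi_{030}$$ of type $(n_1,n_2)$. Then the cubic form $$C:=\tfrac23\Big(\psi_{111}+\tfrac{1}{\sqrt3}\psi_{102}\Big),$$ in the variables $\xi\in\mathbb{R}^{n_1}$ and $z=(\eta,\zeta)\in\mathbb{R}^{2n_1+2n_2-2}$, is an eigencubic of Clifford type. In particular, $$n_1-1\le\rho(n_2+n_1-1),$$ where $\rho$ is the Hurwitz–Radon function.
   Context: For a polynomial $f$ on $\mathbb{R}^n$ put $L(f)=|\nabla f|^2\Delta f-\sum_{i,j=1}^n f_{x_i}f_{x_j}f_{x_ix_j}$. A radial eigencubic in $\mathbb{R}^n$ is a homogeneous polynomial $f\not\equiv 0$ of degree 3 such that $L(f)=\lambda |x|^2 f$ for some constant $\lambda\in\mathbb{R}$. In the normal form, $\mathbb{R}^n=\mathrm{span}(e_n)\oplus V_1\oplus V_2\oplus V_3$ is an orthogonal decomposition ($e_n$ a unit vector, the $V_i$ possibly zero), $x=x_ne_n+\xi+\eta+\zeta$ with $\xi\in V_1,\eta\in V_2,\zeta\in V_3$, and $\psi_{ijk}$ is a cubic form homogeneous of degree $i$ in $\xi$, $j$ in $\eta$ and $k$ in $\zeta$. Its type is $(n_1,n_2)=(\dim V_1,\dim V_2)$; one has $\dim V_3=2n_1+n_2-2$. A symmetric Clifford system $\mathcal{A}=\{A_0,\dots,A_q\}\in\mathrm{Cliff}(\mathbb{R}^{2m},q)$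 is a system of symmetric endomorphisms of $\mathbb{R}^{2m}$ with $A_iA_j+A_jA_i=2\delta_{ij}\mathbf{1}$. To it one associates the cubic form $C_{\mathcal A}(s,y)=\sum_{i=0}^q\langle y,A_iy\rangle s_{i+1}$ on $\mathbb{R}^{q+1}\times\mathbb{R}^{2m}$. A radial eigencubic is of Clifford type if it is congruent to some $C_{\mathcal A}$. Here two such cubics $f_1,f_2$ are called congruent if the cones $f_1^{-1}(0)$ and $f_2^{-1}(0)$ are congruent; for irreducible cubic forms this is equivalent to $f_1(x)=cf_2(Ux)$ for some orthogonal $U$ and real $c\ne0$. The Hurwitz–Radon function is $\rho(m)=8a+2^b$ if $m=2^{4a+b}\cdot\mathrm{odd}$, $0\le b\le3$.
   Formalization: That C is an eigencubic of Clifford type is stated only for n_1 ≥ 1 and n_1+n_2 ≥ 2; in the remaining cases (n_1 = 0, or type (1,0)) C vanishes identically, so it is not an eigencubic. The inequality is stated in all cases. *)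

theory Defs
  imports
    "HOL-Analysis.Analysis"
    "HOL-Computational_Algebra.Computational_Algebra"
    "Jordan_Normal_Form.Matrix"
begin

unbundle no vec_syntax

text \<open>
  The dimensions are related to each other and partly existentially quantified, so
  R^n is the carrier \<^term>\<open>carrier_vec n :: real vec set\<close> throughout; a point of
  R^a x R^b is the concatenation \<open>u @\<^sub>v v\<close>. Functions on R^n only matter on that carrier.
\<close>

definition cubic_form :: "nat \<Rightarrow> (real vec \<Rightarrow> real) \<Rightarrow> bool" where
  "cubic_form n f \<longleftrightarrow>
     (\<exists>c :: nat \<Rightarrow> nat \<Rightarrow> nat \<Rightarrow> real. \<forall>x \<in> carrier_vec n.
        f x = (\<Sum>i<n. \<Sum>j<n. \<Sum>k<n. c i j k * x $ i * x $ j * x $ k))"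

definition partial_deriv :: "nat \<Rightarrow> nat \<Rightarrow> (real vec \<Rightarrow> real) \<Rightarrow> real vec \<Rightarrow> real" where
  "partial_deriv n i f x = deriv (\<lambda>t. f (x + t \<cdot>\<^sub>v unit_vec n i)) 0"

definition L_op :: "nat \<Rightarrow> (real vec \<Rightarrow> real) \<Rightarrow> real vec \<Rightarrow> real" where
  "L_op n f x =
     (\<Sum>i<n. (partial_deriv n i f x)\<^sup>2) * (\<Sum>i<n. partial_deriv n i (partial_deriv n i f) x)
     - (\<Sum>i<n. \<Sum>j<n. partial_deriv n i f x * partial_deriv n j f x
                        * partial_deriv n j (partial_deriv n i f) x)"

definition radial_eigencubic :: "nat \<Rightarrow> (real vec \<Rightarrow> real) \<Rightarrow> bool" where
  "radial_eigencubic n f \<longleftrightarrow>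
     cubic_form n f \<and> (\<exists>x \<in> carrier_vec n. f x \<noteq> 0) \<and>
     (\<exists>l :: real. \<forall>x \<in> carrier_vec n. L_op n f x = l * (x \<bullet> x) * f x)"

text \<open>
  Square matrices whose columns are orthonormal; the library's \<^const>\<open>orthogonal_mat\<close>
  requires only mutually orthogonal columns.
\<close>

definition orthonormal_mat :: "nat \<Rightarrow> real mat \<Rightarrow> bool" where
  "orthonormal_mat n Q \<longleftrightarrow> Q \<in> carrier_mat n n \<and> transpose_mat Q * Q = 1\<^sub>m n"

text \<open>
  Cubic forms homogeneous of degree i in \<open>\<xi>\<close>, j in \<open>\<eta>\<close> and k in \<open>\<zeta>\<close>. The scalars
  may be zero, and \<open>0 ^ 0 = 1\<close>, so degree 0 means independence of that variable.
\<close>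

definition tri_cubic_form ::
    "nat \<Rightarrow> nat \<Rightarrow> nat \<Rightarrow> nat \<Rightarrow> nat \<Rightarrow> nat \<Rightarrow> (real vec \<Rightarrow> real) \<Rightarrow> bool" where
  "tri_cubic_form n1 n2 n3 i j k \<psi> \<longleftrightarrow>
     cubic_form (n1 + n2 + n3) \<psi> \<and>
     (\<forall>\<xi> \<in> carrier_vec n1. \<forall>\<eta> \<in> carrier_vec n2. \<forall>\<zeta> \<in> carrier_vec n3. \<forall>a b c.
        \<psi> ((a \<cdot>\<^sub>v \<xi>) @\<^sub>v (b \<cdot>\<^sub>v \<eta>) @\<^sub>v (c \<cdot>\<^sub>v \<zeta>)) = a ^ i * b ^ j * c ^ k * \<psi> (\<xi> @\<^sub>v \<eta> @\<^sub>v \<zeta>))"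

text \<open>
  The orthogonal decomposition of R^n into V1, V2, V3 and the line spanned by the unit
  vector e is given by orthonormal bases: the columns of \<open>Q\<close> are orthonormal bases of
  V1, V2, V3 (of dimensions \<open>n1\<close>, \<open>n2\<close>, \<open>n3\<close>, possibly 0), in this order, followed by e.
  So \<open>\<xi>\<close>, \<open>\<eta>\<close>, \<open>\<zeta>\<close>, \<open>t\<close> are the coordinates of \<open>x = Q (\<xi>, \<eta>, \<zeta>, t)\<close>, with \<open>t\<close> in the
  role of x_n, and the psi's are functions of the coordinates \<open>(\<xi>, \<eta>, \<zeta>)\<close>. The identity
  \<open>n3 = 2 * n1 + n2 - 2\<close> is not part of the definition.
\<close>

definition normal_form ::
    "nat \<Rightarrow> nat \<Rightarrow> nat \<Rightarrow> nat \<Rightarrow> real mat \<Rightarrow> (real vec \<Rightarrow> real) \<Rightarrow> (real vec \<Rightarrow> real) \<Rightarrow>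
     (real vec \<Rightarrow> real) \<Rightarrow> (real vec \<Rightarrow> real) \<Rightarrow> (real vec \<Rightarrow> real) \<Rightarrow> bool" where
  "normal_form n n1 n2 n3 Q f \<psi>111 \<psi>102 \<psi>012 \<psi>030 \<longleftrightarrow>
     n = n1 + n2 + n3 + 1 \<and> orthonormal_mat n Q \<and>
     tri_cubic_form n1 n2 n3 1 1 1 \<psi>111 \<and> tri_cubic_form n1 n2 n3 1 0 2 \<psi>102 \<and>
     tri_cubic_form n1 n2 n3 0 1 2 \<psi>012 \<and> tri_cubic_form n1 n2 n3 0 3 0 \<psi>030 \<and>
     (\<forall>\<xi> \<in> carrier_vec n1. \<forall>\<eta> \<in> carrier_vec n2. \<forall>\<zeta> \<in> carrier_vec n3. \<forall>t :: real.
        let y = \<xi> @\<^sub>v \<eta> @\<^sub>v \<zeta> in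
        f (Q *\<^sub>v (y @\<^sub>v Matrix.vec 1 (\<lambda>_. t))) =
          t ^ 3 - 3 / 2 * t * (2 * (\<xi> \<bullet> \<xi>) + \<eta> \<bullet> \<eta> - \<zeta> \<bullet> \<zeta>)
          + \<psi>111 y + \<psi>102 y + \<psi>012 y + \<psi>030 y)"

definition clifford_system :: "nat \<Rightarrow> nat \<Rightarrow> (nat \<Rightarrow> real mat) \<Rightarrow> bool" where
  "clifford_system m q A \<longleftrightarrow>
     (\<forall>i \<le> q. A i \<in> carrier_mat (2 * m) (2 * m) \<and> transpose_mat (A i) = A i) \<and>
     (\<forall>i \<le> q. \<forall>j \<le> q. A i * A j + A j * A i = (if i = j then 2 else 0) \<cdot>\<^sub>m 1\<^sub>m (2 * m))"

text \<open>
  The variables s are indexed from 0 here, and \<open>v = s @\<^sub>v y\<close> with s in R^(q+1) and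
  y in R^(2m).
\<close>

definition clifford_cubic :: "nat \<Rightarrow> nat \<Rightarrow> (nat \<Rightarrow> real mat) \<Rightarrow> real vec \<Rightarrow> real" where
  "clifford_cubic m q A v =
     (let s = vec_first v (q + 1); y = vec_last v (2 * m)
      in \<Sum>i\<le>q. (y \<bullet> (A i *\<^sub>v y)) * s $ i)"

text \<open>
  Congruence of the zero cones. The isometry is taken to be linear: two cones with vertex
  at the origin that are matched by an isometry are also matched by its linear part.
\<close>

definition congruent_cubics :: "nat \<Rightarrow> (real vec \<Rightarrow> real) \<Rightarrow> (real vec \<Rightarrow> real) \<Rightarrow> bool" where
  "congruent_cubics n f1 f2 \<longleftrightarrow>
     (\<exists>U. orthonormal_mat n U \<and>
        (\<lambda>x. U *\<^sub>v x) ` {x \<in> carrier_vec n. f1 x = 0} = {x \<in> carrier_vec n. f2 x = 0})"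

definition clifford_type :: "nat \<Rightarrow> (real vec \<Rightarrow> real) \<Rightarrow> bool" where
  "clifford_type n f \<longleftrightarrow>
     radial_eigencubic n f \<and>
     (\<exists>m q A. n = (q + 1) + 2 * m \<and> clifford_system m q A \<and>
        congruent_cubics n f (clifford_cubic m q A))"

text \<open>Meaningful for \<open>m \<ge> 1\<close> only; the value at 0 is an artefact.\<close>

definition hurwitz_radon :: "nat \<Rightarrow> nat" where
  "hurwitz_radon m =
     (let k = multiplicity 2 m in 8 * (k div 4) + 2 ^ (k mod 4))"

end

theory Submission
  imports Defs "HOL-Library.Function_Algebras" "Jordan_Normal_Form.Determinant"
begin

text \<open>
  Write \<open>f x = \<langle>x, x x\<rangle>\<close> with the commutative product defined by the symmetric tensor of \<open>f\<close>. The
  eigencubic equation becomes \<open>|x x|\<^sup>2 tr x - \<langle>x x, x (x x)\<rangle> = \<mu> |x|\<^sup>2 f x\<close>, where \<open>tr x\<close> is the trace of the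
  multiplication by \<open>x\<close>. The vector \<open>e\<close> is an idempotent whose multiplication operator has the
  eigenspaces \<open>V\<^sub>1\<close>, \<open>V\<^sub>2\<close>, \<open>V\<^sub>3\<close> with eigenvalues \<open>-1\<close>, \<open>-1/2\<close>, \<open>1/2\<close>. Comparing coefficients at \<open>t e + y\<close>
  shows that \<open>tr = 0\<close>, which gives the dimension of \<open>V\<^sub>3\<close>, and a quadratic identity for the
  multiplication by \<open>\<xi>\<close> in \<open>V\<^sub>1\<close>; the latter says that the rescaled multiplication
  \<open>A\<^sub>\<xi> z = 2 (\<xi> \<eta> + (\<xi> \<zeta>)\<^sub>2 + (\<xi> \<zeta>)\<^sub>3 / \<surd>3)\<close> for \<open>z = \<eta> + \<zeta>\<close> satisfies \<open>|A\<^sub>\<xi> z| = |\<xi>| |z|\<close>. So the \<open>A\<^sub>\<xi>\<close> form a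
  symmetric Clifford system, and its cubic form \<open>\<langle>z, A\<^sub>\<xi> z\<rangle>\<close> is \<open>C\<close>.

  For the Hurwitz-Radon bound, \<open>p\<close> anticommuting operators of square \<open>1\<close> and \<open>q\<close> of square \<open>-1\<close> are
  transformed by three moves: \<open>(p + 1, q)\<close> to \<open>(q + 1, p)\<close>, \<open>(p, q + 4)\<close> to \<open>(p + 4, q)\<close>, and
  \<open>(p + 1, q + 1)\<close> to \<open>(p, q)\<close> on a subspace of half the dimension.
\<close>

section \<open>Anticommuting operators and the Hurwitz-Radon bound\<close>

text \<open>Origin of the constants. The coefficient of t^5 gives \<open>tr e - 1 = \<mu>\<close>,
  and for a unit vector y in V1 that of t^3 gives \<open>tr e + 1 = - \<mu>\<close>; so one unit
  vector in V1 fixes tr e = 0 and \<open>\<mu> = -1\<close>. The coefficient of t is quartic in y.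
  At y = s x + z, with x in V1 and z of eigenvalue k, its s^2 part weights the component of x z of
  eigenvalue l by 4 l + 8 k - 8, against (k - 3 + 4 k^2) |x|^2 |z|^2. The quotient is 1/4 for the
  passages V2 to V3 and V3 to V2, but 3/4 for V3 to V3; hence the factor 1 / sqrt 3.

  Halving passes to an eigenspace, so the operators act on subspaces of one fixed vector space and
  satisfy their relations there only. Starting from n1 >= 2 involutions in dimension 2 m, one twist
  and one halving leave n1 - 2 complex structures in dimension m. Eight complex structures cost a
  factor 16 in the dimension, which is the period of the Hurwitz-Radon function.\<close>

definition anticommute_on :: "'a::real_vector set \<Rightarrow> ('a \<Rightarrow> 'a) \<Rightarrow> ('a \<Rightarrow> 'a) \<Rightarrow> bool" where
  "anticommute_on W X Y \<longleftrightarrow> (\<forall>x\<in>W. X (Y x) = - Y (X x))"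

text \<open>Linearity is global but the relations are confined to W, so the same operators can be
  kept when W shrinks to an invariant subspace. With \<open>sorted_wrt\<close>, anticommutation
  refers to pairs of positions in the joined list, not to pairs of distinct operators.\<close>

definition clifford_ops :: "'a::real_vector set \<Rightarrow> ('a \<Rightarrow> 'a) list \<Rightarrow> ('a \<Rightarrow> 'a) list \<Rightarrow> bool" where
  "clifford_ops W Es Fs \<longleftrightarrow>
     (\<forall>X\<in>set (Es @ Fs). linear X \<and> (\<forall>x\<in>W. X x \<in> W)) \<and>
     (\<forall>E\<in>set Es. \<forall>x\<in>W. E (E x) = x) \<and> (\<forall>F\<in>set Fs. \<forall>x\<in>W. F (F x) = - x) \<and>
     sorted_wrt (anticommute_on W) (Es @ Fs)"

text \<open>The ambient type may be infinite-dimensional (later it is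
  \<open>nat \<Rightarrow> real\<close>), so finiteness belongs to the subspace.\<close>

definition findim_subspace :: "'a::real_vector set \<Rightarrow> bool" where
  "findim_subspace W \<longleftrightarrow> subspace W \<and> (\<exists>B. finite B \<and> W \<subseteq> span B)"

lemma findim_subspace_basis:
  assumes "findim_subspace W"
  obtains B where "finite B" "independent B" "span B = W" "card B = dim W"
proof -
  obtain B where B: "B \<subseteq> W" "independent B" "W \<subseteq> span B" "card B = dim W"
    by (rule basis_exists)
  have "finite B"
    using assms B independent_span_bound unfolding findim_subspace_def by (metis order_trans)
  moreover have "span B = W"
    using B assms span_minimal unfolding findim_subspace_def by blast
  ultimately show ?thesis using that B by blast
qed

lemma findim_subspace_mono:
  assumes "findim_subspace W" "subspace V" "V \<subseteq> W"
  shows "findim_subspace V"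
  using assms unfolding findim_subspace_def by blast

lemma dim_span_insert:
  fixes S :: "'a::real_vector set"
  assumes "findim_subspace S" "v \<notin> S"
  shows "dim (span (insert v S)) = dim S + 1" "findim_subspace (span (insert v S))"
proof -
  obtain B where B: "finite B" "independent B" "span B = S" "card B = dim S"
    using findim_subspace_basis[OF assms(1)] .
  have i: "independent (insert v B)"
    using B assms(2) independent_insertI by blast
  have n: "v \<notin> B"
    using B assms(2) span_base by blast
  have sp: "span (insert v S) = span (insert v B)"
    using B(3) by (metis span_insert span_span)
  show "dim (span (insert v S)) = dim S + 1"
    unfolding sp using i n B(1,4) dim_span_eq_card_independent[OF i] by simp
  show "findim_subspace (span (insert v S))"
    unfolding sp findim_subspace_def using B(1) by (intro conjI exI[of _ "insert v B"]) auto
qed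

lemma dim_le_findim:
  assumes "findim_subspace W" "subspace V" "V \<subseteq> W"
  shows "dim V \<le> dim W"
proof -
  obtain B where "finite B" "span B = W" "card B = dim W"
    using findim_subspace_basis[OF assms(1)] by metis
  then show ?thesis using dim_le_card[of V B] assms by simp
qed

text \<open>Replaces the choice of a basis over the complex numbers or the quaternions: an invariant
  subspace that misses some v can always be enlarged by exactly d dimensions, until it exhausts
  W.\<close>

lemma dvd_dim_greedy:
  fixes W :: "'a::real_vector set"
  assumes W: "findim_subspace W"
    and zero: "P {0}"
    and step: "\<And>S v. findim_subspace S \<Longrightarrow> S \<subseteq> W \<Longrightarrow> P S \<Longrightarrow> v \<in> W \<Longrightarrow> v \<notin> S \<Longrightarrow>
                 \<exists>S'. findim_subspace S' \<and> S' \<subseteq> W \<and> P S' \<and> dim S' = dim S + d"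
    and d: "d > 0"
  shows "d dvd dim W"
proof -
  have ex: "findim_subspace S \<Longrightarrow> S \<subseteq> W \<Longrightarrow> P S \<Longrightarrow> d dvd dim S \<Longrightarrow> d dvd dim W" for S
  proof (induction "dim W - dim S" arbitrary: S rule: less_induct)
    case less
    show ?case
    proof (cases "S = W")
      case False
      then obtain v where "v \<in> W" "v \<notin> S" using less.prems by blast
      then obtain S' where S': "findim_subspace S'" "S' \<subseteq> W" "P S'" "dim S' = dim S + d"
        using step less.prems by blast
      have "dim S' \<le> dim W"
        using dim_le_findim W S' unfolding findim_subspace_def by blast
      then show ?thesis using less.hyps[of S'] S' d less.prems by auto
    qed (use less.prems in auto)
  qed
  have z: "findim_subspace ({0} :: 'a set)"
    unfolding findim_subspace_def by (intro conjI exI[of _ "{}"]) (auto simp: subspace_def)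
  have "dim ({0} :: 'a set) = 0"
    using dim_unique[of "{}" "{0} :: 'a set" 0] by (simp add: dependent_def)
  then show ?thesis
    using ex[OF z] zero W subspace_0 unfolding findim_subspace_def by auto
qed

section \<open>Complex and quaternionic structures\<close>

lemma linear_span_insert_closed:
  assumes "linear X" "x \<in> span (insert v S)" "X v \<in> span T" "\<And>s. s \<in> S \<Longrightarrow> X s \<in> span T"
  shows "X x \<in> span T"
proof -
  have "X x \<in> span (X ` insert v S)"
    using assms(1,2) by (metis imageI linear_span_image)
  also have "\<dots> \<subseteq> span T"
    using assms(3,4) by (intro span_minimal) auto
  finally show ?thesis .
qed

lemma sum_scaled_in_subspace:
  assumes "subspace S" "(c::real) *\<^sub>R v \<in> S" "c \<noteq> 0"
  shows "v \<in> S"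
  using subspace_scale[OF assms(1,2), of "1/c"] assms(3) by simp

text \<open>If J v lay in the span of S and v, say J v - a v in S, then applying J + a to this
  vector would put -(1 + a^2) v into S. So v and J v really add two dimensions.\<close>

lemma complex_structure_step:
  fixes W :: "'a::real_vector set"
  assumes W: "findim_subspace W" and J: "linear J" "\<And>x. x \<in> W \<Longrightarrow> J x \<in> W" "\<And>x. x \<in> W \<Longrightarrow> J (J x) = - x"
    and S: "findim_subspace S" "S \<subseteq> W" "\<And>x. x \<in> S \<Longrightarrow> J x \<in> S" and v: "v \<in> W" "v \<notin> S"
  defines "S' \<equiv> span (insert (J v) (span (insert v S)))"
  shows "findim_subspace S'" "S' \<subseteq> W" "\<And>x. x \<in> S' \<Longrightarrow> J x \<in> S'" "dim S' = dim S + 2"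
proof -
  let ?S1 = "span (insert v S)"
  have sW: "subspace W" and sS: "subspace S" using W S unfolding findim_subspace_def by auto
  have nin: "J v \<notin> ?S1"
  proof
    assume "J v \<in> ?S1"
    then obtain a where a: "J v - a *\<^sub>R v \<in> S"
      using span_breakdown_eq[of "J v" v S] sS by (metis span_eq_iff)
    then have "J (J v - a *\<^sub>R v) + a *\<^sub>R (J v - a *\<^sub>R v) \<in> S"
      using S(3) sS by (intro subspace_add subspace_scale) auto
    moreover have "J (J v - a *\<^sub>R v) + a *\<^sub>R (J v - a *\<^sub>R v) = (- (1 + a\<^sup>2)) *\<^sub>R v"
      using J(3)[OF v(1)] by (simp add: linear_diff[OF J(1)] linear_scale[OF J(1)] algebra_simps power2_eq_square)
    ultimately have "v \<in> S"
      using sum_scaled_in_subspace[OF sS] by (metis add_nonneg_eq_0_iff neg_equal_0_iff_equal zero_le_one zero_le_power2 zero_neq_one)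
    then show False using v by simp
  qed
  note d1 = dim_span_insert[OF S(1) v(2)]
  note d2 = dim_span_insert[OF d1(2) nin]
  show "findim_subspace S'" "dim S' = dim S + 2"
    unfolding S'_def using d1 d2 by auto
  show "S' \<subseteq> W"
    unfolding S'_def using S v J(2) sW by (intro span_minimal insert_subsetI) auto
  have vS: "v \<in> S'" "J v \<in> S'" "\<And>s. s \<in> S \<Longrightarrow> s \<in> S'"
    unfolding S'_def by (meson insertI1 insertI2 span_base)+
  have sp: "span S' = S'" unfolding S'_def by simp
  have c1: "J x \<in> S'" if "x \<in> ?S1" for x
    using linear_span_insert_closed[OF J(1) that, of S'] vS S(3) unfolding sp by blast
  have "J (J v) \<in> S'"
    using J(3)[OF v(1)] vS subspace_neg[of S' v] unfolding S'_def by simp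
  then show "J x \<in> S'" if "x \<in> S'" for x
    using linear_span_insert_closed[OF J(1) that[unfolded S'_def], of S'] c1 unfolding sp by blast
qed

lemma even_dim_complex_structure:
  assumes W: "findim_subspace W" and J: "clifford_ops W [] [J]"
  shows "2 dvd dim W"
proof -
  have J': "linear J" "\<And>x. x \<in> W \<Longrightarrow> J x \<in> W" "\<And>x. x \<in> W \<Longrightarrow> J (J x) = - x"
    using J unfolding clifford_ops_def by auto
  show ?thesis
  proof (rule dvd_dim_greedy[OF W, of "\<lambda>S. \<forall>x\<in>S. J x \<in> S"])
    show "\<forall>x\<in>{0}. J x \<in> {0}" using J' linear_0 by auto
    fix S v assume "findim_subspace S" "S \<subseteq> W" "\<forall>x\<in>S. J x \<in> S" "v \<in> W" "v \<notin> S"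
    then show "\<exists>S'. findim_subspace S' \<and> S' \<subseteq> W \<and> (\<forall>x\<in>S'. J x \<in> S') \<and> dim S' = dim S + 2"
      using complex_structure_step[OF W J', of S v] by blast
  qed auto
qed

text \<open>The quaternionic orbit of \<open>v\<close> is the sum of the \<open>I\<close>-orbits of \<open>v\<close> and of \<open>J v\<close>.\<close>

lemma four_dvd_dim_quaternionic_structure:
  assumes W: "findim_subspace W" and IJ: "clifford_ops W [] [I, J]"
  shows "4 dvd dim W"
proof -
  have I: "linear I" "\<And>x. x \<in> W \<Longrightarrow> I x \<in> W" "\<And>x. x \<in> W \<Longrightarrow> I (I x) = - x"
    and J: "linear J" "\<And>x. x \<in> W \<Longrightarrow> J x \<in> W" "\<And>x. x \<in> W \<Longrightarrow> J (J x) = - x"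
    and A: "\<And>x. x \<in> W \<Longrightarrow> I (J x) = - J (I x)"
    using IJ unfolding clifford_ops_def anticommute_on_def by auto
  have sW: "subspace W" using W unfolding findim_subspace_def by auto
  show ?thesis
  proof (rule dvd_dim_greedy[OF W, of "\<lambda>S. \<forall>x\<in>S. I x \<in> S \<and> J x \<in> S"])
    show "\<forall>x\<in>{0}. I x \<in> {0} \<and> J x \<in> {0}" using I J linear_0 by auto
    fix S v assume S: "findim_subspace S" "S \<subseteq> W" "\<forall>x\<in>S. I x \<in> S \<and> J x \<in> S" and v: "v \<in> W" "v \<notin> S"
    have sS: "subspace S" using S unfolding findim_subspace_def by auto
    then have spS: "span S = S" by (metis span_eq_iff)
    define S1 where "S1 = span (insert (I v) (span (insert v S)))"
    have S1: "findim_subspace S1" "S1 \<subseteq> W" "\<And>x. x \<in> S1 \<Longrightarrow> I x \<in> S1" "dim S1 = dim S + 2"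
      unfolding S1_def using complex_structure_step[OF W I S(1,2) _ v] S(3) by blast+
    have sS1: "subspace S1" "span S1 = S1" unfolding S1_def by auto
    have S1_ex: "\<exists>a b. x - a *\<^sub>R v - b *\<^sub>R I v \<in> S" if x: "x \<in> S1" for x
    proof -
      obtain b where "x - b *\<^sub>R I v \<in> span (insert v S)"
        using x unfolding S1_def span_breakdown_eq[of x "I v"] span_span by (elim exE)
      then obtain a where "x - b *\<^sub>R I v - a *\<^sub>R v \<in> S"
        unfolding span_breakdown_eq[of _ v S] spS by (elim exE)
      then have "x - a *\<^sub>R v - b *\<^sub>R I v \<in> S" by (simp add: algebra_simps)
      then show ?thesis by blast
    qed
    have S1_in: "v \<in> S1" "I v \<in> S1" "\<And>s. s \<in> S \<Longrightarrow> s \<in> S1"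
      unfolding S1_def by (meson insertI1 insertI2 span_base)+
    have nin: "J v \<notin> S1"
    proof
      assume "J v \<in> S1"
      then obtain a b where ab: "J v - a *\<^sub>R v - b *\<^sub>R I v \<in> S" (is "?u \<in> S")
        using S1_ex by blast
      have "J ?u \<in> S" "I ?u \<in> S" using ab S(3) by blast+
      \<comment> \<open>A conjugate factor: since I and J anticommute, (J + a - b I)(J - a - b I) =
        -(1 + a^2 + b^2), and this scalar is nonzero.\<close>
      then have "J ?u + a *\<^sub>R ?u - b *\<^sub>R I ?u \<in> S"
        using ab subspace_add[OF sS] subspace_diff[OF sS] subspace_scale[OF sS] by metis
      moreover have "J ?u + a *\<^sub>R ?u - b *\<^sub>R I ?u = (- (1 + a\<^sup>2 + b\<^sup>2)) *\<^sub>R v"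
        using I(3)[OF v(1)] J(3)[OF v(1)] A[OF v(1)]
        by (simp add: linear_diff[OF J(1)] linear_scale[OF J(1)] linear_diff[OF I(1)] linear_scale[OF I(1)] linear_add[OF I(1)] linear_add[OF J(1)]
            algebra_simps power2_eq_square)
      ultimately have "v \<in> S"
        using sum_scaled_in_subspace[OF sS, of "- (1 + a\<^sup>2 + b\<^sup>2)" v]
        by (smt (verit) zero_le_power2)
      then show False using v by simp
    qed
    define S2 where "S2 = span (insert (I (J v)) (span (insert (J v) S1)))"
    have S2: "findim_subspace S2" "S2 \<subseteq> W" "\<And>x. x \<in> S2 \<Longrightarrow> I x \<in> S2" "dim S2 = dim S1 + 2"
      unfolding S2_def using complex_structure_step[OF W I S1(1,2,3) J(2)[OF v(1)] nin] by blast+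
    have sS2: "subspace S2" "span S2 = S2" unfolding S2_def by auto
    have S2_in: "J v \<in> S2" "I (J v) \<in> S2" "\<And>s. s \<in> S1 \<Longrightarrow> s \<in> S2"
      unfolding S2_def by (meson insertI1 insertI2 span_base)+
    have J1: "J x \<in> S2" if "x \<in> span (insert v S)" for x
      using linear_span_insert_closed[OF J(1) that, of S2] S2_in S1_in S(3) unfolding sS2 by blast
    have JI: "J (I v) = - I (J v)" using A[OF v(1)] by simp
    have J2: "J x \<in> S2" if "x \<in> S1" for x
      using linear_span_insert_closed[OF J(1) that[unfolded S1_def], of S2] J1 S2_in subspace_neg[OF sS2(1)] JI
      unfolding sS2 by metis
    have JJv: "J (J v) \<in> S2"
      using J(3)[OF v(1)] S1_in S2_in subspace_neg[OF sS2(1)] by metis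
    have J3: "J x \<in> S2" if "x \<in> span (insert (J v) S1)" for x
      using linear_span_insert_closed[OF J(1) that, of S2] J2 JJv unfolding sS2 by blast
    have "J (I (J v)) = I v"
      using A[OF J(2)[OF v(1)]] J(3)[OF v(1)] linear_neg[OF I(1), of v] by simp
    then have JIJv: "J (I (J v)) \<in> S2" using S1_in S2_in by simp
    have "J x \<in> S2" if "x \<in> S2" for x
      using linear_span_insert_closed[OF J(1) that[unfolded S2_def], of S2] J3 JIJv unfolding sS2 by blast
    then show "\<exists>S'. findim_subspace S' \<and> S' \<subseteq> W \<and> (\<forall>x\<in>S'. I x \<in> S' \<and> J x \<in> S') \<and> dim S' = dim S + 4"
      using S2 S1 by (intro exI[of _ S2]) auto
  qed auto
qed

section \<open>The moves between lists of generators\<close>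

lemma anticommute_on_sym: "anticommute_on W X Y \<Longrightarrow> anticommute_on W Y X"
  unfolding anticommute_on_def by (metis minus_minus)

lemma sorted_wrt_map_mono:
  assumes "sorted_wrt R xs" "\<And>x y. x \<in> set xs \<Longrightarrow> y \<in> set xs \<Longrightarrow> R x y \<Longrightarrow> R' (g x) (g y)"
  shows "sorted_wrt R' (map g xs)"
  unfolding sorted_wrt_map using assms sorted_wrt_mono_rel[of xs R "\<lambda>x y. R' (g x) (g y)"] by blast

lemma sorted_wrt_swap:
  assumes "sorted_wrt R (xs @ ys)" "\<And>x y. R x y \<Longrightarrow> R y x"
  shows "sorted_wrt R (ys @ xs)"
  using assms by (auto simp: sorted_wrt_append)

text \<open>For \<open>E\<^sup>2 = 1\<close>, the products of \<open>E\<close> with the other generators anticommute, and their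
  squares are the negated squares of the generators.\<close>

lemma clifford_ops_twist:
  assumes "clifford_ops W (E # Es) Fs"
  shows "clifford_ops W (E # map ((\<circ>) E) Fs) (map ((\<circ>) E) Es)"
proof -
  have E: "linear E" "\<And>x. x \<in> W \<Longrightarrow> E x \<in> W" "\<And>x. x \<in> W \<Longrightarrow> E (E x) = x"
    and lin: "\<And>X. X \<in> set (Es @ Fs) \<Longrightarrow> linear X" "\<And>X x. X \<in> set (Es @ Fs) \<Longrightarrow> x \<in> W \<Longrightarrow> X x \<in> W"
    and an: "\<And>X x. X \<in> set (Es @ Fs) \<Longrightarrow> x \<in> W \<Longrightarrow> E (X x) = - X (E x)"
    and sq: "\<And>X x. X \<in> set Es \<Longrightarrow> x \<in> W \<Longrightarrow> X (X x) = x" "\<And>X x. X \<in> set Fs \<Longrightarrow> x \<in> W \<Longrightarrow> X (X x) = - x"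
    and srt: "sorted_wrt (anticommute_on W) (Es @ Fs)"
    using assms unfolding clifford_ops_def anticommute_on_def by auto
  have EX: "E (X (E (Y x))) = - X (Y x)" if "X \<in> set (Es @ Fs)" "Y \<in> set (Es @ Fs)" "x \<in> W" for X Y x
    using an[OF that(1), of "E (Y x)"] E(2,3) lin(2) that by simp
  have "sorted_wrt (anticommute_on W) (map ((\<circ>) E) (Fs @ Es))"
  proof (rule sorted_wrt_map_mono)
    show "sorted_wrt (anticommute_on W) (Fs @ Es)"
      using sorted_wrt_swap[OF srt] anticommute_on_sym by blast
    fix X Y assume XY: "X \<in> set (Fs @ Es)" "Y \<in> set (Fs @ Es)" "anticommute_on W X Y"
    then show "anticommute_on W (E \<circ> X) (E \<circ> Y)"
      using EX[of X Y] EX[of Y X] unfolding anticommute_on_def by auto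
  qed
  moreover have "anticommute_on W E (E \<circ> X)" if "X \<in> set (Es @ Fs)" for X
    using that an[OF that] E(2,3) lin(2)[OF that] linear_neg[OF E(1)] unfolding anticommute_on_def
    by (simp add: E)
  ultimately have "sorted_wrt (anticommute_on W) ((E # map ((\<circ>) E) Fs) @ map ((\<circ>) E) Es)"
    by auto
  moreover have "linear (E \<circ> X)" if "X \<in> set (Es @ Fs)" for X
    using linear_compose[OF lin(1)[OF that] E(1)] .
  moreover have "E (X (E (X x))) = x" if "X \<in> set Fs" "x \<in> W" for X x
    using EX[of X X x] sq(2)[OF that] that by simp
  moreover have "E (X (E (X x))) = - x" if "X \<in> set Es" "x \<in> W" for X x
    using EX[of X X x] sq(1)[OF that] that by simp
  ultimately show ?thesis
    unfolding clifford_ops_def using E lin(2) by auto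
qed

text \<open>Each generator commutes with one factor of the product and anticommutes with three, so
  the total sign is -1. Squaring the product takes six transpositions, an even number, and leaves
  s^4 = 1.\<close>

lemma clifford_ops_product_anticommute:
  assumes "sorted_wrt (anticommute_on W) [F1, F2, F3, F4]"
    "\<forall>X\<in>{F1, F2, F3, F4}. linear X \<and> (\<forall>x\<in>W. X x \<in> W)"
    "\<forall>X\<in>{F1, F2, F3, F4}. \<forall>x\<in>W. X (X x) = s *\<^sub>R x" "s * s = 1"
  defines "w \<equiv> F1 \<circ> F2 \<circ> F3 \<circ> F4"
  shows "X \<in> {F1, F2, F3, F4} \<Longrightarrow> anticommute_on W w X" "x \<in> W \<Longrightarrow> w (w x) = x"
proof -
  have lin: "linear F1" "linear F2" "linear F3" "linear F4" and W: "\<And>x. x \<in> W \<Longrightarrow> F1 x \<in> W"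
    "\<And>x. x \<in> W \<Longrightarrow> F2 x \<in> W" "\<And>x. x \<in> W \<Longrightarrow> F3 x \<in> W" "\<And>x. x \<in> W \<Longrightarrow> F4 x \<in> W"
    using assms by auto
  have ac: "F2 (F1 x) = - F1 (F2 x)" "F3 (F1 x) = - F1 (F3 x)" "F4 (F1 x) = - F1 (F4 x)"
    "F3 (F2 x) = - F2 (F3 x)" "F4 (F2 x) = - F2 (F4 x)" "F4 (F3 x) = - F3 (F4 x)" if "x \<in> W" for x
    using assms(1) that unfolding anticommute_on_def by auto
  have sq: "F1 (F1 x) = s *\<^sub>R x" "F2 (F2 x) = s *\<^sub>R x" "F3 (F3 x) = s *\<^sub>R x" "F4 (F4 x) = s *\<^sub>R x"
    if "x \<in> W" for x
    using assms(3) that by auto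
  note neg = linear_neg[OF lin(1)] linear_neg[OF lin(2)] linear_neg[OF lin(3)] linear_neg[OF lin(4)]
    linear_scale[OF lin(1)] linear_scale[OF lin(2)] linear_scale[OF lin(3)] linear_scale[OF lin(4)]
  have w_apply: "w y = F1 (F2 (F3 (F4 y)))" for y
    unfolding w_def by simp
  show "w (w x) = x" if x: "x \<in> W"
  proof -
    have "F4 (w x) = - F1 (F2 (F3 (F4 (F4 x))))"
      unfolding w_def using x by (simp add: ac(3)[of "F2 (F3 (F4 x))"] ac(5)[of "F3 (F4 x)"] ac(6)[of "F4 x"] W neg)
    then have 4: "F4 (w x) = - s *\<^sub>R F1 (F2 (F3 x))"
      using x by (simp add: sq neg)
    have "F3 (F1 (F2 (F3 x))) = F1 (F2 (F3 (F3 x)))"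
      using x by (simp add: ac(2)[of "F2 (F3 x)"] ac(4)[of "F3 x"] W neg)
    then have 3: "F3 (F1 (F2 (F3 x))) = s *\<^sub>R F1 (F2 x)"
      using x by (simp add: sq neg)
    have "F2 (F1 (F2 x)) = - F1 (F2 (F2 x))"
      using x by (simp add: ac(1)[of "F2 x"] W neg)
    then have 2: "F2 (F1 (F2 x)) = - s *\<^sub>R F1 x"
      using x by (simp add: sq neg)
    have "w (w x) = ((s * s) * (s * s)) *\<^sub>R x"
      using x by (subst w_apply) (simp add: 4 3 2 sq neg mult.assoc)
    then show ?thesis using assms(4) by simp
  qed
  have "w (F1 x) = - F1 (w x)" if x: "x \<in> W" for x
    unfolding w_def using x by (simp add: ac(3)[of x] ac(2)[of "F4 x"] ac(1)[of "F3 (F4 x)"] W neg)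
  moreover have "w (F2 x) = - F2 (w x)" if x: "x \<in> W" for x
    unfolding w_def using x by (simp add: ac(5)[of x] ac(4)[of "F4 x"] ac(1)[of "F2 (F3 (F4 x))"] W neg)
  moreover have "w (F3 x) = - F3 (w x)" if x: "x \<in> W" for x
    unfolding w_def using x by (simp add: ac(6)[of x] ac(2)[of "F2 (F3 (F4 x))"] ac(4)[of "F3 (F4 x)"] W neg)
  moreover have "w (F4 x) = - F4 (w x)" if x: "x \<in> W" for x
    unfolding w_def using x by (simp add: ac(3)[of "F2 (F3 (F4 x))"] ac(5)[of "F3 (F4 x)"] ac(6)[of "F4 x"] W neg)
  ultimately show "X \<in> {F1, F2, F3, F4} \<Longrightarrow> anticommute_on W w X"
    unfolding anticommute_on_def by auto
qed

lemma sorted_wrt_swap_front: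
  assumes "sorted_wrt R (xs @ ys @ zs)" "\<And>x y. R x y \<Longrightarrow> R y x"
  shows "sorted_wrt R (ys @ xs @ zs)"
proof -
  have "\<forall>y\<in>set ys. \<forall>x\<in>set xs. R y x"
    using assms by (auto simp: sorted_wrt_append)
  then show ?thesis using assms(1) by (auto simp: sorted_wrt_append)
qed

text \<open>The product w has an even number of factors, so it commutes with the remaining
  operators, while w X w Y = - X Y for X, Y among the four. Replacing each of the four by its
  product with w thus flips the signs of their squares and preserves every anticommutation.\<close>

lemma clifford_product_twist:
  fixes s :: real
  assumes srt: "sorted_wrt (anticommute_on W) ([F1, F2, F3, F4] @ Rs)"
    and cl: "\<forall>X\<in>set ([F1, F2, F3, F4] @ Rs). linear X \<and> (\<forall>x\<in>W. X x \<in> W)"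
    and sq: "\<forall>X\<in>{F1, F2, F3, F4}. \<forall>x\<in>W. X (X x) = s *\<^sub>R x" "s * s = 1"
  defines "w \<equiv> F1 \<circ> F2 \<circ> F3 \<circ> F4"
  shows "sorted_wrt (anticommute_on W) (map ((\<circ>) w) [F1, F2, F3, F4] @ Rs)"
    and "\<forall>X\<in>set (map ((\<circ>) w) [F1, F2, F3, F4]). linear X \<and> (\<forall>x\<in>W. X x \<in> W \<and> X (X x) = - s *\<^sub>R x)"
proof -
  have w: "X \<in> {F1, F2, F3, F4} \<Longrightarrow> anticommute_on W w X" "x \<in> W \<Longrightarrow> w (w x) = x" for X x
    unfolding w_def using clifford_ops_product_anticommute[of W F1 F2 F3 F4 s] srt cl sq by auto
  have lin: "linear F1" "linear F2" "linear F3" "linear F4"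
    and W: "\<And>x. x \<in> W \<Longrightarrow> F1 x \<in> W" "\<And>x. x \<in> W \<Longrightarrow> F2 x \<in> W" "\<And>x. x \<in> W \<Longrightarrow> F3 x \<in> W"
      "\<And>x. x \<in> W \<Longrightarrow> F4 x \<in> W" "\<And>X x. X \<in> set Rs \<Longrightarrow> x \<in> W \<Longrightarrow> X x \<in> W"
    and linR: "\<And>X. X \<in> set Rs \<Longrightarrow> linear X"
    using cl by auto
  have wlin: "linear w" unfolding w_def using lin by (intro linear_compose)
  have wW: "x \<in> W \<Longrightarrow> w x \<in> W" for x unfolding w_def using W by simp
  let ?Gs = "{F1, F2, F3, F4}"
  have GW: "X \<in> ?Gs \<Longrightarrow> x \<in> W \<Longrightarrow> X x \<in> W" for X x using W by auto
  have wXwY: "w (X (w (Y x))) = - X (Y x)" if "X \<in> ?Gs" "Y \<in> ?Gs" "x \<in> W" for X Y x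
  proof -
    have "X (w (Y x)) = - w (X (Y x))"
      using w(1)[OF that(1)] GW[OF that(2,3)] unfolding anticommute_on_def by (metis minus_minus)
    then show ?thesis
      using w(2)[OF GW[OF that(1) GW[OF that(2,3)]]] linear_neg[OF wlin] by metis
  qed
  have comm: "w (R x) = R (w x)" if "R \<in> set Rs" "x \<in> W" for R x
  proof -
    have ac: "F1 (R y) = - R (F1 y)" "F2 (R y) = - R (F2 y)" "F3 (R y) = - R (F3 y)" "F4 (R y) = - R (F4 y)"
      if "y \<in> W" for y
      using srt \<open>R \<in> set Rs\<close> that unfolding anticommute_on_def by auto
    note neg = linear_neg[OF lin(1)] linear_neg[OF lin(2)] linear_neg[OF lin(3)] linear_neg[OF lin(4)]
    show ?thesis
      unfolding w_def using that by (simp add: ac W neg)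
  qed
  have "sorted_wrt (anticommute_on W) (map ((\<circ>) w) [F1, F2, F3, F4])"
  proof (rule sorted_wrt_map_mono)
    show "sorted_wrt (anticommute_on W) [F1, F2, F3, F4]" using srt by auto
    fix X Y assume XY: "X \<in> set [F1, F2, F3, F4]" "Y \<in> set [F1, F2, F3, F4]" "anticommute_on W X Y"
    then show "anticommute_on W (w \<circ> X) (w \<circ> Y)"
      using wXwY[of X Y] wXwY[of Y X] unfolding anticommute_on_def by auto
  qed
  moreover have "anticommute_on W (w \<circ> X) R" if X: "X \<in> ?Gs" and R: "R \<in> set Rs" for X R
    unfolding anticommute_on_def
  proof
    fix x assume x: "x \<in> W"
    have "X (R x) = - R (X x)"
      using srt X R x unfolding anticommute_on_def by auto
    then show "(w \<circ> X) (R x) = - R ((w \<circ> X) x)"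
      using comm[OF R GW[OF X x]] linear_neg[OF wlin] by simp
  qed
  ultimately show "sorted_wrt (anticommute_on W) (map ((\<circ>) w) [F1, F2, F3, F4] @ Rs)"
    using srt unfolding sorted_wrt_append by auto
  have "linear (w \<circ> X) \<and> (\<forall>x\<in>W. (w \<circ> X) x \<in> W \<and> (w \<circ> X) ((w \<circ> X) x) = - s *\<^sub>R x)" if X: "X \<in> ?Gs" for X
    using linear_compose[OF _ wlin, of X] X lin wXwY[OF X X] sq(1) wW GW[OF X] by auto
  then show "\<forall>X\<in>set (map ((\<circ>) w) [F1, F2, F3, F4]). linear X \<and> (\<forall>x\<in>W. X x \<in> W \<and> X (X x) = - s *\<^sub>R x)"
    by auto
qed

lemma clifford_ops_neg_to_pos:
  assumes "clifford_ops W Es (F1 # F2 # F3 # F4 # Fs)"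
  shows "clifford_ops W (map ((\<circ>) (F1 \<circ> F2 \<circ> F3 \<circ> F4)) [F1, F2, F3, F4] @ Es) Fs"
proof -
  let ?G = "[F1, F2, F3, F4]"
  have s: "sorted_wrt (anticommute_on W) (?G @ (Es @ Fs))"
  proof -
    have "sorted_wrt (anticommute_on W) (Es @ ?G @ Fs)" using assms unfolding clifford_ops_def by simp
    then show ?thesis by (rule sorted_wrt_swap_front) (rule anticommute_on_sym)
  qed
  have cl: "\<forall>X\<in>set (?G @ (Es @ Fs)). linear X \<and> (\<forall>x\<in>W. X x \<in> W)"
    using assms unfolding clifford_ops_def by auto
  have sq: "\<forall>X\<in>{F1, F2, F3, F4}. \<forall>x\<in>W. X (X x) = (- 1) *\<^sub>R x"
    using assms unfolding clifford_ops_def by auto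
  have sq_Es: "\<forall>E\<in>set Es. \<forall>x\<in>W. E (E x) = x" and sq_Fs: "\<forall>F\<in>set Fs. \<forall>x\<in>W. F (F x) = - x"
    using assms unfolding clifford_ops_def by auto
  note tw = clifford_product_twist[OF s cl sq, simplified minus_minus scaleR_one]
  show ?thesis
    unfolding clifford_ops_def set_append ball_Un append_assoc
    using tw cl sq_Es sq_Fs unfolding set_append ball_Un by (intro conjI) (assumption | blast | simp)+
qed

lemma independent_Un_trivial_Int:
  fixes A B :: "'a::real_vector set"
  assumes "finite B" "independent A" "independent B" "span A \<inter> span B \<subseteq> {0}"
  shows "independent (A \<union> B)"
  using assms(1,3,4)
proof (induction B)
  case (insert b B)
  have "independent B" "b \<notin> span B"
    using insert by (auto simp: independent_insert)
  moreover have "span B \<subseteq> span (insert b B)" by (rule span_mono) auto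
  ultimately have iAB: "independent (A \<union> B)" using insert by blast
  have "b \<notin> span (A \<union> B)"
  proof
    assume "b \<in> span (A \<union> B)"
    then obtain a c where ac: "b = a + c" "a \<in> span A" "c \<in> span B" unfolding span_Un by auto
    have "b - c \<in> span (insert b B)"
      using ac \<open>span B \<subseteq> span (insert b B)\<close> by (intro span_diff) (auto intro: span_base)
    then have "a = 0" using ac insert.prems(2) by auto
    then show False using ac \<open>b \<notin> span B\<close> by simp
  qed
  then show ?case using independent_insertI iAB by simp
qed (use assms in auto)

text \<open>The product \<open>J = E F\<close> is an involution commuting with the remaining operators, and \<open>E\<close>
  interchanges its two eigenspaces.\<close>

lemma clifford_ops_halve:
  fixes W :: "'a::real_vector set"
  assumes W: "findim_subspace W" and cl: "clifford_ops W (E # Es) (F # Fs)"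
  shows "\<exists>W'::'a set. findim_subspace W' \<and> clifford_ops W' Es Fs \<and> dim W = 2 * dim W'"
proof -
  have E: "linear E" "\<And>x. x \<in> W \<Longrightarrow> E x \<in> W" "\<And>x. x \<in> W \<Longrightarrow> E (E x) = x"
    and F: "linear F" "\<And>x. x \<in> W \<Longrightarrow> F x \<in> W" "\<And>x. x \<in> W \<Longrightarrow> F (F x) = - x"
    and EF: "\<And>x. x \<in> W \<Longrightarrow> E (F x) = - F (E x)"
    and rest: "\<And>X. X \<in> set (Es @ Fs) \<Longrightarrow> linear X" "\<And>X x. X \<in> set (Es @ Fs) \<Longrightarrow> x \<in> W \<Longrightarrow> X x \<in> W"
      "\<And>X x. X \<in> set (Es @ Fs) \<Longrightarrow> x \<in> W \<Longrightarrow> E (X x) = - X (E x)"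
    and sW: "subspace W"
    using cl W unfolding clifford_ops_def anticommute_on_def findim_subspace_def by auto
  have FX: "F (X x) = - X (F x)" if X: "X \<in> set (Es @ Fs)" and x: "x \<in> W" for X x
  proof -
    have "sorted_wrt (anticommute_on W) (Es @ F # Fs)"
      using cl unfolding clifford_ops_def by simp
    then have "anticommute_on W F X"
      using X anticommute_on_sym unfolding sorted_wrt_append by auto
    then show ?thesis using x unfolding anticommute_on_def by blast
  qed
  define J where "J x = E (F x)" for x
  have Jlin: "linear J" using linear_compose[OF F(1) E(1)] unfolding J_def comp_def .
  have JW: "J x \<in> W" if "x \<in> W" for x unfolding J_def using E F that by auto
  have JJ: "J (J x) = x" if "x \<in> W" for x
    unfolding J_def using that E(2,3) F(2,3) EF[of "F (E (F x))"] EF[of "E (F x)"]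
    by (metis EF minus_minus linear_neg[OF E(1)] linear_neg[OF F(1)])
  have JE: "J (E x) = - E (J x)" if "x \<in> W" for x
    unfolding J_def using that E F EF linear_neg[OF E(1)] by (metis minus_minus)
  have JX: "J (X x) = X (J x)" if X: "X \<in> set (Es @ Fs)" and x: "x \<in> W" for X x
    unfolding J_def FX[OF X x] linear_neg[OF E(1)] rest(3)[OF X F(2)[OF x]] by simp
  define W' where "W' = {x \<in> W. J x = x}"
  have sW': "subspace W'"
    unfolding W'_def subspace_def using sW Jlin
    by (auto simp: linear_0 linear_add linear_scale subspace_0 subspace_add subspace_scale)
  have fW': "findim_subspace W'"
    using findim_subspace_mono[OF W sW'] unfolding W'_def by auto
  obtain B where B: "finite B" "independent B" "span B = W'" "card B = dim W'"
    using findim_subspace_basis[OF fW'] .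
  have injE: "inj_on E W" using E(3) by (rule inj_on_inverseI)
  have W'W: "W' \<subseteq> W" unfolding W'_def by auto
  have BW': "B \<subseteq> W'" using B(3) span_base by blast
  have iE: "independent (E ` B)"
    using linear_independent_injective_image[OF E(1) B(2)] inj_on_subset[OF injE W'W] B(3) by simp
  have spE: "span (E ` B) = E ` W'" using linear_span_image[OF E(1)] B(3) by metis
  have JEW': "J x = - x" if "x \<in> E ` W'" for x
    using that JE unfolding W'_def by auto
  have int: "x = 0" if "x \<in> W'" "x \<in> E ` W'" for x
  proof -
    have "x = - x" using JEW'[OF that(2)] that(1) unfolding W'_def by simp
    then show ?thesis by (simp add: eq_neg_iff_add_eq_0 flip: scaleR_2)
  qed
  \<comment> \<open>As E maps the eigenspace of J for 1 injectively onto the one for -1, B and its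
    image together form a basis of W; this is where the factor 2 comes from.\<close>
  have ind: "independent (B \<union> E ` B)"
    using independent_Un_trivial_Int[OF _ B(2) iE] B(1,3) spE int by auto
  have sp: "span (B \<union> E ` B) = W"
  proof
    show "span (B \<union> E ` B) \<subseteq> W"
      using BW' W'W E(2) sW by (intro span_minimal) auto
    show "W \<subseteq> span (B \<union> E ` B)"
    proof
      fix x assume x: "x \<in> W"
      let ?u = "(1/2) *\<^sub>R (x + J x)" and ?v = "(1/2) *\<^sub>R (x - J x)"
      have u: "?u \<in> W'"
        unfolding W'_def using x sW JW JJ
        by (auto simp: linear_scale[OF Jlin] linear_add[OF Jlin] add.commute intro!: subspace_scale subspace_add)
      have vW: "?v \<in> W" using x sW JW by (auto intro!: subspace_scale subspace_diff)
      have Jv: "J ?v = - ?v"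
        using x JJ by (simp add: linear_scale[OF Jlin] linear_diff[OF Jlin] algebra_simps)
      have "E ?v \<in> W'"
        unfolding W'_def using E(2)[OF vW] JE[OF vW] Jv linear_neg[OF E(1), of ?v] by simp
      then have "?v \<in> E ` W'" using E(3)[OF vW] by (metis imageI)
      moreover have "x = ?u + ?v" by (simp add: algebra_simps flip: scaleR_add_left)
      ultimately show "x \<in> span (B \<union> E ` B)"
        unfolding span_Un B(3) spE using u by blast
    qed
  qed
  have disj: "B \<inter> E ` B = {}"
  proof -
    have "0 \<notin> B" using B(2) dependent_zero by blast
    moreover have "E ` B \<subseteq> E ` W'" using BW' by (rule image_mono)
    ultimately have "x = 0" if "x \<in> B" "x \<in> E ` B" for x
      using int[of x] BW' that by (meson subsetD)
    with \<open>0 \<notin> B\<close> show ?thesis unfolding disjoint_iff by metis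
  qed
  have "dim W = card (B \<union> E ` B)"
    using dim_span_eq_card_independent[OF ind] sp by simp
  also have "\<dots> = 2 * dim W'"
    using B(1,4) disj card_image[OF inj_on_subset[OF injE, of B]] BW' W'W by (simp add: card_Un_disjoint)
  finally have "dim W = 2 * dim W'" .
  moreover have "clifford_ops W' Es Fs"
    unfolding clifford_ops_def
  proof (intro conjI)
    show "\<forall>X\<in>set (Es @ Fs). linear X \<and> (\<forall>x\<in>W'. X x \<in> W')"
      using rest JX unfolding W'_def by auto
    show "\<forall>E\<in>set Es. \<forall>x\<in>W'. E (E x) = x" "\<forall>F\<in>set Fs. \<forall>x\<in>W'. F (F x) = - x"
      using cl W'W unfolding clifford_ops_def by auto
    have "sorted_wrt (anticommute_on W) (Es @ Fs)"
      using cl unfolding clifford_ops_def by (auto simp: sorted_wrt_append)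
    then show "sorted_wrt (anticommute_on W') (Es @ Fs)"
      using sorted_wrt_mono_rel[of "Es @ Fs" "anticommute_on W" "anticommute_on W'"] W'W
      unfolding anticommute_on_def by blast
  qed
  ultimately show ?thesis using fW' by blast
qed

section \<open>Signatures, periodicity and divisibility of the dimension\<close>

definition clifford_rep :: "nat \<Rightarrow> nat \<Rightarrow> 'a::real_vector set \<Rightarrow> bool" where
  "clifford_rep p q W \<longleftrightarrow>
     findim_subspace W \<and> (\<exists>Es Fs. length Es = p \<and> length Fs = q \<and> clifford_ops W Es Fs)"

lemma clifford_rep_twist: "clifford_rep (Suc p) q W \<Longrightarrow> clifford_rep (Suc q) p W"
  unfolding clifford_rep_def
  by (metis (no_types, lifting) clifford_ops_twist length_Cons length_Suc_conv length_map)

lemma clifford_rep_halve: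
  fixes W :: "'a::real_vector set"
  shows "clifford_rep (Suc p) (Suc q) W \<Longrightarrow> \<exists>W'::'a set. clifford_rep p q W' \<and> dim W = 2 * dim W'"
  unfolding clifford_rep_def length_Suc_conv using clifford_ops_halve by blast

lemma length_Suc4_conv:
  "length xs = Suc (Suc (Suc (Suc n))) \<longleftrightarrow> (\<exists>a b c d ys. xs = a # b # c # d # ys \<and> length ys = n)"
  by (auto simp: length_Suc_conv)

lemma clifford_rep_neg_to_pos: "clifford_rep p (Suc (Suc (Suc (Suc q)))) W \<Longrightarrow> clifford_rep (p + 4) q W"
  unfolding clifford_rep_def length_Suc4_conv
  apply (elim conjE exE)
  subgoal for Es Fs a b c d ys
    using clifford_ops_neg_to_pos[of W Es a b c d ys]
    by (intro conjI exI[of _ "map ((\<circ>) (a \<circ> b \<circ> c \<circ> d)) [a, b, c, d] @ Es"] exI[of _ ys]) auto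
  done

lemma clifford_rep_0_drop: "clifford_rep 0 (Suc r) W \<Longrightarrow> clifford_rep 0 r W"
  unfolding clifford_rep_def length_Suc_conv clifford_ops_def by force

lemma clifford_rep_0_antimono: "r' \<le> r \<Longrightarrow> clifford_rep 0 r W \<Longrightarrow> clifford_rep 0 r' W"
  by (induction r) (auto simp: le_Suc_eq dest: clifford_rep_0_drop)

text \<open>The signatures run from (0, r + 8) to (4, r + 4), and each of four halvings consumes one
  generator of either sign.\<close>

lemma clifford_rep_periodicity:
  fixes W :: "'a::real_vector set"
  assumes "clifford_rep 0 (r + 8) W"
  shows "\<exists>W'::'a set. clifford_rep 0 r W' \<and> dim W = 16 * dim W'"
proof -
  have "clifford_rep (Suc (Suc (Suc (Suc 0)))) (Suc (Suc (Suc (Suc r)))) W"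
    using clifford_rep_neg_to_pos[of 0 "r + 4" W] assms by (simp add: numeral_eq_Suc)
  then obtain W1 W2 W3 W4 :: "'a set" where "dim W = 2 * dim W1" "dim W1 = 2 * dim W2" "dim W2 = 2 * dim W3"
    "dim W3 = 2 * dim W4" "clifford_rep 0 r W4"
    by (meson clifford_rep_halve)
  then show ?thesis by (intro exI[of _ W4]) simp
qed

lemma two_dvd_dim_clifford_rep: "clifford_rep 0 1 W \<Longrightarrow> 2 dvd dim W"
  unfolding clifford_rep_def using even_dim_complex_structure by (auto simp: length_Suc_conv)

lemma four_dvd_dim_clifford_rep: "clifford_rep 0 2 W \<Longrightarrow> 4 dvd dim W"
  unfolding clifford_rep_def using four_dvd_dim_quaternionic_structure
  by (auto simp: length_Suc_conv numeral_2_eq_2)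

text \<open>The signatures run from (0, 4) to (4, 0), then (1, 3), then (0, 2) in half the
  dimension, where the structure is quaternionic.\<close>

lemma eight_dvd_dim_clifford_rep:
  fixes W :: "'a::real_vector set"
  assumes "clifford_rep 0 4 W"
  shows "8 dvd dim W"
proof -
  have "clifford_rep (Suc (Suc (Suc (Suc 0)))) 0 W"
    using clifford_rep_neg_to_pos[of 0 0 W] assms by (simp add: numeral_eq_Suc)
  then have "clifford_rep (Suc 0) (Suc (Suc (Suc 0))) W"
    by (rule clifford_rep_twist)
  then obtain W' :: "'a set" where W': "clifford_rep 0 (Suc (Suc 0)) W'" "dim W = 2 * dim W'"
    using clifford_rep_halve by blast
  then have "4 dvd dim W'" using four_dvd_dim_clifford_rep by (simp add: numeral_2_eq_2)
  then show ?thesis unfolding W'(2) by auto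
qed

lemma hurwitz_radon_16: "N > 0 \<Longrightarrow> hurwitz_radon (16 * N) = hurwitz_radon N + 8"
proof -
  assume "N > 0"
  have "multiplicity 2 (16::nat) = 4"
    using multiplicity_same_power[of "2::nat" 4] by simp
  then have "multiplicity 2 (16 * N) = multiplicity 2 N + 4"
    using prime_elem_multiplicity_mult_distrib[of "2::nat" 16 N] \<open>N > 0\<close> by simp
  then show ?thesis unfolding hurwitz_radon_def Let_def by simp
qed

text \<open>For an exponent of 2 below 4 the value is the power itself; from 4 on, the summand 8 a
  alone reaches \<open>2 ^ 3\<close>.\<close>

lemma hurwitz_radon_ge:
  assumes "N > 0" "2 ^ k dvd N" "k \<le> 3"
  shows "2 ^ k \<le> hurwitz_radon N"
proof -
  let ?m = "multiplicity 2 N"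
  have k: "k \<le> ?m" using assms by (intro multiplicity_geI) auto
  show ?thesis
  proof (cases "?m < 4")
    case True
    then show ?thesis using k unfolding hurwitz_radon_def Let_def by (simp add: power_increasing)
  next
    case False
    then have "8 \<le> 8 * (?m div 4)" by (simp add: div_greater_zero_iff Suc_le_eq)
    moreover have "(2::nat) ^ k \<le> 2 ^ 3" using assms(3) by (intro power_increasing) auto
    ultimately show ?thesis unfolding hurwitz_radon_def Let_def by simp
  qed
qed

text \<open>Lowering r by 8 divides the dimension by 16, which lowers the Hurwitz-Radon value by
  exactly 8. For r below 8 the dimension is divisible by the least power of 2 that is at least r +
  1.\<close>

theorem anticommuting_complex_structures_hurwitz_radon:
  fixes W :: "'a::real_vector set"
  assumes "clifford_rep 0 r W" "dim W > 0"
  shows "r + 1 \<le> hurwitz_radon (dim W)"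
  using assms
proof (induction r arbitrary: W rule: less_induct)
  case (less r)
  consider "r \<ge> 8" | "r = 0" | "r = 1" | "r \<in> {2, 3}" | "r \<in> {4, 5, 6, 7}" by force
  then show ?case
  proof cases
    case 1
    then obtain r' where r': "r = r' + 8" by (metis le_add_diff_inverse2)
    then obtain W' :: "'a set" where W': "clifford_rep 0 r' W'" "dim W = 16 * dim W'"
      using clifford_rep_periodicity less.prems by blast
    then show ?thesis
      using less.IH[of r' W'] r' less.prems hurwitz_radon_16[of "dim W'"] by simp
  next
    case 2
    then show ?thesis using hurwitz_radon_ge[of "dim W" 0] less.prems by simp
  next
    case 3
    then show ?thesis
      using hurwitz_radon_ge[of "dim W" 1] less.prems two_dvd_dim_clifford_rep[of W] by simp
  next
    case 4
    then have "clifford_rep 0 2 W" using clifford_rep_0_antimono[of 2 r] less.prems by auto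
    then show ?thesis
      using 4 hurwitz_radon_ge[of "dim W" 2] less.prems four_dvd_dim_clifford_rep[of W] by auto
  next
    case 5
    then have "clifford_rep 0 4 W" using clifford_rep_0_antimono[of 4 r] less.prems by auto
    then show ?thesis
      using 5 hurwitz_radon_ge[of "dim W" 3] less.prems eight_dvd_dim_clifford_rep[of W] by auto
  qed
qed

text \<open>Twisting by one involution turns the signature (r + 2, 0) into (1, r + 1); halving then
  leaves r complex structures in dimension m.\<close>

lemma anticommuting_involutions_hurwitz_radon:
  fixes W :: "'a::real_vector set"
  assumes "clifford_rep (Suc (Suc r)) 0 W" "dim W = 2 * m" "m > 0"
  shows "r + 1 \<le> hurwitz_radon m"
proof -
  have "clifford_rep (Suc 0) (Suc r) W" using clifford_rep_twist assms(1) by blast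
  then obtain W' :: "'a set" where "clifford_rep 0 r W'" "dim W = 2 * dim W'"
    using clifford_rep_halve by blast
  then show ?thesis
    using anticommuting_complex_structures_hurwitz_radon[of r W'] assms by simp
qed

section \<open>Radial cubic algebras\<close>

text \<open>Together with commutativity, \<open>ip_mul\<close> makes \<open>ip x (mul y z)\<close> a
  totally symmetric trilinear form, the polarization of the cubic form
  \<open>ip x (mul x x)\<close>.\<close>

locale cubic_algebra =
  fixes ip :: "'a::real_vector \<Rightarrow> 'a \<Rightarrow> real" and mul :: "'a \<Rightarrow> 'a \<Rightarrow> 'a"
  assumes ip_commute: "ip x y = ip y x"
    and ip_add_left: "ip (x + y) z = ip x z + ip y z"
    and ip_scale_left: "ip (r *\<^sub>R x) z = r * ip x z"
    and mul_commute: "mul x y = mul y x"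
    and mul_add_left: "mul (x + y) z = mul x z + mul y z"
    and mul_scale_left: "mul (r *\<^sub>R x) z = r *\<^sub>R mul x z"
    and ip_mul: "ip (mul x y) z = ip x (mul y z)"
begin

lemma ip_add_right: "ip z (x + y) = ip z x + ip z y"
  using ip_add_left ip_commute by metis

lemma ip_scale_right: "ip z (r *\<^sub>R x) = r * ip z x"
  using ip_scale_left ip_commute by metis

lemma mul_add_right: "mul z (x + y) = mul z x + mul z y"
  using mul_add_left mul_commute by metis

lemma mul_scale_right: "mul z (r *\<^sub>R x) = r *\<^sub>R mul z x"
  using mul_scale_left mul_commute by metis

lemma ip_minus_left: "ip (- x) z = - ip x z"
  using ip_scale_left[of "-1" x z] by simp

lemma ip_minus_right: "ip z (- x) = - ip z x"
  using ip_scale_right[of z "-1" x] by simp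

lemma mul_minus_left: "mul (- x) z = - mul x z"
  using mul_scale_left[of "-1" x z] by simp

lemma mul_minus_right: "mul z (- x) = - mul z x"
  using mul_scale_right[of z "-1" x] by simp

lemma ip_diff_left: "ip (x - y) z = ip x z - ip y z"
  using ip_add_left[of x "- y" z] by (simp add: ip_minus_left)

lemma ip_diff_right: "ip z (x - y) = ip z x - ip z y"
  using ip_add_right[of z x "- y"] by (simp add: ip_minus_right)

lemma mul_diff_left: "mul (x - y) z = mul x z - mul y z"
  using mul_add_left[of x "- y" z] by (simp add: mul_minus_left)

lemma mul_diff_right: "mul z (x - y) = mul z x - mul z y"
  using mul_add_right[of z x "- y"] by (simp add: mul_minus_right)

lemmas bilinear = ip_diff_left ip_diff_right mul_diff_left mul_diff_right
  ip_add_left ip_add_right ip_scale_left ip_scale_right ip_minus_left ip_minus_right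
  mul_add_left mul_add_right mul_scale_left mul_scale_right mul_minus_left mul_minus_right

lemma ip_mul_swap: "ip (mul x y) z = ip y (mul x z)"
  using ip_mul mul_commute by metis

lemma ip_add_add: "ip (x + y) (x + y) = ip x x + 2 * ip x y + ip y y"
  using ip_commute[of y x] by (simp add: bilinear)

lemma mul_add_add: "mul (x + y) (x + y) = mul x x + 2 *\<^sub>R mul x y + mul y y"
  using mul_commute[of y x] by (simp add: bilinear scaleR_2 algebra_simps)

end

text \<open>Six evaluation points determine a polynomial of degree 5.\<close>

lemma poly_degree_5_eq_0:
  fixes c0 c1 c2 c3 c4 c5 :: real
  assumes "\<And>t. c0 + c1 * t + c2 * t^2 + c3 * t^3 + c4 * t^4 + c5 * t^5 = 0"
  shows "c0 = 0 \<and> c1 = 0 \<and> c2 = 0 \<and> c3 = 0 \<and> c4 = 0 \<and> c5 = 0"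
  using assms[of 0] assms[of 1] assms[of "-1"] assms[of 2] assms[of "-2"] assms[of 3]
  by simp

text \<open>The assumption \<open>radial\<close> is the eigencubic equation divided by 54, and
  \<open>tr\<close> is an abstract linear functional in place of the trace of the
  multiplication.\<close>

locale idempotent_cubic_algebra = cubic_algebra ip mul
  for ip :: "'a::real_vector \<Rightarrow> 'a \<Rightarrow> real" and mul :: "'a \<Rightarrow> 'a \<Rightarrow> 'a" +
  fixes tr :: "'a \<Rightarrow> real" and \<mu> :: real and e :: 'a
  assumes tr_add: "tr (x + y) = tr x + tr y"
    and tr_scale: "tr (r *\<^sub>R x) = r * tr x"
    and radial: "ip (mul x x) (mul x x) * tr x - ip (mul x x) (mul x (mul x x)) = \<mu> * ip x x * ip x (mul x x)"
    and idem: "mul e e = e"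
    and ip_e_e: "ip e e = 1"
begin

text \<open>Compare the coefficients of the powers of \<open>t\<close> in the radial equation at \<open>t e + y\<close>.\<close>

lemma radial_coefficients:
  assumes y: "ip e y = 0"
  defines "w \<equiv> mul e y"
  shows "tr e - 1 = \<mu>" "tr y = 0"
    and "tr e * (4 * ip w w + 2 * ip y w) - 2 * ip y w - 4 * ip w (mul e w) - 4 * ip w w
           = \<mu> * (ip y y + 3 * ip y w)"
    and "tr e * ip (mul y y) (mul y y) - ip (mul y y) (mul e (mul y y))
           - 4 * ip (mul y w) (mul y y) = \<mu> * ip y y * 3 * ip y w"
proof -
  define s where "s = mul y y"
  define q where "q = ip y w"
  have ew: "ip e w = 0" unfolding w_def ip_mul[symmetric] idem using y .
  have es: "ip e s = q" unfolding s_def q_def w_def by (metis ip_mul ip_commute)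
  have poly: "(tr y * ip s s - ip (mul y s) s - \<mu> * ip y y * ip y s)
      + (tr e * ip s s + 4 * tr y * ip w s - ip (mul e s) s - 4 * ip (mul y w) s - \<mu> * ip y y * 3 * q) * t
      + (4 * tr e * ip w s + tr y * (2 * q + 4 * ip w w) - 4 * ip (mul e w) s - 2 * ip w s
           - 4 * ip (mul y w) w - \<mu> * ip y s) * t^2
      + (tr e * (2 * q + 4 * ip w w) - 2 * q - 4 * ip (mul e w) w - 4 * ip w w - \<mu> * (ip y y + 3 * q)) * t^3
      + tr y * t^4 + (tr e - 1 - \<mu>) * t^5 = 0" for t :: real
  proof -
    define x where "x = t *\<^sub>R e + y"
    define v where "v = (2 * t) *\<^sub>R w + s"
    have xx: "mul x x = t\<^sup>2 *\<^sub>R e + v"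
      unfolding x_def mul_add_add by (simp add: v_def bilinear idem w_def s_def power2_eq_square)
    have ev: "ip e v = q" unfolding v_def by (simp add: bilinear ew es)
    have vv: "ip v v = 4 * t\<^sup>2 * ip w w + 4 * t * ip w s + ip s s"
      unfolding v_def ip_add_add by (simp add: bilinear power2_eq_square)
    have yv: "ip y v = 2 * t * q + ip y s" unfolding v_def by (simp add: bilinear q_def)
    have n: "ip (mul x x) (mul x x) = t^4 + 2 * t\<^sup>2 * q + ip v v"
      unfolding xx ip_add_add by (simp add: bilinear ip_e_e ev flip: power_add)
    have x1: "ip x (mul x x) = t^3 + t * q + ip y v"
      unfolding xx unfolding x_def using y ip_commute[of y e]
      by (simp add: bilinear ip_e_e ev power2_eq_square power3_eq_cube)
    have x2: "ip x x = t\<^sup>2 + ip y y"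
      unfolding x_def ip_add_add using y by (simp add: bilinear ip_e_e power2_eq_square)
    have m: "mul (mul x x) (mul x x) = t^4 *\<^sub>R e + (2 * t\<^sup>2) *\<^sub>R mul e v + mul v v"
      unfolding xx mul_add_add by (simp add: bilinear idem flip: power_add)
    have evv: "ip e (mul v v) = 4 * t\<^sup>2 * ip (mul e w) w + 4 * t * ip (mul e w) s + ip (mul e s) s"
    proof -
      have "ip e (mul v v) = ip (mul e v) v" by (simp add: ip_mul)
      moreover have "ip (mul e s) w = ip (mul e w) s"
        using ip_mul_swap[of e s w] ip_commute[of s "mul e w"] by simp
      ultimately show ?thesis
        unfolding v_def by (simp add: bilinear power2_eq_square algebra_simps)
    qed
    have yvv: "ip y (mul v v) = 4 * t\<^sup>2 * ip (mul y w) w + 4 * t * ip (mul y w) s + ip (mul y s) s"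
    proof -
      have "ip y (mul v v) = ip (mul y v) v" by (simp add: ip_mul)
      moreover have "ip (mul y s) w = ip (mul y w) s"
        using ip_mul_swap[of y s w] ip_commute[of s "mul y w"] by simp
      ultimately show ?thesis
        unfolding v_def by (simp add: bilinear power2_eq_square algebra_simps)
    qed
    have eev: "ip e (mul e v) = q" using ip_mul[of e e v] ev by (simp add: idem)
    have yev: "ip y (mul e v) = 2 * t * ip w w + ip w s"
    proof -
      have "ip y (mul e v) = ip w v" unfolding w_def using ip_mul[of y e v] mul_commute[of y e] by simp
      then show ?thesis unfolding v_def by (simp add: bilinear)
    qed
    have "ip (mul x x) (mul x (mul x x)) = ip x (mul (mul x x) (mul x x))"
      using ip_mul ip_commute by metis
    also have "\<dots> = t * t^4 + 2 * t^3 * q + t * ip e (mul v v) + 2 * t\<^sup>2 * ip y (mul e v) + ip y (mul v v)"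
      unfolding m unfolding x_def using y ip_commute[of y e]
      by (simp add: bilinear ip_e_e eev power2_eq_square power3_eq_cube algebra_simps)
    finally have c: "ip (mul x x) (mul x (mul x x)) =
      t * t^4 + 2 * t^3 * q + t * ip e (mul v v) + 2 * t\<^sup>2 * ip y (mul e v) + ip y (mul v v)" .
    have trx: "tr x = t * tr e + tr y" unfolding x_def by (simp add: tr_add tr_scale)
    have "(t^4 + 2 * t\<^sup>2 * q + (4 * t\<^sup>2 * ip w w + 4 * t * ip w s + ip s s)) * (t * tr e + tr y)
      - (t * t^4 + 2 * t^3 * q + t * (4 * t\<^sup>2 * ip (mul e w) w + 4 * t * ip (mul e w) s + ip (mul e s) s)
         + 2 * t\<^sup>2 * (2 * t * ip w w + ip w s)
         + (4 * t\<^sup>2 * ip (mul y w) w + 4 * t * ip (mul y w) s + ip (mul y s) s))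
      = \<mu> * (t\<^sup>2 + ip y y) * (t^3 + t * q + (2 * t * q + ip y s))"
      using radial[of x] unfolding c n x1 x2 trx vv yv evv yvv yev .
    then show ?thesis by Groebner_Basis.algebra
  qed
  \<comment> \<open>The four claims are the coefficients of t^5, t^4, t^3 and t, in this
    order.\<close>
  note coeffs = poly_degree_5_eq_0[OF poly]
  show "tr e - 1 = \<mu>" "tr y = 0" using coeffs by auto
  have c3: "ip (mul e w) w = ip w (mul e w)" by (rule ip_commute)
  have "tr e * (2 * q + 4 * ip w w) - 2 * q - 4 * ip (mul e w) w - 4 * ip w w - \<mu> * (ip y y + 3 * q) = 0"
    using coeffs by blast
  then show "tr e * (4 * ip w w + 2 * ip y w) - 2 * ip y w - 4 * ip w (mul e w) - 4 * ip w w
           = \<mu> * (ip y y + 3 * ip y w)"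
    unfolding c3 q_def by Groebner_Basis.algebra
  have c1: "ip (mul e s) s = ip s (mul e s)" by (rule ip_commute)
  have "tr e * ip s s + 4 * tr y * ip w s - ip (mul e s) s - 4 * ip (mul y w) s - \<mu> * ip y y * 3 * q = 0"
    using coeffs by blast
  then show "tr e * ip (mul y y) (mul y y) - ip (mul y y) (mul e (mul y y))
           - 4 * ip (mul y w) (mul y y) = \<mu> * ip y y * 3 * ip y w"
    using \<open>tr y = 0\<close> unfolding c1 q_def unfolding s_def by simp
qed

end

section \<open>Eigenvectors of the idempotent\<close>

context idempotent_cubic_algebra
begin

lemma eigenvectors_orthogonal:
  assumes "mul e x = a *\<^sub>R x" "mul e y = b *\<^sub>R y" "a \<noteq> b"
  shows "ip x y = 0"
proof -
  have "a * ip x y = b * ip x y"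
    using ip_mul_swap[of e x y] assms(1,2) by (simp add: bilinear)
  then show ?thesis using assms(3) by simp
qed

lemma eigenvector_orthogonal_e:
  assumes "mul e x = a *\<^sub>R x" "a \<noteq> 1"
  shows "ip e x = 0"
  using eigenvectors_orthogonal[of e 1 x a] idem assms by simp

text \<open>At y = u the t^3 coefficient reads 2 tr e + 2 = - 2 \<open>\<mu>\<close>; combined with
  tr e - 1 = \<open>\<mu>\<close> it determines both numbers.\<close>

lemma trace_zero:
  assumes u: "mul e u = - u" and n: "ip u u = 1"
  shows "tr e = 0" "\<mu> = -1" "\<And>y. ip e y = 0 \<Longrightarrow> tr y = 0"
proof -
  have eu: "ip e u = 0" using eigenvector_orthogonal_e[of u "-1"] u by simp
  have "tr e - 1 = \<mu>" "tr e * 2 + 2 = - 2 * \<mu>"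
    using radial_coefficients(1,3)[OF eu] by (simp_all add: u n bilinear)
  then show "tr e = 0" "\<mu> = -1" by simp_all
qed (use radial_coefficients in blast)

lemma linear_coefficient:
  assumes u: "mul e u = - u" "ip u u = 1" and y: "ip e y = 0"
  shows "ip (mul y y) (mul e (mul y y)) + 4 * ip (mul y (mul e y)) (mul y y) = 3 * ip y y * ip y (mul e y)"
  using radial_coefficients(4)[OF y] trace_zero(1,2)[OF u] by simp

text \<open>This is the s^2 part of \<open>linear_coefficient\<close> at s x + z. It isolates what
  is quadratic in z for a fixed x, that is, a statement about the operator of multiplication by
  x.\<close>

lemma quadratic_coefficient:
  assumes u: "mul e u = - u" "ip u u = 1"
    and x: "mul e x = - x" "mul x x = - ip x x *\<^sub>R e" and z: "ip e z = 0" "ip x z = 0"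
  defines "g \<equiv> mul x z" and "w \<equiv> mul e z" and "a \<equiv> ip x x"
  shows "4 * ip g (mul e g) + 8 * ip (mul x w) g - 8 * ip g g = a * ip z w - 3 * a * ip z z + 4 * a * ip w w"
proof -
  define h where "h = mul z z"
  define l where "l = mul z w"
  define k where "k = mul x w"
  have ex: "ip e x = 0" using eigenvector_orthogonal_e[of x "-1"] x by simp
  have xw: "ip x w = 0" unfolding w_def using ip_mul[of x e z] mul_commute[of x e] x(1) z(2) by (simp add: bilinear)
  have eg: "ip e g = 0" unfolding g_def using ip_mul[of e x z] x(1) z(2) by (simp add: bilinear)
  have ge: "ip g e = 0" using eg ip_commute by metis
  have eeg: "ip e (mul e g) = 0" using ip_mul[of e e g] eg idem by simp
  have eh: "ip e h = ip z w" unfolding h_def w_def by (metis ip_mul ip_commute)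
  have he: "ip h e = ip z w" using eh ip_commute by metis
  have eeh: "ip e (mul e h) = ip z w" using ip_mul[of e e h] eh idem by simp
  have el: "ip e l = ip w w" unfolding l_def w_def by (metis ip_mul)
  have le: "ip l e = ip w w" using el ip_commute by metis
  have ek: "ip e k = 0" unfolding k_def using ip_mul[of e x w] x(1) xw by (simp add: bilinear)
  have ke: "ip k e = 0" using ek ip_commute by metis
  \<comment> \<open>Because x x is a multiple of e, the terms in s^4 cancel as 1 - 4 + 3; the zero
    summands give the sum the shape required by \<open>poly_degree_5_eq_0\<close>.\<close>
  have "ip h (mul e h) + 4 * ip l h - 3 * ip z z * ip z w
      + (2 * ip g (mul e h) + 2 * ip h (mul e g) + 4 * (2 * ip l g + ip (k - g) h)) * s
      + (4 * ip g (mul e g) - 2 * a * ip z w + 4 * (a * ip z w + 2 * ip (k - g) g - a * ip w w)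
          - 3 * a * (ip z w - ip z z)) * s^2 + 0 * s^3 + 0 * s^4 + 0 * s^5 = 0" for s
  proof -
    define y where "y = s *\<^sub>R x + z"
    have ey: "ip e y = 0" unfolding y_def using ex z by (simp add: bilinear)
    have w': "mul e y = - s *\<^sub>R x + w" unfolding y_def w_def by (simp add: bilinear x)
    have yy: "mul y y = (- s\<^sup>2 * a) *\<^sub>R e + ((2 * s) *\<^sub>R g + h)"
      unfolding y_def mul_add_add by (simp add: bilinear x a_def g_def h_def power2_eq_square)
    have eyy: "mul e (mul y y) = (- s\<^sup>2 * a) *\<^sub>R e + ((2 * s) *\<^sub>R mul e g + mul e h)"
      unfolding yy by (simp add: bilinear idem)
    have yw: "mul y (mul e y) = (s\<^sup>2 * a) *\<^sub>R e + (s *\<^sub>R (k - g) + l)"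
      unfolding w' unfolding y_def using mul_commute[of z x]
      by (simp add: bilinear x k_def g_def l_def a_def power2_eq_square algebra_simps)
    have ns: "ip y y = s\<^sup>2 * a + ip z z"
      unfolding y_def ip_add_add by (simp add: bilinear z a_def power2_eq_square)
    have nw: "ip y (mul e y) = - s\<^sup>2 * a + ip z w"
      unfolding w' unfolding y_def using z(2) ip_commute[of z x] by (simp add: bilinear xw a_def power2_eq_square)
    have "ip (mul y y) (mul e (mul y y)) = s^4 * a^2 - 2 * s^2 * a * ip z w + 4 * s^2 * ip g (mul e g)
      + 2 * s * ip g (mul e h) + 2 * s * ip h (mul e g) + ip h (mul e h)"
      unfolding eyy unfolding yy
      by (simp add: bilinear ip_e_e eeg ge he eeh power2_eq_square power4_eq_xxxx algebra_simps)
    moreover have "ip (mul y (mul e y)) (mul y y) = - (s^4) * a^2 + s^2 * a * ip z w - s^2 * a * ip w w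
      + 2 * s^2 * ip (k - g) g + s * ip (k - g) h + 2 * s * ip l g + ip l h"
      unfolding yw unfolding yy
      by (simp add: bilinear ip_e_e eg ge ke eh le power2_eq_square power4_eq_xxxx algebra_simps)
    ultimately show ?thesis
      using linear_coefficient[OF u ey] unfolding ns nw by (simp only:) Groebner_Basis.algebra
  qed
  from poly_degree_5_eq_0[OF this]
  have "4 * ip g (mul e g) - 2 * a * ip z w + 4 * (a * ip z w + 2 * ip (k - g) g - a * ip w w)
          - 3 * a * (ip z w - ip z z) = 0" by blast
  moreover have "ip (k - g) g = ip k g - ip g g"
    using ip_add_left[of k "- g" g] by (simp add: bilinear)
  ultimately show ?thesis unfolding k_def by (simp add: algebra_simps)
qed

text \<open>With \<open>x\<close> in \<open>V\<^sub>1\<close>, \<open>y\<close> in \<open>V\<^sub>2\<close>, \<open>z\<close> in \<open>V\<^sub>3\<close> and the components \<open>p\<close>, \<open>r\<close> of \<open>x z\<close> in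
  \<open>V\<^sub>2\<close> and \<open>V\<^sub>3\<close>, these are the three parts of \<open>|x y + p + r / \<surd>3|\<^sup>2 = |x|\<^sup>2 (|y|\<^sup>2 + |z|\<^sup>2) / 4\<close>.\<close>

lemma eigenspace_norms:
  assumes u: "mul e u = - u" "ip u u = 1"
    and x: "mul e x = - x" "mul x x = - ip x x *\<^sub>R e"
    and y: "mul e y = (-1/2) *\<^sub>R y" and xy: "mul e (mul x y) = (1/2) *\<^sub>R mul x y"
    and z: "mul e z = (1/2) *\<^sub>R z" and xz: "mul x z = p + r" "mul e p = (-1/2) *\<^sub>R p" "mul e r = (1/2) *\<^sub>R r"
  shows "ip (mul x y) (mul x y) = ip x x * ip y y / 4"
    and "ip p p + ip r r / 3 = ip x x * ip z z / 4"
    and "ip (mul x y) r = 0"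
proof -
  have ex: "mul e x = (-1) *\<^sub>R x" using x by simp
  have o: "ip e y = 0" "ip x y = 0" "ip e z = 0" "ip x z = 0" "ip y z = 0"
    "ip p r = 0" "ip p (mul x y) = 0"
    using eigenvector_orthogonal_e[OF y] eigenvector_orthogonal_e[OF z] eigenvectors_orthogonal[OF ex y]
      eigenvectors_orthogonal[OF ex z] eigenvectors_orthogonal[OF y z] eigenvectors_orthogonal[OF xz(2,3)]
      eigenvectors_orthogonal[OF xz(2) xy] by auto
  then have o': "ip r p = 0" "ip (mul x y) p = 0" "ip z y = 0" using ip_commute by metis+
  define U where "U = mul x y"
  have eU: "mul e U = (1/2) *\<^sub>R U" unfolding U_def by (rule xy)
  note oU = o(7)[folded U_def] o'(2)[folded U_def]
  define c where "c = ip U r"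
  have rU: "ip r U = c" unfolding c_def by (rule ip_commute)
  have Y: "ip U U = ip x x * ip y y / 4"
    using quadratic_coefficient[OF u x o(1,2)] unfolding U_def[symmetric]
    by (simp add: bilinear y xy eU U_def[symmetric])
  then show "ip (mul x y) (mul x y) = ip x x * ip y y / 4" unfolding U_def .
  have Z: "ip p p + ip r r / 3 = ip x x * ip z z / 4"
    using quadratic_coefficient[OF u x o(3,4)]
    by (simp add: bilinear z xz o o' algebra_simps)
  then show "ip p p + ip r r / 3 = ip x x * ip z z / 4" .
  have yz: "ip e (y + z) = 0" "ip x (y + z) = 0" using o by (simp_all add: bilinear)
  \<comment> \<open>Against the sum of the identities for y and for z, the one for y + z has the
    surplus 4 c - 16 c on the left and none on the right, so c = 0.\<close>
  have "4 * (ip U U / 2 - ip p p / 2 + ip r r / 2 + c) + 8 * (- ip U U / 2 + ip p p / 2 + ip r r / 2)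
      - 8 * (ip U U + ip p p + ip r r + 2 * c)
    = ip x x * (- ip y y / 2 + ip z z / 2) - 3 * ip x x * (ip y y + ip z z) + ip x x * (ip y y + ip z z)"
    using quadratic_coefficient[OF u x yz]
    by (simp add: bilinear y z xz U_def[symmetric] eU o o' oU rU c_def[symmetric] field_simps)
  then have "c = 0" using Y Z by (simp add: field_simps)
  then show "ip (mul x y) r = 0" unfolding c_def U_def .
qed

end

text \<open>Since \<open>\<langle>z, A z\<rangle>\<close> equals three times the pairing of x with z
  z, the product x z is A z / 3 for the Clifford operator A of x; this explains the 1/9 in
  \<open>norm\<close>. The factor 4/27 becomes the eigenvalue -8 through the factor 54 of
  \<open>L_op_tensor\<close>.\<close>

lemma (in cubic_algebra) clifford_algebra_radial:
  assumes sums: "\<And>x x'. x \<in> X \<Longrightarrow> x' \<in> X \<Longrightarrow> x + x' \<in> X" "\<And>z z'. z \<in> Z \<Longrightarrow> z' \<in> Z \<Longrightarrow> z + z' \<in> Z"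
    and XX: "\<And>x x'. x \<in> X \<Longrightarrow> x' \<in> X \<Longrightarrow> mul x x' = 0"
    and XZ: "\<And>x z. x \<in> X \<Longrightarrow> z \<in> Z \<Longrightarrow> mul x z \<in> Z"
    and ZZ: "\<And>z z'. z \<in> Z \<Longrightarrow> z' \<in> Z \<Longrightarrow> mul z z' \<in> X"
    and orth: "\<And>x z. x \<in> X \<Longrightarrow> z \<in> Z \<Longrightarrow> ip x z = 0"
    and norm: "\<And>x z. x \<in> X \<Longrightarrow> z \<in> Z \<Longrightarrow> ip (mul x z) (mul x z) = ip x x * ip z z / 9"
    and x: "x \<in> X" and z: "z \<in> Z"
  shows "ip (mul (x + z) (x + z)) (mul (x + z) (mul (x + z) (x + z))) =
    4 / 27 * ip (x + z) (x + z) * ip (x + z) (mul (x + z) (x + z))"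
proof -
  define g where "g = mul x z"
  define h where "h = mul z z"
  define c where "c = ip x h"
  have g: "g \<in> Z" and h: "h \<in> X" unfolding g_def h_def using XZ ZZ x z by auto
  have ss: "mul (x + z) (x + z) = 2 *\<^sub>R g + h"
    unfolding mul_add_add using XX[OF x x] by (simp add: g_def h_def)
  have zg: "ip z g = c"
    unfolding c_def g_def h_def by (metis ip_mul ip_commute)
  have zh: "ip z h = 0" using orth[OF h z] ip_commute by metis
  have l: "ip (x + z) (2 *\<^sub>R g + h) = 3 * c"
    by (simp add: bilinear orth[OF x g] c_def[symmetric] zg zh)
  have nn: "ip (x + z) (x + z) = ip x x + ip z z"
    unfolding ip_add_add by (simp add: orth[OF x z])
  \<comment> \<open>Both mixed terms come from polarizing \<open>norm\<close>: here in the second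
    argument at z and g = x z, and for \<open>zgh\<close> in the first argument at x and h = z
    z.\<close>
  have xgg: "ip x (mul g g) = ip x x * c / 9"
  proof -
    have "ip (mul x (z + g)) (mul x (z + g)) = ip g g + 2 * ip g (mul x g) + ip (mul x g) (mul x g)"
      unfolding mul_add_right ip_add_add g_def ..
    then have "2 * ip g (mul x g) = ip x x * (ip (z + g) (z + g) - ip z z - ip g g) / 9"
      unfolding norm[OF x sums(2)[OF z g]] norm[OF x g]
      using norm[OF x z] unfolding g_def[symmetric] by (simp add: algebra_simps)
    then have "ip g (mul x g) = ip x x * c / 9"
      unfolding ip_add_add zg by (simp add: mult.commute)
    then show ?thesis by (metis ip_mul ip_commute)
  qed
  have zgh: "ip z (mul g h) = c * ip z z / 9"
  proof -
    have "ip (mul (x + h) z) (mul (x + h) z) = ip g g + 2 * ip g (mul h z) + ip (mul h z) (mul h z)"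
      unfolding mul_add_left ip_add_add g_def ..
    then have "2 * ip g (mul h z) = (ip (x + h) (x + h) - ip x x - ip h h) * ip z z / 9"
      unfolding norm[OF sums(1)[OF x h] z] norm[OF h z]
      using norm[OF x z] unfolding g_def[symmetric] by (simp add: algebra_simps)
    then have "ip g (mul h z) = c * ip z z / 9"
      unfolding ip_add_add c_def by simp
    then show ?thesis by (metis ip_mul ip_commute)
  qed
  have "ip (mul (x + z) (x + z)) (mul (x + z) (mul (x + z) (x + z)))
      = ip (x + z) (mul (mul (x + z) (x + z)) (mul (x + z) (x + z)))"
    by (metis ip_mul ip_commute)
  also have "\<dots> = ip (x + z) (4 *\<^sub>R mul g g + 4 *\<^sub>R mul g h)"
    unfolding ss mul_add_add[of "2 *\<^sub>R g" h] using XX[OF h h] by (simp add: bilinear)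
  also have "\<dots> = 4 * (ip x x * c / 9) + 4 * (c * ip z z / 9)"
    using orth[OF x] orth[of _ z] XZ[OF h g, unfolded mul_commute[of h g]] ip_commute[of z "mul g g"] ZZ[OF g g] z
    by (simp add: bilinear xgg zgh)
  also have "\<dots> = 4 / 27 * ip (x + z) (x + z) * ip (x + z) (mul (x + z) (x + z))"
    unfolding ss l nn by (simp add: algebra_simps)
  finally show ?thesis .
qed

section \<open>Cubic forms in coordinates\<close>

text \<open>Coordinate vectors are functions on \<open>nat\<close>, so that \<open>linear\<close>,
  \<open>span\<close> and \<open>dim\<close> apply although the dimensions are terms and not
  types.\<close>

instantiation "fun" :: (type, real_vector) real_vector
begin

definition scaleR_fun :: "real \<Rightarrow> ('a \<Rightarrow> 'b) \<Rightarrow> 'a \<Rightarrow> 'b" where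
  "scaleR_fun r f = (\<lambda>x. r *\<^sub>R f x)"

instance
  by standard (auto simp: scaleR_fun_def fun_eq_iff scaleR_add_right scaleR_add_left)

end

lemma scaleR_fun_apply [simp]: "(r *\<^sub>R f) x = r *\<^sub>R f x"
  by (simp add: scaleR_fun_def)

lemma sum_fun_apply: "(\<Sum>i\<in>I. f i) x = (\<Sum>i\<in>I. f i x)" for f :: "'i \<Rightarrow> 'a \<Rightarrow> 'b::comm_monoid_add"
  by (induction I rule: infinite_finite_induct) auto

definition dotp :: "nat \<Rightarrow> (nat \<Rightarrow> real) \<Rightarrow> (nat \<Rightarrow> real) \<Rightarrow> real" where
  "dotp n x y = (\<Sum>i<n. x i * y i)"

text \<open>The cut-off at n makes every product a supported function, hence determined by its inner
  products with a basis.\<close>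

definition tensor_mul ::
    "nat \<Rightarrow> (nat \<Rightarrow> nat \<Rightarrow> nat \<Rightarrow> real) \<Rightarrow> (nat \<Rightarrow> real) \<Rightarrow> (nat \<Rightarrow> real) \<Rightarrow> nat \<Rightarrow> real" where
  "tensor_mul n c x y = (\<lambda>k. if k < n then \<Sum>i<n. \<Sum>j<n. c i j k * x i * y j else 0)"

definition tensor_trace :: "nat \<Rightarrow> (nat \<Rightarrow> nat \<Rightarrow> nat \<Rightarrow> real) \<Rightarrow> (nat \<Rightarrow> real) \<Rightarrow> real" where
  "tensor_trace n c x = (\<Sum>k<n. \<Sum>i<n. c k i i * x k)"

definition unit_fun :: "nat \<Rightarrow> nat \<Rightarrow> real" where
  "unit_fun i = (\<lambda>k. if k = i then 1 else 0)"

text \<open>The coordinates of a vector, cut off at its dimension because the index function of a vector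
  is unspecified beyond it.\<close>

definition vec_fun :: "real vec \<Rightarrow> nat \<Rightarrow> real" where
  "vec_fun x = (\<lambda>i. if i < dim_vec x then x $ i else 0)"

definition supported :: "nat \<Rightarrow> (nat \<Rightarrow> real) \<Rightarrow> bool" where
  "supported n x \<longleftrightarrow> (\<forall>i\<ge>n. x i = 0)"

lemma dotp_unit: "i < n \<Longrightarrow> dotp n (unit_fun i) x = x i" "i < n \<Longrightarrow> dotp n x (unit_fun i) = x i"
proof -
  have "unit_fun i k * x k = (if k = i then x k else 0)" "x k * unit_fun i k = (if k = i then x k else 0)" for k
    by (simp_all add: unit_fun_def)
  then show "i < n \<Longrightarrow> dotp n (unit_fun i) x = x i" "i < n \<Longrightarrow> dotp n x (unit_fun i) = x i"
    by (simp_all add: dotp_def)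
qed

lemma vec_fun_scalar_prod: "x \<in> carrier_vec n \<Longrightarrow> y \<in> carrier_vec n \<Longrightarrow> dotp n (vec_fun x) (vec_fun y) = x \<bullet> y"
  by (auto simp: dotp_def vec_fun_def scalar_prod_def atLeast0LessThan intro!: sum.cong)

lemma vec_fun_add_unit:
  "x \<in> carrier_vec n \<Longrightarrow> i < n \<Longrightarrow> vec_fun (x + t \<cdot>\<^sub>v unit_vec n i) = vec_fun x + t *\<^sub>R unit_fun i"
  by (auto simp: vec_fun_def unit_fun_def fun_eq_iff)

lemma supported_vec_fun: "x \<in> carrier_vec n \<Longrightarrow> supported n (vec_fun x)"
  by (auto simp: supported_def vec_fun_def)

lemma supported_tensor_mul: "supported n (tensor_mul n c x y)"
  by (simp add: supported_def tensor_mul_def)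

lemma supported_eqI: "supported n x \<Longrightarrow> supported n y \<Longrightarrow> (\<And>i. i < n \<Longrightarrow> x i = y i) \<Longrightarrow> x = y"
  unfolding supported_def fun_eq_iff by (metis not_le_imp_less)

definition symmetric_tensor :: "(nat \<Rightarrow> nat \<Rightarrow> nat \<Rightarrow> real) \<Rightarrow> bool" where
  "symmetric_tensor c \<longleftrightarrow> (\<forall>i j k. c i j k = c j i k \<and> c i j k = c i k j)"

lemma dotp_tensor_mul:
  "dotp n x (tensor_mul n c y z) = (\<Sum>i<n. \<Sum>j<n. \<Sum>k<n. c j k i * x i * y j * z k)"
  unfolding dotp_def tensor_mul_def by (intro sum.cong refl) (simp add: sum_distrib_left algebra_simps)

lemma cubic_algebra_tensor:
  assumes c: "symmetric_tensor c"
  shows "cubic_algebra (dotp n) (tensor_mul n c)"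
proof
  fix x y z :: "nat \<Rightarrow> real" and r :: real
  show "dotp n x y = dotp n y x" by (simp add: dotp_def mult.commute)
  show "dotp n (x + y) z = dotp n x z + dotp n y z"
    by (simp add: dotp_def algebra_simps sum.distrib)
  show "dotp n (r *\<^sub>R x) z = r * dotp n x z"
    by (simp add: dotp_def sum_distrib_left algebra_simps)
  have "(\<Sum>i<n. \<Sum>j<n. c i j k * x i * y j) = (\<Sum>i<n. \<Sum>j<n. c i j k * y i * x j)" for k
    using c unfolding symmetric_tensor_def
    by (subst sum.swap) (intro sum.cong refl, metis mult.commute mult.assoc)
  then show "tensor_mul n c x y = tensor_mul n c y x"
    unfolding tensor_mul_def by auto
  show "tensor_mul n c (x + y) z = tensor_mul n c x z + tensor_mul n c y z"
    by (auto simp: tensor_mul_def fun_eq_iff algebra_simps sum.distrib)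
  show "tensor_mul n c (r *\<^sub>R x) z = r *\<^sub>R tensor_mul n c x z"
    by (auto simp: tensor_mul_def fun_eq_iff sum_distrib_left algebra_simps)
  have "dotp n (tensor_mul n c x y) z = dotp n z (tensor_mul n c x y)"
    by (simp add: dotp_def mult.commute)
  also have "\<dots> = (\<Sum>k<n. \<Sum>i<n. \<Sum>j<n. c i j k * z k * x i * y j)"
    unfolding dotp_tensor_mul ..
  also have "\<dots> = (\<Sum>i<n. \<Sum>k<n. \<Sum>j<n. c i j k * z k * x i * y j)"
    by (rule sum.swap)
  also have "\<dots> = (\<Sum>i<n. \<Sum>j<n. \<Sum>k<n. c i j k * z k * x i * y j)"
    by (intro sum.cong refl sum.swap)
  also have "\<dots> = (\<Sum>i<n. \<Sum>j<n. \<Sum>k<n. c j k i * x i * y j * z k)"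
  proof (intro sum.cong refl)
    fix i j k
    have "c i j k = c j k i" using c unfolding symmetric_tensor_def by metis
    then show "c i j k * z k * x i * y j = c j k i * x i * y j * z k" by simp
  qed
  also have "\<dots> = dotp n x (tensor_mul n c y z)" unfolding dotp_tensor_mul ..
  finally show "dotp n (tensor_mul n c x y) z = dotp n x (tensor_mul n c y z)" .
qed

lemma tensor_trace_add: "tensor_trace n c (x + y) = tensor_trace n c x + tensor_trace n c y"
  by (simp add: tensor_trace_def algebra_simps sum.distrib)

lemma tensor_trace_scale: "tensor_trace n c (r *\<^sub>R x) = r * tensor_trace n c x"
  by (simp add: tensor_trace_def sum_distrib_left algebra_simps)

lemma tensor_trace_eq:
  assumes "symmetric_tensor c"
  shows "tensor_trace n c x = (\<Sum>i<n. dotp n (unit_fun i) (tensor_mul n c x (unit_fun i)))"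
proof -
  have "dotp n (unit_fun i) (tensor_mul n c x (unit_fun i)) = (\<Sum>k<n. c k i i * x k)" if "i < n" for i
    unfolding dotp_unit(1)[OF that] using that by (simp add: tensor_mul_def unit_fun_def if_distrib cong: if_cong)
  then show ?thesis
    unfolding tensor_trace_def by (subst sum.swap) (intro sum.cong refl, simp)
qed

section \<open>Symmetric tensors of cubic forms and the operator \<open>L_op\<close>\<close>

lemma symmetrize_cubic_form:
  assumes "cubic_form n f"
  obtains c where "symmetric_tensor c"
    "\<And>x. x \<in> carrier_vec n \<Longrightarrow> f x = dotp n (vec_fun x) (tensor_mul n c (vec_fun x) (vec_fun x))"
proof -
  obtain b where b: "\<And>x. x \<in> carrier_vec n \<Longrightarrow>
      f x = (\<Sum>i<n. \<Sum>j<n. \<Sum>k<n. b i j k * x $ i * x $ j * x $ k)"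
    using assms unfolding cubic_form_def by blast
  define c where "c i j k = (b i j k + b i k j + b j i k + b j k i + b k i j + b k j i) / 6" for i j k
  have c: "symmetric_tensor c" unfolding symmetric_tensor_def c_def by simp
  moreover have "f x = dotp n (vec_fun x) (tensor_mul n c (vec_fun x) (vec_fun x))" if x: "x \<in> carrier_vec n" for x
  proof -
    define X where "X = vec_fun x"
    \<comment> \<open>The value of the cubic form as a function of its tensor; two transpositions of
      indices generate all six permutations, and none of them changes the value.\<close>
    define S where "S b = (\<Sum>i<n. \<Sum>j<n. \<Sum>k<n. b i j k * X i * X j * X k)" for b
    have sw12: "S (\<lambda>i j k. b j i k) = S b" for b
      unfolding S_def by (subst sum.swap) (intro sum.cong refl, simp)
    have sw23: "S (\<lambda>i j k. b i k j) = S b" for b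
      unfolding S_def by (rule sum.cong[OF refl], subst sum.swap) (intro sum.cong refl, simp)
    have 1: "S (\<lambda>i j k. b j i k) = S b" "S (\<lambda>i j k. b i k j) = S b"
      using sw12 sw23 by auto
    have 2: "S (\<lambda>i j k. b j k i) = S b"
      using sw12[of "\<lambda>i j k. b i k j"] sw23[of b] by simp
    have 3: "S (\<lambda>i j k. b k i j) = S b"
      using sw23[of "\<lambda>i j k. b j i k"] sw12[of b] by simp
    have 4: "S (\<lambda>i j k. b k j i) = S b"
      using sw12[of "\<lambda>i j k. b k i j"] 3 by simp
    have "dotp n X (tensor_mul n c X X) = S c"
    proof -
      have "c j k i = c i j k" for i j k using c unfolding symmetric_tensor_def by metis
      then show ?thesis unfolding dotp_tensor_mul S_def by simp
    qed
    also have "\<dots> = (S b + S (\<lambda>i j k. b i k j) + S (\<lambda>i j k. b j i k) + S (\<lambda>i j k. b j k i)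
        + S (\<lambda>i j k. b k i j) + S (\<lambda>i j k. b k j i)) / 6"
      unfolding S_def c_def by (simp add: algebra_simps sum.distrib sum_divide_distrib add_divide_distrib)
    also have "\<dots> = S b" unfolding 1 2 3 4 by simp
    also have "\<dots> = f x" unfolding S_def b[OF x] X_def vec_fun_def using x by (intro sum.cong refl) auto
    finally show ?thesis unfolding X_def by simp
  qed
  ultimately show ?thesis using that by blast
qed

lemma deriv_cubic_at_0: "deriv (\<lambda>t::real. a + b * t + c * t\<^sup>2 + d * t^3) 0 = b"
  by (rule DERIV_imp_deriv) (auto intro!: derivative_eq_intros)

lemma partial_deriv_cong:
  assumes "\<And>x. x \<in> carrier_vec n \<Longrightarrow> f x = g x" "x \<in> carrier_vec n"
  shows "partial_deriv n i f x = partial_deriv n i g x"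
proof -
  have "f (x + t \<cdot>\<^sub>v unit_vec n i) = g (x + t \<cdot>\<^sub>v unit_vec n i)" for t
    using assms by (intro assms(1)) auto
  then show ?thesis unfolding partial_deriv_def by simp
qed

lemma L_op_cong:
  assumes "\<And>x. x \<in> carrier_vec n \<Longrightarrow> f x = g x" "x \<in> carrier_vec n"
  shows "L_op n f x = L_op n g x"
proof -
  have 1: "partial_deriv n i f y = partial_deriv n i g y" if "y \<in> carrier_vec n" for i y
    using partial_deriv_cong[of n f g] assms(1) that by blast
  have "partial_deriv n j (partial_deriv n i f) x = partial_deriv n j (partial_deriv n i g) x" for i j
    using partial_deriv_cong[OF 1 assms(2)] .
  then show ?thesis unfolding L_op_def using 1[OF assms(2)] by simp
qed

lemma tensor_mul_unit_sum:
  assumes "i < n"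
  shows "(\<Sum>j<n. y j * tensor_mul n c x (unit_fun j) i) = tensor_mul n c x y i"
proof -
  have "tensor_mul n c x (unit_fun j) i = (\<Sum>k<n. c k j i * x k)" if "j < n" for j
    using that \<open>i < n\<close> by (simp add: tensor_mul_def unit_fun_def if_distrib cong: if_cong)
  then have "(\<Sum>j<n. y j * tensor_mul n c x (unit_fun j) i) = (\<Sum>j<n. \<Sum>k<n. c k j i * x k * y j)"
    by (intro sum.cong refl) (simp add: sum_distrib_left algebra_simps)
  also have "\<dots> = tensor_mul n c x y i"
    unfolding tensor_mul_def using \<open>i < n\<close> by (subst sum.swap) simp
  finally show ?thesis .
qed

text \<open>The gradient at x is 3 x x and the Hessian is 6 times the multiplication by x, so both
  terms of \<open>L_op\<close> carry the factor 9 * 6 = 54.\<close>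

lemma L_op_tensor:
  assumes c: "symmetric_tensor c"
    and f: "\<And>x. x \<in> carrier_vec n \<Longrightarrow> f x = dotp n (vec_fun x) (tensor_mul n c (vec_fun x) (vec_fun x))"
    and x: "x \<in> carrier_vec n"
  defines "X \<equiv> vec_fun x"
  shows "L_op n f x = 54 * (dotp n (tensor_mul n c X X) (tensor_mul n c X X) * tensor_trace n c X
    - dotp n (tensor_mul n c X X) (tensor_mul n c X (tensor_mul n c X X)))"
proof -
  interpret cubic_algebra "dotp n" "tensor_mul n c" by (rule cubic_algebra_tensor[OF c])
  let ?m = "tensor_mul n c"
  have d1: "partial_deriv n i f y = 3 * ?m (vec_fun y) (vec_fun y) i" if y: "y \<in> carrier_vec n" and i: "i < n" for y i
  proof -
    let ?Y = "vec_fun y" and ?u = "unit_fun i"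
    have "f (y + t \<cdot>\<^sub>v unit_vec n i) = dotp n ?Y (?m ?Y ?Y) + (3 * ?m ?Y ?Y i) * t
        + (3 * dotp n ?Y (?m ?u ?u)) * t\<^sup>2 + dotp n ?u (?m ?u ?u) * t^3" for t
    proof -
      have "dotp n ?Y (?m ?Y ?u) = dotp n ?u (?m ?Y ?Y)" "dotp n ?u (?m ?Y ?u) = dotp n ?Y (?m ?u ?u)"
        using ip_mul ip_commute mul_commute by metis+
      moreover have "f (y + t \<cdot>\<^sub>v unit_vec n i) = dotp n (?Y + t *\<^sub>R ?u) (?m (?Y + t *\<^sub>R ?u) (?Y + t *\<^sub>R ?u))"
        using f[of "y + t \<cdot>\<^sub>v unit_vec n i"] y i by (simp add: vec_fun_add_unit)
      ultimately show ?thesis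
        unfolding mul_add_add using dotp_unit(1)[OF i, of "?m ?Y ?Y"]
        by (simp add: bilinear power2_eq_square power3_eq_cube algebra_simps)
    qed
    then show ?thesis unfolding partial_deriv_def by (simp only: deriv_cubic_at_0)
  qed
  have d2: "partial_deriv n j (partial_deriv n i f) x = 6 * ?m X (unit_fun j) i" if i: "i < n" and j: "j < n" for i j
  proof -
    let ?u = "unit_fun j"
    have "partial_deriv n j (partial_deriv n i f) x = partial_deriv n j (\<lambda>y. 3 * ?m (vec_fun y) (vec_fun y) i) x"
      by (rule partial_deriv_cong[OF _ x]) (use d1 i in auto)
    moreover have "3 * ?m (vec_fun (x + t \<cdot>\<^sub>v unit_vec n j)) (vec_fun (x + t \<cdot>\<^sub>v unit_vec n j)) i
        = 3 * ?m X X i + (6 * ?m X ?u i) * t + (3 * ?m ?u ?u i) * t\<^sup>2 + 0 * t^3" for t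
      unfolding vec_fun_add_unit[OF x j] X_def[symmetric] mul_add_add
      by (simp add: bilinear power2_eq_square algebra_simps)
    ultimately show ?thesis unfolding partial_deriv_def by (simp only: deriv_cubic_at_0)
  qed
  have 1: "(\<Sum>i<n. (partial_deriv n i f x)\<^sup>2) = 9 * dotp n (?m X X) (?m X X)"
    unfolding dotp_def sum_distrib_left using d1[OF x] unfolding X_def[symmetric]
    by (intro sum.cong refl) (simp add: power2_eq_square)
  have 2: "(\<Sum>i<n. partial_deriv n i (partial_deriv n i f) x) = 6 * tensor_trace n c X"
    unfolding tensor_trace_eq[OF c] sum_distrib_left using d2
    by (intro sum.cong refl) (simp add: dotp_unit)
  have 3: "(\<Sum>i<n. \<Sum>j<n. partial_deriv n i f x * partial_deriv n j f x * partial_deriv n j (partial_deriv n i f) x)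
      = 54 * dotp n (?m X X) (?m X (?m X X))"
  proof -
    have "(\<Sum>j<n. partial_deriv n i f x * partial_deriv n j f x * partial_deriv n j (partial_deriv n i f) x)
        = 54 * (?m X X i * ?m X (?m X X) i)" if i: "i < n" for i
    proof -
      have "(\<Sum>j<n. partial_deriv n i f x * partial_deriv n j f x * partial_deriv n j (partial_deriv n i f) x)
        = (\<Sum>j<n. 54 * ?m X X i * (?m X X j * ?m X (unit_fun j) i))"
        using d1[OF x] d2 i unfolding X_def[symmetric] by (intro sum.cong refl) simp
      also have "\<dots> = 54 * ?m X X i * (\<Sum>j<n. ?m X X j * ?m X (unit_fun j) i)"
        by (simp only: sum_distrib_left)
      finally show ?thesis
        using tensor_mul_unit_sum[OF i, where y = "?m X X" and x = X and c = c] by simp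
    qed
    then show ?thesis unfolding dotp_def[of n "?m X X"] sum_distrib_left by (intro sum.cong refl) simp
  qed
  show ?thesis unfolding L_op_def 1 2 3 by (simp add: algebra_simps)
qed

section \<open>Cubic forms of Clifford systems\<close>

lemma sum_lessThan_add: "(\<Sum>i<p + N. f i) = (\<Sum>i<p. f i) + (\<Sum>b<N. f (p + b :: nat))"
  for f :: "nat \<Rightarrow> 'a::comm_monoid_add"
  by (induction N) (auto simp: add.assoc)

text \<open>The \<open>a i\<close> are the entries of symmetric matrices. Stating the Clifford
  relations as multiplicativity of norms matches what \<open>eigenspace_norms\<close> delivers;
  polarization recovers the relations.\<close>

locale clifford_tensor =
  fixes p N :: nat and a :: "nat \<Rightarrow> nat \<Rightarrow> nat \<Rightarrow> real"
  assumes a_sym: "a i k b = a i b k"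
    and norm: "(\<Sum>k<N. (\<Sum>i<p. \<Sum>b<N. a i k b * x i * z b)\<^sup>2) = dotp p x x * dotp N z z"
begin

definition act :: "(nat \<Rightarrow> real) \<Rightarrow> (nat \<Rightarrow> real) \<Rightarrow> nat \<Rightarrow> real" where
  "act x z k = (\<Sum>i<p. \<Sum>b<N. a i k b * x i * z b)"

lemma act_add: "act (x + x') z = act x z + act x' z" "act x (z + z') = act x z + act x z'"
  by (auto simp: act_def fun_eq_iff algebra_simps sum.distrib)

lemma dotp_add_add: "dotp n (x + y) (x + y) = dotp n x x + 2 * dotp n x y + dotp n y y"
  unfolding dotp_def by (simp add: algebra_simps sum.distrib sum_distrib_left)

lemma act_norm: "dotp N (act x z) (act x z) = dotp p x x * dotp N z z"
  using norm[of x z] by (simp add: dotp_def[of N "act x z"] act_def power2_eq_square)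

text \<open>The norm identity is polarized first in z (fact 1), then in x.\<close>

lemma act_polarized:
  "dotp N (act x z) (act x' z') + dotp N (act x' z) (act x z') = 2 * dotp p x x' * dotp N z z'"
proof -
  have 1: "dotp N (act y z) (act y z') = dotp p y y * dotp N z z'" for y
    using act_norm[of y "z + z'"] act_norm[of y z] act_norm[of y z']
    unfolding act_add dotp_add_add by (simp add: algebra_simps)
  have add: "dotp N (u + u') (v + v') = dotp N u v + dotp N u v' + dotp N u' v + dotp N u' v'" for u u' v v'
    by (simp add: dotp_def algebra_simps sum.distrib)
  show ?thesis
    using 1[of "x + x'"] 1[of x] 1[of x'] unfolding act_add add dotp_add_add by (simp add: algebra_simps)
qed

lemma act_unit: "i < p \<Longrightarrow> b < N \<Longrightarrow> act (unit_fun i) (unit_fun b) k = a i k b"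
proof -
  assume ib: "i < p" "b < N"
  have "(\<Sum>b'<N. a i' k b' * unit_fun i i' * unit_fun b b') = a i' k b * unit_fun i i'" for i'
    using dotp_unit(2)[OF ib(2), of "\<lambda>b'. a i' k b' * unit_fun i i'"] by (simp add: dotp_def)
  then show ?thesis
    using dotp_unit(2)[OF ib(1), of "\<lambda>i'. a i' k b"] by (simp add: act_def dotp_def)
qed

text \<open>At unit vectors the polarized identity concerns the transpose of one matrix times
  another; \<open>a_sym\<close> removes the transpose.\<close>

lemma anticommutator:
  assumes "i < p" "j < p" "k < N" "l < N"
  shows "(\<Sum>b<N. a i k b * a j b l) + (\<Sum>b<N. a j k b * a i b l) = (if i = j \<and> k = l then 2 else 0)"
proof -
  have u: "dotp n (unit_fun r) (unit_fun s) = (if r = s then 1 else 0)" if "r < n" for n r s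
    using that by (simp add: dotp_unit) (simp add: unit_fun_def)
  have "dotp N (act (unit_fun i) (unit_fun k)) (act (unit_fun j) (unit_fun l)) = (\<Sum>b<N. a i k b * a j b l)"
    "dotp N (act (unit_fun j) (unit_fun k)) (act (unit_fun i) (unit_fun l)) = (\<Sum>b<N. a j k b * a i b l)"
    unfolding dotp_def using assms a_sym by (auto simp: act_unit intro!: sum.cong)
  then show ?thesis
    using act_polarized[of "unit_fun i" "unit_fun k" "unit_fun j" "unit_fun l"] assms by (simp add: u)
qed

lemma clifford_system_mat:
  assumes "p = q + 1" "N = 2 * m"
  shows "clifford_system m q (\<lambda>i. mat N N (\<lambda>(k, b). a i k b))"
  unfolding clifford_system_def assms(2)[symmetric]
proof (intro conjI allI impI)
  fix i show "mat N N (\<lambda>(k, b). a i k b) \<in> carrier_mat N N" by simp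
  show "transpose_mat (mat N N (\<lambda>(k, b). a i k b)) = mat N N (\<lambda>(k, b). a i k b)"
    by (rule eq_matI) (auto simp: a_sym)
next
  fix i j assume ij: "i \<le> q" "j \<le> q"
  let ?A = "\<lambda>i. mat N N (\<lambda>(k, b). a i k b)"
  have "(?A i * ?A j) $$ (k, l) = (\<Sum>b<N. a i k b * a j b l)" if "k < N" "l < N" for i j k l
    using that by (simp add: scalar_prod_def atLeast0LessThan)
  then show "?A i * ?A j + ?A j * ?A i = (if i = j then 2 else 0) \<cdot>\<^sub>m 1\<^sub>m N"
    using ij assms(1) anticommutator by (intro eq_matI) auto
qed

text \<open>The same matrices as globally defined linear maps on
  \<open>nat \<Rightarrow> real\<close>, in the form that \<open>clifford_ops\<close>
  requires.\<close>

definition operator :: "nat \<Rightarrow> (nat \<Rightarrow> real) \<Rightarrow> nat \<Rightarrow> real" where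
  "operator i z = (\<lambda>k. if k < N then \<Sum>b<N. a i k b * z b else 0)"

lemma operator_linear: "linear (operator i)"
  by (rule linearI) (auto simp: operator_def fun_eq_iff algebra_simps sum.distrib sum_distrib_left)

lemma supported_operator: "supported N (operator i z)"
  by (simp add: supported_def operator_def)

lemma operator_anticommutator:
  assumes "i < p" "j < p" "supported N z"
  shows "operator i (operator j z) + operator j (operator i z) = (if i = j then 2 else 0) *\<^sub>R z"
proof (rule supported_eqI[of N])
  show "supported N (operator i (operator j z) + operator j (operator i z))"
    using supported_operator unfolding supported_def by simp
  show "supported N ((if i = j then 2 else 0) *\<^sub>R z)"
    using assms(3) unfolding supported_def by simp
  fix k assume k: "k < N"
  have comp: "operator i (operator j z) k = (\<Sum>l<N. (\<Sum>b<N. a i k b * a j b l) * z l)" for i j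
  proof -
    have "operator i (operator j z) k = (\<Sum>b<N. \<Sum>l<N. a i k b * a j b l * z l)"
      using k by (simp add: operator_def sum_distrib_left algebra_simps)
    also have "\<dots> = (\<Sum>l<N. \<Sum>b<N. a i k b * a j b l * z l)" by (rule sum.swap)
    finally show ?thesis by (simp add: sum_distrib_right)
  qed
  have "(operator i (operator j z) + operator j (operator i z)) k
      = (\<Sum>l<N. ((\<Sum>b<N. a i k b * a j b l) + (\<Sum>b<N. a j k b * a i b l)) * z l)"
    by (simp add: comp algebra_simps sum.distrib)
  also have "\<dots> = (\<Sum>l<N. if k = l then (if i = j then 2 else 0) * z l else 0)"
    using anticommutator[OF assms(1,2) k] by (intro sum.cong refl) auto
  also have "\<dots> = ((if i = j then 2 else 0) *\<^sub>R z) k"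
    using k by simp
  finally show "(operator i (operator j z) + operator j (operator i z)) k = ((if i = j then 2 else 0) *\<^sub>R z) k" .
qed

lemma findim_subspace_supported: "findim_subspace {z. supported N z}" "dim {z. supported N z} = N"
proof -
  let ?W = "{z. supported N z}"
  let ?B = "unit_fun ` {..<N}"
  have sub: "subspace ?W" by (auto simp: subspace_def supported_def)
  have W: "?W \<subseteq> span ?B"
  proof
    fix z assume z: "z \<in> ?W"
    have "z = (\<Sum>i<N. z i *\<^sub>R unit_fun i)"
    proof (rule supported_eqI[of N])
      show "supported N z" using z by simp
      show "supported N (\<Sum>i<N. z i *\<^sub>R unit_fun i)" by (simp add: supported_def sum_fun_apply unit_fun_def)
      show "z k = (\<Sum>i<N. z i *\<^sub>R unit_fun i) k" if "k < N" for k
        using that by (simp add: sum_fun_apply unit_fun_def if_distrib cong: if_cong)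
    qed
    also have "\<dots> \<in> span ?B" by (intro span_sum span_scale) (auto intro: span_base)
    finally show "z \<in> span ?B" .
  qed
  show "findim_subspace ?W"
    unfolding findim_subspace_def using sub W by (intro conjI exI[of _ ?B]) auto
  have inj: "inj_on unit_fun {..<N}" by (rule inj_onI) (metis unit_fun_def zero_neq_one)
  have "independent ?B"
  proof (rule independent_if_scalars_zero)
    fix f x assume s: "(\<Sum>x\<in>?B. f x *\<^sub>R x) = 0" and x: "x \<in> ?B"
    then obtain k where k: "k < N" "x = unit_fun k" by auto
    have "0 = (\<Sum>x\<in>?B. f x *\<^sub>R x) k" using s by simp
    also have "\<dots> = (\<Sum>i<N. f (unit_fun i) * unit_fun i k)"
      using inj by (simp add: sum_fun_apply sum.reindex)
    also have "\<dots> = f x" using k by (simp add: unit_fun_def if_distrib cong: if_cong)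
    finally show "f x = 0" by simp
  qed simp
  moreover have "?B \<subseteq> ?W" by (auto simp: supported_def unit_fun_def)
  ultimately show "dim ?W = N"
    using dim_unique[of ?B ?W N] W inj by (simp add: card_image)
qed

lemma clifford_rep_operators: "clifford_rep p 0 {z. supported N z}"
proof -
  let ?W = "{z. supported N z}"
  let ?Es = "map operator [0..<p]"
  have sq: "operator i (operator i z) = z" if "i < p" "supported N z" for i z
  proof -
    have "2 *\<^sub>R operator i (operator i z) = 2 *\<^sub>R z"
      using operator_anticommutator[OF that(1) that] by (simp add: scaleR_2)
    then show ?thesis by simp
  qed
  have ac: "anticommute_on ?W (operator i) (operator j)" if "i < p" "j < p" "i \<noteq> j" for i j
    unfolding anticommute_on_def
    using operator_anticommutator[OF that(1,2)] that(3) by (simp add: eq_neg_iff_add_eq_0)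
  have "sorted_wrt (anticommute_on ?W) ?Es"
    unfolding sorted_wrt_map
    by (rule sorted_wrt_mono_rel[OF _ sorted_wrt_upt]) (use ac in auto)
  then have "clifford_ops ?W ?Es []"
    unfolding clifford_ops_def using operator_linear supported_operator sq by auto
  then show ?thesis
    unfolding clifford_rep_def using findim_subspace_supported(1)
    by (intro conjI exI[of _ ?Es] exI[of _ "[]"]) auto
qed

lemma hurwitz_radon_bound:
  assumes "N = 2 * m" "m > 0"
  shows "p - 1 \<le> hurwitz_radon m"
proof (cases "p \<le> 1")
  case False
  then obtain r where r: "p = Suc (Suc r)" by (metis Suc_le_D not_less_eq_eq One_nat_def)
  show ?thesis
    using anticommuting_involutions_hurwitz_radon[of r "{z. supported N z}" m] clifford_rep_operators
      findim_subspace_supported(2) assms r by simp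
qed simp

section \<open>The cubic form of a Clifford tensor is an eigencubic\<close>

definition block :: "nat \<Rightarrow> nat \<Rightarrow> nat \<Rightarrow> real" where
  "block i j k = (if i < p \<and> p \<le> j \<and> p \<le> k then a i (j - p) (k - p) / 3 else 0)"

text \<open>The index below p may stand in any of the three slots; the 1/3 in \<open>block\<close>
  compensates for this, so that the cubic form of the symmetric tensor is \<open>form\<close>
  itself.\<close>

definition cubic_tensor :: "nat \<Rightarrow> nat \<Rightarrow> nat \<Rightarrow> real" where
  "cubic_tensor i j k = block i j k + block j i k + block k i j"

lemma symmetric_cubic_tensor: "symmetric_tensor cubic_tensor"
proof -
  have "block i j k = block i k j" for i j k by (auto simp: block_def a_sym)
  then show ?thesis unfolding symmetric_tensor_def cubic_tensor_def by auto
qed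

definition form :: "real vec \<Rightarrow> real" where
  "form v = (\<Sum>i<p. \<Sum>k<N. \<Sum>b<N. a i k b * v $ i * v $ (p + k) * v $ (p + b))"

lemma cubic_tensor_simps:
  assumes "i < p"
  shows "j < p \<Longrightarrow> cubic_tensor i j k = 0"
    and "j < p \<Longrightarrow> cubic_tensor i (p + b) j = 0"
    and "j < p \<Longrightarrow> cubic_tensor (p + b) i j = 0"
    and "cubic_tensor i (p + b) (p + c) = a i b c / 3"
    and "cubic_tensor (p + b) (p + c) i = a i b c / 3"
  using assms by (auto simp: cubic_tensor_def block_def a_sym)

lemma cubic_tensor_high: "cubic_tensor (p + b) (p + c) (p + d) = 0"
  by (simp add: cubic_tensor_def block_def)

text \<open>Vanishing traces remove the first term of \<open>L_op\<close>, and the second is 54 *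
  4/27 = 8 times the required product. For a single matrix (p = 1) the traces do not vanish by the
  Clifford relations alone, since the identity matrix satisfies them; hence the hypothesis
  \<open>tr\<close>.\<close>

lemma form_eigencubic:
  assumes tr: "\<And>i. i < p \<Longrightarrow> (\<Sum>k<N. a i k k) = 0" and v: "v \<in> carrier_vec (p + N)"
  shows "L_op (p + N) form v = - 8 * (v \<bullet> v) * form v"
proof -
  let ?n = "p + N" let ?m = "tensor_mul ?n cubic_tensor"
  interpret cubic_algebra "dotp ?n" ?m by (rule cubic_algebra_tensor[OF symmetric_cubic_tensor])
  define X where "X = {x :: nat \<Rightarrow> real. \<forall>i\<ge>p. x i = 0}"
  define Z where "Z = {z :: nat \<Rightarrow> real. \<forall>i. i < p \<or> p + N \<le> i \<longrightarrow> z i = 0}"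
  have X: "x (p + b) = 0" if "x \<in> X" for x b using that unfolding X_def by simp
  have Z: "z i = 0" if "z \<in> Z" "i < p" for z i using that unfolding Z_def by simp
  have low_high: "k < p \<or> (\<exists>c<N. k = p + c)" if "k < ?n" for k
    using that by (metis le_add_diff_inverse nat_add_left_cancel_less not_le_imp_less)
  have mulXX: "?m x x' = 0" if "x \<in> X" "x' \<in> X" for x x'
    using X[OF that(1)] X[OF that(2)]
    by (auto simp: tensor_mul_def fun_eq_iff sum_lessThan_add cubic_tensor_simps)
  have mulXZ_low: "?m x z k = 0" if "x \<in> X" "z \<in> Z" "k < p" for x z k
    using X[OF that(1)] Z[OF that(2)] that(3)
    by (simp add: tensor_mul_def sum_lessThan_add cubic_tensor_simps)
  have mulXZ: "?m x z (p + c) = act x (\<lambda>b. z (p + b)) c / 3" if "x \<in> X" "z \<in> Z" "c < N" for x z c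
    using X[OF that(1)] Z[OF that(2)] that(3)
    by (simp add: tensor_mul_def sum_lessThan_add cubic_tensor_simps act_def sum_divide_distrib a_sym[of _ c])
  have mulZZ_high: "?m z z' (p + c) = 0" if "z \<in> Z" "z' \<in> Z" for z z' c
    using Z[OF that(1)] Z[OF that(2)]
    by (simp add: tensor_mul_def sum_lessThan_add cubic_tensor_high)
  have mulZZ: "?m z z' k = (\<Sum>b<N. \<Sum>c<N. a k b c * z (p + b) * z' (p + c)) / 3" if "z \<in> Z" "z' \<in> Z" "k < p" for z z' k
    using Z[OF that(1)] Z[OF that(2)] that(3)
    by (simp add: tensor_mul_def sum_lessThan_add cubic_tensor_simps sum_divide_distrib)
  have XZ: "?m x z \<in> Z" if "x \<in> X" "z \<in> Z" for x z
    unfolding Z_def using mulXZ_low[OF that] by (auto simp: tensor_mul_def)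
  have ZZ: "?m z z' \<in> X" if "z \<in> Z" "z' \<in> Z" for z z'
    unfolding X_def using mulZZ_high[OF that] by (auto simp: le_iff_add)
  have sums: "x \<in> X \<Longrightarrow> x' \<in> X \<Longrightarrow> x + x' \<in> X" "z \<in> Z \<Longrightarrow> z' \<in> Z \<Longrightarrow> z + z' \<in> Z" for x x' z z'
    unfolding X_def Z_def by auto
  have orth: "dotp ?n x z = 0" if "x \<in> X" "z \<in> Z" for x z
    unfolding dotp_def sum_lessThan_add using X[OF that(1)] Z[OF that(2)] by simp
  have mul_norm: "dotp ?n (?m x z) (?m x z) = dotp ?n x x * dotp ?n z z / 9" if x: "x \<in> X" and z: "z \<in> Z" for x z
  proof -
    have "dotp ?n (?m x z) (?m x z) = (\<Sum>c<N. (?m x z (p + c))\<^sup>2)"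
      unfolding dotp_def sum_lessThan_add using mulXZ_low[OF x z] by (simp add: power2_eq_square)
    also have "\<dots> = (\<Sum>c<N. (act x (\<lambda>b. z (p + b)) c)\<^sup>2) / 9"
      unfolding sum_divide_distrib using mulXZ[OF x z]
      by (intro sum.cong refl) (simp only: lessThan_iff power_divide, simp)
    also have "\<dots> = dotp p x x * dotp N (\<lambda>b. z (p + b)) (\<lambda>b. z (p + b)) / 9"
      unfolding act_def norm ..
    also have "\<dots> = dotp ?n x x * dotp ?n z z / 9"
      unfolding dotp_def sum_lessThan_add using X[OF x] Z[OF z] by simp
    finally show ?thesis .
  qed
  have tensor: "form w = dotp ?n (vec_fun w) (?m (vec_fun w) (vec_fun w))" if w: "w \<in> carrier_vec ?n" for w
  proof -
    define x where "x i = (if i < p then vec_fun w i else 0)" for i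
    define z where "z i = (if i < p then 0 else vec_fun w i)" for i
    have xz: "x \<in> X" "z \<in> Z" "vec_fun w = x + z"
      using w unfolding X_def Z_def x_def z_def by (auto simp: vec_fun_def fun_eq_iff)
    have "dotp ?n (vec_fun w) (?m (vec_fun w) (vec_fun w)) = 3 * dotp ?n x (?m z z)"
    proof -
      have "dotp ?n z (?m z z) = 0" "dotp ?n x (?m x z) = 0"
        using orth[OF ZZ[OF xz(2,2)] xz(2)] orth[OF xz(1) XZ[OF xz(1,2)]] ip_commute by auto
      moreover have "dotp ?n z (?m x z) = dotp ?n x (?m z z)" by (metis ip_mul ip_commute mul_commute)
      ultimately show ?thesis
        unfolding xz(3) mul_add_add using mulXX[OF xz(1,1)] by (simp add: bilinear)
    qed
    also have "\<dots> = (\<Sum>i<p. x i * (\<Sum>b<N. \<Sum>c<N. a i b c * z (p + b) * z (p + c)))"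
    proof -
      have "dotp ?n x (?m z z) = (\<Sum>i<p. x i * ?m z z i)"
        unfolding dotp_def sum_lessThan_add using X[OF xz(1)] by simp
      also have "\<dots> = (\<Sum>i<p. x i * ((\<Sum>b<N. \<Sum>c<N. a i b c * z (p + b) * z (p + c)) / 3))"
        using mulZZ[OF xz(2,2)] by (intro sum.cong refl) (simp only: lessThan_iff)
      finally show ?thesis by (simp flip: sum_divide_distrib)
    qed
    also have "\<dots> = form w"
      unfolding form_def x_def z_def sum_distrib_left using w
      by (intro sum.cong refl) (auto simp: vec_fun_def)
    finally show ?thesis by simp
  qed
  define V where "V = vec_fun v"
  define x where "x i = (if i < p then V i else 0)" for i
  define z where "z i = (if i < p then 0 else V i)" for i
  have xz: "x \<in> X" "z \<in> Z" "V = x + z"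
    using v unfolding X_def Z_def x_def z_def V_def by (auto simp: vec_fun_def fun_eq_iff)
  have "tensor_trace ?n cubic_tensor V = 0"
  proof -
    have "(\<Sum>i<?n. cubic_tensor k i i * V k) = 0" if "k < ?n" for k
    proof (cases "k < p")
      case True
      have "(\<Sum>i<?n. cubic_tensor k i i * V k) = (\<Sum>b<N. a k b b) / 3 * V k"
        using True by (simp add: sum_lessThan_add cubic_tensor_simps sum_divide_distrib sum_distrib_right)
      then show ?thesis using tr[OF True] by simp
    next
      case False
      then obtain c where "k = p + c" by (metis le_iff_add not_le_imp_less)
      then show ?thesis by (simp add: sum_lessThan_add cubic_tensor_simps cubic_tensor_high)
    qed
    then show ?thesis unfolding tensor_trace_def by simp
  qed
  moreover have "dotp ?n (?m V V) (?m V (?m V V)) = 4 / 27 * dotp ?n V V * dotp ?n V (?m V V)"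
    unfolding xz(3) by (rule clifford_algebra_radial[of X Z])
      (use sums mulXX XZ ZZ orth mul_norm xz in auto)
  ultimately show ?thesis
    using L_op_tensor[OF symmetric_cubic_tensor tensor v, folded V_def] tensor[OF v, folded V_def]
      vec_fun_scalar_prod[OF v v, folded V_def] by simp
qed

end

section \<open>The normal form\<close>

text \<open>The part of the cubic at u + v that is odd in v consists of a linear and a cubic term;
  subtracting the latter leaves the former. With \<open>four_mul\<close> this recovers the trilinear
  form from values of the cubic.\<close>

lemma (in cubic_algebra) cubic_pair:
  "3 * ip v (mul u u) = (ip (u + v) (mul (u + v) (u + v)) - ip (u - v) (mul (u - v) (u - v))) / 2 - ip v (mul v v)"
proof -
  have "ip u (mul u v) = ip v (mul u u)" "ip v (mul u v) = ip u (mul v v)"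
    using ip_mul ip_commute mul_commute by metis+
  then show ?thesis
    by (simp add: bilinear mul_commute[of v u] field_simps)
qed

lemma (in cubic_algebra) four_mul: "4 *\<^sub>R mul y z = mul (y + z) (y + z) - mul (y - z) (y - z)"
proof -
  have "(1 + 1 + 1 + 1) *\<^sub>R mul y z = mul y z + mul y z + mul y z + mul y z"
    by (simp only: scaleR_add_left scaleR_one)
  then show ?thesis
    by (simp add: bilinear mul_commute[of z y] algebra_simps)
qed

lemma (in cubic_algebra) mul_zero: "mul 0 x = 0" "mul x 0 = 0"
  using mul_scale_left[of 0 x x] mul_scale_right[of x 0 x] by simp_all

lemma (in cubic_algebra) ip_zero: "ip 0 x = 0" "ip x 0 = 0"
  using ip_scale_left[of 0 x x] ip_scale_right[of x 0 x] by simp_all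

lemma (in cubic_algebra) mul_sum_right: "mul x (\<Sum>i\<in>I. g i) = (\<Sum>i\<in>I. mul x (g i))"
  by (induction I rule: infinite_finite_induct) (auto simp: mul_add_right mul_zero)

lemma (in cubic_algebra) ip_sum_right: "ip x (\<Sum>i\<in>I. g i) = (\<Sum>i\<in>I. ip x (g i))"
  by (induction I rule: infinite_finite_induct) (auto simp: ip_add_right ip_zero)

lemma (in cubic_algebra) ip_sum_left: "ip (\<Sum>i\<in>I. g i) x = (\<Sum>i\<in>I. ip (g i) x)"
  unfolding ip_commute[of _ x] by (rule ip_sum_right)

text \<open>Once homogeneity has extracted the scalars, the psi-values are mere numbers p, q, r, w.
  Polarization expresses each entry through values of the cubic at combinations with coefficients 0,
  1 and -1 (facts \<open>pr\<close> and \<open>pm\<close>).\<close>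

lemma (in cubic_algebra) normal_form_coefficients:
  assumes G: "\<And>\<alpha> \<beta> \<gamma> s. ip (\<alpha> *\<^sub>R x + \<beta> *\<^sub>R y + \<gamma> *\<^sub>R z + s *\<^sub>R e)
      (mul (\<alpha> *\<^sub>R x + \<beta> *\<^sub>R y + \<gamma> *\<^sub>R z + s *\<^sub>R e) (\<alpha> *\<^sub>R x + \<beta> *\<^sub>R y + \<gamma> *\<^sub>R z + s *\<^sub>R e)) =
      s^3 - 3 / 2 * s * (2 * \<alpha>\<^sup>2 * A + \<beta>\<^sup>2 * B - \<gamma>\<^sup>2 * D)
      + \<alpha> * \<beta> * \<gamma> * p + \<alpha> * \<gamma>\<^sup>2 * q + \<beta> * \<gamma>\<^sup>2 * r + \<beta>^3 * w"
  shows "ip e (mul e e) = 1" "ip x (mul e e) = 0" "ip y (mul e e) = 0" "ip z (mul e e) = 0"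
    and "ip e (mul x x) = - A" "ip e (mul y y) = - B / 2" "ip e (mul z z) = D / 2"
    and "ip e (mul x y) = 0" "ip e (mul x z) = 0" "ip e (mul y z) = 0"
    and "ip x (mul x x) = 0" "ip y (mul x x) = 0" "ip z (mul x x) = 0" "ip x (mul y y) = 0"
    and "6 * ip x (mul y z) = p" "3 * ip x (mul z z) = q"
proof -
  have m: "4 * ip v (mul u u') = ip v (mul (u + u') (u + u')) - ip v (mul (u - u') (u - u'))" for u u' v
    using arg_cong[OF four_mul[of u u'], of "ip v"] by (simp add: bilinear)
  define T where "T u = ip u (mul u u)" for u
  note G' = G[folded T_def]
  have pr: "3 * ip v (mul u u) = (T (u + v) - T (u - v)) / 2 - T v" for u v
    unfolding T_def by (rule cubic_pair)
  have pm: "24 * ip v (mul u u') = T (u + u' + v) - T (u + u' - v) - (T (u - u' + v) - T (u - u' - v))" for u u' v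
    using m[of v u u'] pr[of v "u + u'"] pr[of v "u - u'"] by (simp add: field_simps)
  show "ip e (mul e e) = 1" using G'[of 0 0 0 1] by (simp add: T_def)
  then have e3: "T e = 1" by (simp add: T_def)
  have x3: "T x = 0" using G'[of 1 0 0 0] by simp
  then show "ip x (mul x x) = 0" by (simp add: T_def)
  have y3: "T y = w" using G'[of 0 1 0 0] by simp
  have z3: "T z = 0" using G'[of 0 0 1 0] by simp
  show "ip x (mul e e) = 0" using pr[of x e] G'[of 1 0 0 1] G'[of "-1" 0 0 1] x3 by (simp add: algebra_simps)
  show "ip y (mul e e) = 0" using pr[of y e] G'[of 0 1 0 1] G'[of 0 "-1" 0 1] y3 by (simp add: algebra_simps)
  show "ip z (mul e e) = 0" using pr[of z e] G'[of 0 0 1 1] G'[of 0 0 "-1" 1] z3 by (simp add: algebra_simps)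
  show "ip e (mul x x) = - A" using pr[of e x] G'[of 1 0 0 1] G'[of 1 0 0 "-1"] e3 by (simp add: algebra_simps)
  show "ip e (mul y y) = - B / 2" using pr[of e y] G'[of 0 1 0 1] G'[of 0 1 0 "-1"] e3 by (simp add: algebra_simps)
  show "ip e (mul z z) = D / 2" using pr[of e z] G'[of 0 0 1 1] G'[of 0 0 1 "-1"] e3 by (simp add: algebra_simps)
  show "ip y (mul x x) = 0" using pr[of y x] G'[of 1 1 0 0] G'[of 1 "-1" 0 0] y3 by (simp add: algebra_simps)
  show "ip z (mul x x) = 0" using pr[of z x] G'[of 1 0 1 0] G'[of 1 0 "-1" 0] z3 by (simp add: algebra_simps)
  show "ip x (mul y y) = 0" using pr[of x y] G'[of 1 1 0 0] G'[of "-1" 1 0 0] x3 by (simp add: algebra_simps)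
  show "3 * ip x (mul z z) = q" using pr[of x z] G'[of 1 0 1 0] G'[of "-1" 0 1 0] x3 by (simp add: algebra_simps)
  show "ip e (mul x y) = 0"
    using pm[of e x y] G'[of 1 1 0 1] G'[of 1 1 0 "-1"] G'[of 1 "-1" 0 1] G'[of 1 "-1" 0 "-1"] by simp
  show "ip e (mul x z) = 0"
    using pm[of e x z] G'[of 1 0 1 1] G'[of 1 0 1 "-1"] G'[of 1 0 "-1" 1] G'[of 1 0 "-1" "-1"] by simp
  show "ip e (mul y z) = 0"
    using pm[of e y z] G'[of 0 1 1 1] G'[of 0 1 1 "-1"] G'[of 0 1 "-1" 1] G'[of 0 1 "-1" "-1"] by simp
  have "24 * ip z (mul x y) = 4 * p"
    using pm[of z x y] G'[of 1 1 1 0] G'[of 1 1 "-1" 0] G'[of 1 "-1" 1 0] G'[of 1 "-1" "-1" 0] by simp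
  moreover have "ip z (mul x y) = ip x (mul y z)" by (metis ip_mul ip_commute)
  ultimately show "6 * ip x (mul y z) = p" by simp
qed

section \<open>The orthonormal basis given by the columns of Q\<close>

locale orthonormal_columns =
  fixes n :: nat and Q :: "real mat"
  assumes Q: "orthonormal_mat n Q"
begin

definition q :: "nat \<Rightarrow> nat \<Rightarrow> real" where
  "q b = vec_fun (col Q b)"

lemma Q_carrier: "Q \<in> carrier_mat n n"
  using Q unfolding orthonormal_mat_def by simp

lemma supported_q: "supported n (q b)"
  unfolding q_def using Q_carrier by (intro supported_vec_fun) auto

lemma q_apply: "b < n \<Longrightarrow> i < n \<Longrightarrow> q b i = Q $$ (i, b)"
  using Q_carrier by (auto simp: q_def vec_fun_def)

lemma dotp_q: assumes "a < n" "b < n" shows "dotp n (q a) (q b) = (if a = b then 1 else 0)"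
proof -
  have "dotp n (q a) (q b) = (transpose_mat Q * Q) $$ (a, b)"
    using Q_carrier assms unfolding q_def by (subst vec_fun_scalar_prod) auto
  then show ?thesis using Q assms unfolding orthonormal_mat_def by simp
qed

text \<open>Completeness of the columns amounts to orthonormality of the rows: for a square matrix
  the left inverse is also a right inverse.\<close>

lemma parseval: "dotp n x y = (\<Sum>a<n. dotp n x (q a) * dotp n y (q a))"
proof -
  have QQ: "Q * transpose_mat Q = 1\<^sub>m n"
    using mat_mult_left_right_inverse[of "transpose_mat Q" n Q] Q Q_carrier unfolding orthonormal_mat_def by simp
  have rows: "(\<Sum>a<n. Q $$ (i, a) * Q $$ (j, a)) = (if i = j then 1 else 0)" if "i < n" "j < n" for i j
    using that arg_cong[OF QQ, of "\<lambda>M. M $$ (i, j)"] Q_carrier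
    by (simp add: scalar_prod_def atLeast0LessThan)
  have "(\<Sum>a<n. dotp n x (q a) * dotp n y (q a)) = (\<Sum>a<n. \<Sum>i<n. \<Sum>j<n. x i * y j * (Q $$ (i, a) * Q $$ (j, a)))"
    unfolding dotp_def sum_product using q_apply by (intro sum.cong refl) (simp add: algebra_simps)
  also have "\<dots> = (\<Sum>i<n. \<Sum>a<n. \<Sum>j<n. x i * y j * (Q $$ (i, a) * Q $$ (j, a)))"
    by (rule sum.swap)
  also have "\<dots> = (\<Sum>i<n. \<Sum>j<n. \<Sum>a<n. x i * y j * (Q $$ (i, a) * Q $$ (j, a)))"
    by (intro sum.cong refl sum.swap)
  also have "\<dots> = (\<Sum>i<n. \<Sum>j<n. x i * y j * (if i = j then 1 else 0))"
    using rows by (intro sum.cong refl) (simp flip: sum_distrib_left)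
  also have "\<dots> = dotp n x y"
    unfolding dotp_def by (intro sum.cong refl) (simp add: if_distrib cong: if_cong)
  finally show ?thesis by simp
qed

lemma supported_eq_by_q:
  assumes "supported n x" "supported n y" "\<And>a. a < n \<Longrightarrow> dotp n x (q a) = dotp n y (q a)"
  shows "x = y"
proof (rule supported_eqI[OF assms(1,2)])
  fix i assume i: "i < n"
  have "dotp n x (unit_fun i) = dotp n y (unit_fun i)"
    unfolding parseval[of x "unit_fun i"] parseval[of y "unit_fun i"] using assms(3) by simp
  then show "x i = y i" using i by (simp add: dotp_unit)
qed

text \<open>Basis independence of the trace, which allows it to be computed in a basis of
  eigenvectors of e.\<close>

lemma trace_q:
  assumes c: "symmetric_tensor c"
  shows "tensor_trace n c x = (\<Sum>a<n. dotp n (q a) (tensor_mul n c x (q a)))"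
proof -
  interpret cubic_algebra "dotp n" "tensor_mul n c" by (rule cubic_algebra_tensor[OF c])
  let ?m = "tensor_mul n c"
  have adj: "dotp n (?m x u) v = dotp n u (?m x v)" for u v by (rule ip_mul_swap)
  have "tensor_trace n c x = (\<Sum>i<n. \<Sum>a<n. dotp n (unit_fun i) (q a) * dotp n (?m x (unit_fun i)) (q a))"
    unfolding tensor_trace_eq[OF c] by (intro sum.cong refl parseval)
  also have "\<dots> = (\<Sum>a<n. \<Sum>i<n. dotp n (unit_fun i) (q a) * dotp n (?m x (unit_fun i)) (q a))"
    by (rule sum.swap)
  also have "\<dots> = (\<Sum>a<n. dotp n (q a) (?m x (q a)))"
    unfolding adj dotp_def[of n "q _" "?m x (q _)"] by (intro sum.cong refl) (simp add: dotp_unit)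
  finally show ?thesis .
qed

lemma vec_fun_mult_Q:
  assumes "x \<in> carrier_vec n"
  shows "vec_fun (Q *\<^sub>v x) = (\<Sum>a<n. (x $ a) *\<^sub>R q a)"
proof (rule supported_eqI[of n])
  show "supported n (vec_fun (Q *\<^sub>v x))"
    using mult_mat_vec_carrier[OF Q_carrier assms] by (rule supported_vec_fun)
  show "supported n (\<Sum>a<n. (x $ a) *\<^sub>R q a)"
    using supported_q by (simp add: supported_def sum_fun_apply)
  show "vec_fun (Q *\<^sub>v x) i = (\<Sum>a<n. (x $ a) *\<^sub>R q a) i" if "i < n" for i
    using that Q_carrier assms
    by (auto simp: vec_fun_def sum_fun_apply scalar_prod_def atLeast0LessThan q_apply intro!: sum.cong)
qed

text \<open>With (s, m) equal to (0, n1), (n1, n2) and (n1 + n2, n3) these are the coordinate maps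
  onto V1, V2 and V3.\<close>

definition comb :: "nat \<Rightarrow> nat \<Rightarrow> (nat \<Rightarrow> real) \<Rightarrow> nat \<Rightarrow> real" where
  "comb s m x = (\<Sum>a<m. x a *\<^sub>R q (s + a))"

lemma comb_unit: "a < m \<Longrightarrow> comb s m (unit_fun a) = q (s + a)"
  by (simp add: comb_def unit_fun_def if_distrib[of "\<lambda>r. r *\<^sub>R q _"] cong: if_cong)

lemma comb_add: "comb s m (x + y) = comb s m x + comb s m y"
  by (simp add: comb_def scaleR_add_left sum.distrib)

lemma comb_scale: "comb s m (\<lambda>a. r * x a) = r *\<^sub>R comb s m x"
  by (simp add: comb_def scaleR_sum_right)

lemma supported_comb: "supported n (comb s m x)"
  using supported_q by (simp add: supported_def comb_def sum_fun_apply)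

lemma dotp_sum_scale: "dotp n (\<Sum>i\<in>I. r i *\<^sub>R g i) y = (\<Sum>i\<in>I. r i * dotp n (g i) y)"
  unfolding dotp_def by (simp add: sum_fun_apply sum_distrib_right sum_distrib_left mult.assoc sum.swap[of _ I])

lemma dotp_comb:
  assumes "s + m \<le> n" "b < n"
  shows "dotp n (comb s m x) (q b) = (if s \<le> b \<and> b < s + m then x (b - s) else 0)"
proof -
  have "dotp n (comb s m x) (q b) = (\<Sum>a<m. x a * (if s + a = b then 1 else 0))"
    unfolding comb_def dotp_sum_scale using assms by (intro sum.cong refl) (simp add: dotp_q)
  also have "\<dots> = (\<Sum>a<m. if a = b - s then (if s \<le> b then x a else 0) else 0)"
    by (intro sum.cong refl) auto
  also have "\<dots> = (if s \<le> b \<and> b < s + m then x (b - s) else 0)" by auto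
  finally show ?thesis .
qed

end

text \<open>The scalars in \<open>cubic\<close> absorb the tri-homogeneity of the psi's, so that a
  single identity carries both the shape of f and the degrees.\<close>

locale normal_form_algebra = orthonormal_columns n Q
  for n :: nat and Q :: "real mat" +
  fixes n1 n2 n3 :: nat and c :: "nat \<Rightarrow> nat \<Rightarrow> nat \<Rightarrow> real" and \<mu> :: real
    and \<psi>111 \<psi>102 \<psi>012 \<psi>030 :: "(nat \<Rightarrow> real) \<Rightarrow> (nat \<Rightarrow> real) \<Rightarrow> (nat \<Rightarrow> real) \<Rightarrow> real"
  assumes n: "n = n1 + n2 + n3 + 1" and n1: "n1 \<ge> 1"
    and c: "symmetric_tensor c"
    and radial_tensor: "dotp n (tensor_mul n c x x) (tensor_mul n c x x) * tensor_trace n c x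
      - dotp n (tensor_mul n c x x) (tensor_mul n c x (tensor_mul n c x x))
      = \<mu> * dotp n x x * dotp n x (tensor_mul n c x x)"
    and cubic: "u = \<alpha> *\<^sub>R comb 0 n1 x + \<beta> *\<^sub>R comb n1 n2 y + \<gamma> *\<^sub>R comb (n1 + n2) n3 z + s *\<^sub>R q (n1 + n2 + n3) \<Longrightarrow>
      dotp n u (tensor_mul n c u u) =
        s^3 - 3 / 2 * s * (2 * \<alpha>\<^sup>2 * dotp n1 x x + \<beta>\<^sup>2 * dotp n2 y y - \<gamma>\<^sup>2 * dotp n3 z z)
        + \<alpha> * \<beta> * \<gamma> * \<psi>111 x y z + \<alpha> * \<gamma>\<^sup>2 * \<psi>102 x y z + \<beta> * \<gamma>\<^sup>2 * \<psi>012 x y z + \<beta>^3 * \<psi>030 x y z"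
begin

abbreviation "ip \<equiv> dotp n"
abbreviation "mul \<equiv> tensor_mul n c"
abbreviation "X \<equiv> comb 0 n1"
abbreviation "Y \<equiv> comb n1 n2"
abbreviation "Z \<equiv> comb (n1 + n2) n3"
abbreviation "e \<equiv> q (n1 + n2 + n3)"

sublocale cubic_algebra ip mul
  by (rule cubic_algebra_tensor[OF c])

section \<open>Multiplication table of the normal form\<close>

lemma coefficients:
  "ip e (mul e e) = 1" "ip (X x) (mul e e) = 0" "ip (Y y) (mul e e) = 0" "ip (Z z) (mul e e) = 0"
  "ip e (mul (X x) (X x)) = - dotp n1 x x" "ip e (mul (Y y) (Y y)) = - dotp n2 y y / 2"
  "ip e (mul (Z z) (Z z)) = dotp n3 z z / 2"
  "ip e (mul (X x) (Y y)) = 0" "ip e (mul (X x) (Z z)) = 0" "ip e (mul (Y y) (Z z)) = 0"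
  "ip (X x) (mul (X x) (X x)) = 0" "ip (Y y) (mul (X x) (X x)) = 0" "ip (Z z) (mul (X x) (X x)) = 0"
  "ip (X x) (mul (Y y) (Y y)) = 0"
  "6 * ip (X x) (mul (Y y) (Z z)) = \<psi>111 x y z" "3 * ip (X x) (mul (Z z) (Z z)) = \<psi>102 x y z"
  using normal_form_coefficients[where x = "X x" and y = "Y y" and z = "Z z" and e = e
      and A = "dotp n1 x x" and B = "dotp n2 y y" and D = "dotp n3 z z" and p = "\<psi>111 x y z"
      and q = "\<psi>102 x y z" and r = "\<psi>012 x y z" and w = "\<psi>030 x y z", OF cubic[OF refl]]
  by blast+

lemma comb_diff: "comb s m (x - y) = comb s m x - comb s m y"
  by (simp add: comb_def scaleR_diff_left sum_subtractf)

lemma polarize_comb: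
  assumes "\<And>x. ip v (mul (comb s m x) (comb s m x)) = k * dotp m x x"
  shows "ip v (mul (comb s m x) (comb s m y)) = k * dotp m x y"
proof -
  have "4 * ip v (mul (comb s m x) (comb s m y)) = k * dotp m (x + y) (x + y) - k * dotp m (x - y) (x - y)"
    unfolding ip_scale_right[symmetric] four_mul ip_diff_right comb_add[symmetric] comb_diff[symmetric] assms ..
  moreover have "dotp m (x + y) (x + y) - dotp m (x - y) (x - y) = 4 * dotp m x y"
    unfolding dotp_def by (simp add: algebra_simps sum.distrib sum_distrib_left sum_subtractf)
  ultimately show ?thesis by (simp flip: right_diff_distrib)
qed

lemma e_products:
  "ip e (mul (X x) (X x')) = - dotp n1 x x'" "ip e (mul (Y y) (Y y')) = - dotp n2 y y' / 2"
  "ip e (mul (Z z) (Z z')) = dotp n3 z z' / 2"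
  using polarize_comb[of e 0 n1 "-1" x x'] polarize_comb[of e n1 n2 "-1/2" y y']
    polarize_comb[of e "n1 + n2" n3 "1/2" z z'] coefficients by simp_all

lemma vanishing_products:
  "ip (Y y) (mul (X x) (X x')) = 0" "ip (Z z) (mul (X x) (X x')) = 0" "ip (X x) (mul (Y y) (Y y')) = 0"
  using polarize_comb[of "Y y" 0 n1 0 x x'] polarize_comb[of "Z z" 0 n1 0 x x']
    polarize_comb[of "X x" n1 n2 0 y y'] coefficients by simp_all

lemma XXX_vanishes: "ip (X x') (mul (X x) (X x)) = 0"
  using cubic_pair[of "X x'" "X x"] coefficients(11)
  unfolding comb_add[symmetric] comb_diff[symmetric] by simp

lemma dotp_comb_left: "dotp n w (comb s m x) = (\<Sum>a<m. x a * dotp n w (q (s + a)))"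
  unfolding comb_def ip_sum_right ip_scale_right ..

lemma dotp_components: "dotp m (\<lambda>k. dotp n w (q (s + k))) u = dotp n w (comb s m u)"
  unfolding dotp_comb_left dotp_def[of m] by (simp add: mult.commute)

lemma ip_table:
  "ip (X x) (X x') = dotp n1 x x'" "ip (Y y) (Y y') = dotp n2 y y'" "ip (Z z) (Z z') = dotp n3 z z'"
  "ip (X x) (Y y) = 0" "ip (X x) (Z z) = 0" "ip (Y y) (Z z) = 0"
  "ip (Y y) (X x) = 0" "ip (Z z) (X x) = 0" "ip (Z z) (Y y) = 0"
  "ip (X x) e = 0" "ip (Y y) e = 0" "ip (Z z) e = 0" "ip e (X x) = 0" "ip e (Y y) = 0" "ip e (Z z) = 0"
  "ip e e = 1"
proof -
  have le: "n1 \<le> n" "n1 + n2 \<le> n" "n1 + n2 + n3 \<le> n" "n1 + n2 + n3 < n"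
    "\<And>a. a < n1 \<Longrightarrow> a < n" "\<And>a. a < n2 \<Longrightarrow> n1 + a < n" "\<And>a. a < n3 \<Longrightarrow> n1 + n2 + a < n"
    using n by auto
  show "ip (X x) (X x') = dotp n1 x x'" "ip (Y y) (Y y') = dotp n2 y y'" "ip (Z z) (Z z') = dotp n3 z z'"
    "ip (X x) (Y y) = 0" "ip (X x) (Z z) = 0" "ip (Y y) (Z z) = 0"
    "ip (Y y) (X x) = 0" "ip (Z z) (X x) = 0" "ip (Z z) (Y y) = 0"
    unfolding dotp_comb_left dotp_def[of n1] dotp_def[of n2] dotp_def[of n3]
    by (auto simp: dotp_comb le mult.commute intro!: sum.cong sum.neutral)
  show "ip (X x) e = 0" "ip (Y y) e = 0" "ip (Z z) e = 0" "ip e e = 1"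
    by (auto simp: dotp_comb dotp_q le)
  then show "ip e (X x) = 0" "ip e (Y y) = 0" "ip e (Z z) = 0"
    using ip_commute by metis+
qed

lemma index_cases:
  assumes "a < n"
  obtains "a < n1" "q a = X (unit_fun a)" | b where "b < n2" "a = n1 + b" "q a = Y (unit_fun b)"
    | b where "b < n3" "a = n1 + n2 + b" "q a = Z (unit_fun b)" | "a = n1 + n2 + n3"
proof -
  consider "a < n1" | "n1 \<le> a" "a < n1 + n2" | "n1 + n2 \<le> a" "a < n1 + n2 + n3" | "a = n1 + n2 + n3"
    using assms n by linarith
  then show ?thesis
  proof cases
    case 1 then show ?thesis using that(1) comb_unit[of a n1 0] by simp
  next
    case 2 then show ?thesis using that(2)[of "a - n1"] comb_unit[of "a - n1" n2 n1] by simp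
  next
    case 3 then show ?thesis using that(3)[of "a - (n1 + n2)"] comb_unit[of "a - (n1 + n2)" n3 "n1 + n2"] by simp
  next
    case 4 then show ?thesis using that(4) by simp
  qed
qed

lemma eq_by_components:
  assumes "supported n w" "supported n w'"
    and "\<And>u. ip w (X u) = ip w' (X u)" "\<And>u. ip w (Y u) = ip w' (Y u)" "\<And>u. ip w (Z u) = ip w' (Z u)"
    and "ip w e = ip w' e"
  shows "w = w'"
proof (rule supported_eq_by_q[OF assms(1,2)])
  show "ip w (q a) = ip w' (q a)" if "a < n" for a
    using index_cases[OF that] assms(3-6) by metis
qed

lemma supported_scale: "supported n w \<Longrightarrow> supported n (r *\<^sub>R w)"
  by (simp add: supported_def)

lemma supported_add: "supported n w \<Longrightarrow> supported n w' \<Longrightarrow> supported n (w + w')"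
  by (simp add: supported_def)

text \<open>The eigenvalues come from the quadratic form that multiplies t in the normal form,
  divided by 3, because t occurs in the cubic with the coefficient 3
  \<open>ip e (mul y y)\<close>.\<close>

lemma mul_e: "mul e (X x) = (-1) *\<^sub>R X x" "mul e (Y y) = (-1/2) *\<^sub>R Y y" "mul e (Z z) = (1/2) *\<^sub>R Z z" "mul e e = e"
proof -
  have swap: "ip e (mul w e) = ip w (mul e e)" for w using ip_mul mul_commute ip_commute by metis
  have XY: "ip e (mul (Y y) (X x)) = 0" "ip e (mul (Z z) (X x)) = 0" "ip e (mul (Z z) (Y y)) = 0" for x y z
    using coefficients mul_commute by metis+
  show "mul e (X x) = (-1) *\<^sub>R X x" "mul e (Y y) = (-1/2) *\<^sub>R Y y" "mul e (Z z) = (1/2) *\<^sub>R Z z"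
    by (rule eq_by_components; (intro supported_tensor_mul supported_scale supported_comb)?;
        simp add: ip_mul bilinear ip_table e_products coefficients XY swap)+
  show "mul e e = e"
    by (rule eq_by_components; (intro supported_tensor_mul supported_q)?;
        simp add: ip_commute[of "mul e e"] ip_table coefficients)
qed

sublocale idempotent_cubic_algebra ip mul "tensor_trace n c" \<mu> e
  by unfold_locales (auto simp: tensor_trace_add tensor_trace_scale radial_tensor mul_e ip_table)

definition u0 :: "nat \<Rightarrow> real" where "u0 = X (unit_fun 0)"

lemma u0: "mul e u0 = - u0" "ip u0 u0 = 1"
  using n1 by (simp_all add: u0_def mul_e ip_table dotp_unit) (simp add: unit_fun_def)

text \<open>No psi has degree 2 or more in \<xi>, so x x has no component in V1, V2 or V3.\<close>

lemma mul_XX: "mul (X x) (X x) = - ip (X x) (X x) *\<^sub>R e"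
  by (rule eq_by_components; (intro supported_tensor_mul supported_scale supported_q)?;
      simp add: ip_commute[of "mul (X x) (X x)"] bilinear ip_table XXX_vanishes vanishing_products coefficients)

text \<open>The components of x y in V1 and V2 would come from monomials of type (2, 1, 0) and (1,
  2, 0), which are absent from the normal form; so x y lies in V3.\<close>

lemma mul_XY: "mul (X x) (Y y) = Z (\<lambda>k. ip (mul (X x) (Y y)) (q (n1 + n2 + k)))"
proof (rule eq_by_components)
  let ?U = "mul (X x) (Y y)"
  show "supported n ?U" by (rule supported_tensor_mul)
  show "supported n (Z (\<lambda>k. ip ?U (q (n1 + n2 + k))))" by (rule supported_comb)
  show "ip ?U (X u) = ip (Z (\<lambda>k. ip ?U (q (n1 + n2 + k)))) (X u)" for u
    unfolding ip_mul_swap[of "X x"] by (simp add: vanishing_products ip_table)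
  show "ip ?U (Y u) = ip (Z (\<lambda>k. ip ?U (q (n1 + n2 + k)))) (Y u)" for u
    unfolding ip_mul by (simp add: vanishing_products ip_table)
  show "ip ?U (Z u) = ip (Z (\<lambda>k. ip ?U (q (n1 + n2 + k)))) (Z u)" for u
    by (simp add: ip_table dotp_components)
  show "ip ?U e = ip (Z (\<lambda>k. ip ?U (q (n1 + n2 + k)))) e"
    unfolding ip_commute[of ?U e] by (simp add: coefficients ip_table)
qed

text \<open>Only the component in V1 is excluded, as there is no term of type (2, 0, 1); the two
  others are encoded by \<open>\<psi>111\<close> and \<open>\<psi>102\<close>.\<close>

lemma mul_XZ: "mul (X x) (Z z) =
  Y (\<lambda>k. ip (mul (X x) (Z z)) (q (n1 + k))) + Z (\<lambda>k. ip (mul (X x) (Z z)) (q (n1 + n2 + k)))"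
proof (rule eq_by_components)
  let ?w = "mul (X x) (Z z)"
  let ?P = "Y (\<lambda>k. ip ?w (q (n1 + k)))" and ?R = "Z (\<lambda>k. ip ?w (q (n1 + n2 + k)))"
  show "supported n ?w" by (rule supported_tensor_mul)
  show "supported n (?P + ?R)" by (intro supported_add supported_comb)
  show "ip ?w (X u) = ip (?P + ?R) (X u)" for u
    unfolding ip_mul_swap[of "X x"] by (simp add: bilinear vanishing_products ip_table)
  show "ip ?w (Y u) = ip (?P + ?R) (Y u)" "ip ?w (Z u) = ip (?P + ?R) (Z u)" for u
    by (simp_all add: ip_add_left ip_table dotp_components)
  show "ip ?w e = ip (?P + ?R) e"
    unfolding ip_commute[of ?w e] by (simp add: bilinear coefficients ip_table)
qed

lemma dotp_unit_unit: "a < m \<Longrightarrow> dotp m (unit_fun a) (unit_fun a) = 1"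
  by (simp add: dotp_unit) (simp add: unit_fun_def)

text \<open>In the eigenbasis the vanishing trace of the multiplication by e is - n1 - n2 / 2 + n3 /
  2 + 1.\<close>

lemma dim_V3: "real n3 = 2 * real n1 + real n2 - 2"
proof -
  have "tensor_trace n c e = (\<Sum>a<(n1 + n2 + n3) + 1. ip (q a) (mul e (q a)))"
    unfolding trace_q[OF c] by (intro sum.cong) (simp_all only: n[symmetric])
  also have "\<dots> = (\<Sum>a<n1. ip (q a) (mul e (q a))) + (\<Sum>a<n2. ip (q (n1 + a)) (mul e (q (n1 + a))))
      + (\<Sum>a<n3. ip (q (n1 + n2 + a)) (mul e (q (n1 + n2 + a)))) + 1"
    unfolding sum_lessThan_add by (simp add: mul_e ip_table)
  also have "(\<Sum>a<n1. ip (q a) (mul e (q a))) = (\<Sum>a<n1. -1)"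
    by (intro sum.cong refl)
      (simp add: comb_unit[of _ n1 0, simplified, symmetric] mul_e bilinear ip_table dotp_unit_unit)
  also have "(\<Sum>a<n2. ip (q (n1 + a)) (mul e (q (n1 + a)))) = (\<Sum>a<n2. -1/2)"
    by (intro sum.cong refl)
      (simp add: comb_unit[of _ n2 n1, symmetric] mul_e bilinear ip_table dotp_unit_unit)
  also have "(\<Sum>a<n3. ip (q (n1 + n2 + a)) (mul e (q (n1 + n2 + a)))) = (\<Sum>a<n3. 1/2)"
    by (intro sum.cong refl)
      (simp add: comb_unit[of _ n3 "n1 + n2", symmetric] mul_e bilinear ip_table dotp_unit_unit)
  finally show ?thesis using trace_zero(1)[OF u0] by simp
qed

text \<open>The scaling by \<open>1 / \<surd>3\<close> of the part of \<open>x z\<close> in \<open>V\<^sub>3\<close> turns the norm identities into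
  \<open>|A\<^sub>x z| = |x| |z|\<close>.\<close>

definition weight :: "nat \<Rightarrow> nat \<Rightarrow> real" where
  "weight k b = (if k < n2 then (if b < n2 then 0 else 1) else (if b < n2 then 1 else 1 / sqrt 3))"

text \<open>The factor 2 undoes the 1/4 in \<open>eigenspace_norms\<close>. The indices k and b run
  through the coordinates of \<eta> and then those of \<zeta>, hence the shift by n1.\<close>

definition clifford_coeff :: "nat \<Rightarrow> nat \<Rightarrow> nat \<Rightarrow> real" where
  "clifford_coeff i k b = 2 * weight k b * ip (q i) (mul (q (n1 + k)) (q (n1 + b)))"

lemma ip_comb_mul_comb:
  "ip (X x) (mul w (comb s m z)) = (\<Sum>i<n1. \<Sum>b<m. ip (q i) (mul w (q (s + b))) * x i * z b)"
  unfolding comb_def mul_sum_right mul_scale_right ip_sum_right ip_scale_right ip_sum_left ip_scale_left sum_distrib_left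
  by (subst sum.swap) (simp add: algebra_simps)

lemma ip_mul_rotate: "ip x (mul y z) = ip (mul x z) y"
  by (metis ip_mul mul_commute)

lemma clifford_coeff_action:
  defines "act x z k \<equiv> \<Sum>i<n1. \<Sum>b<n2 + n3. clifford_coeff i k b * x i * z b"
  shows "k < n2 \<Longrightarrow> act x z k = 2 * ip (mul (X x) (Z (\<lambda>b. z (n2 + b)))) (q (n1 + k))"
    and "k < n3 \<Longrightarrow> act x z (n2 + k) = 2 * (ip (mul (X x) (Y z)) (q (n1 + n2 + k))
          + ip (mul (X x) (Z (\<lambda>b. z (n2 + b)))) (q (n1 + n2 + k)) / sqrt 3)"
proof -
  show "act x z k = 2 * ip (mul (X x) (Z (\<lambda>b. z (n2 + b)))) (q (n1 + k))" if "k < n2"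
    unfolding act_def sum_lessThan_add ip_mul_rotate[symmetric] ip_comb_mul_comb using that
    by (simp add: clifford_coeff_def weight_def sum_distrib_left add.assoc algebra_simps)
  show "act x z (n2 + k) = 2 * (ip (mul (X x) (Y z)) (q (n1 + n2 + k))
          + ip (mul (X x) (Z (\<lambda>b. z (n2 + b)))) (q (n1 + n2 + k)) / sqrt 3)" if "k < n3"
    unfolding act_def sum_lessThan_add ip_mul_rotate[symmetric] ip_comb_mul_comb sum.distrib
    by (simp add: clifford_coeff_def weight_def sum_distrib_left sum_divide_distrib add.assoc algebra_simps sum.distrib)
qed

text \<open>The image of (\<eta>, \<zeta>) has the part 2 p in V2 and 2 (U + r / sqrt 3) in V3,
  where U is the product of x with \<eta>. The three claims of \<open>eigenspace_norms\<close> give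
  the two squares and the vanishing of the mixed term in U and r.\<close>

sublocale clifford_tensor n1 "n2 + n3" clifford_coeff
proof
  show "clifford_coeff i k b = clifford_coeff i b k" for i k b
    unfolding clifford_coeff_def weight_def using mul_commute by simp
next
  fix x z :: "nat \<Rightarrow> real"
  define z' where "z' b = z (n2 + b)" for b
  have zz: "(\<lambda>b. z (n2 + b)) = z'" unfolding z'_def ..
  define U where "U = mul (X x) (Y z)"
  define Uv where "Uv k = ip U (q (n1 + n2 + k))" for k
  define pv where "pv k = ip (mul (X x) (Z z')) (q (n1 + k))" for k
  define rv where "rv k = ip (mul (X x) (Z z')) (q (n1 + n2 + k))" for k
  have U: "mul (X x) (Y z) = Z Uv" unfolding Uv_def U_def by (rule mul_XY)
  have W: "mul (X x) (Z z') = Y pv + Z rv" unfolding pv_def rv_def by (rule mul_XZ)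
  have eX: "mul e (X x) = - X x" by (simp add: mul_e)
  have eU: "mul e (mul (X x) (Y z)) = (1/2) *\<^sub>R mul (X x) (Y z)" unfolding U by (rule mul_e)
  note norms = eigenspace_norms[OF u0 eX mul_XX mul_e(2) eU mul_e(3) W mul_e(2,3)]
  have nU: "dotp n3 Uv Uv = dotp n1 x x * dotp n2 z z / 4"
    and nW: "dotp n2 pv pv + dotp n3 rv rv / 3 = dotp n1 x x * dotp n3 z' z' / 4"
    and o: "dotp n3 Uv rv = 0"
    using norms unfolding U by (simp_all add: ip_table)
  have "(\<Sum>k<n2 + n3. (\<Sum>i<n1. \<Sum>b<n2 + n3. clifford_coeff i k b * x i * z b)\<^sup>2)
     = (\<Sum>k<n2. (2 * pv k)\<^sup>2) + (\<Sum>k<n3. (2 * (Uv k + rv k / sqrt 3))\<^sup>2)"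
    unfolding sum_lessThan_add[of _ n2 n3, of "\<lambda>k. (_ k)\<^sup>2"]
    by (intro arg_cong2[of _ _ _ _ "(+)"] sum.cong refl)
       (simp_all only: lessThan_iff clifford_coeff_action pv_def rv_def Uv_def U_def zz)
  also have "\<dots> = 4 * dotp n2 pv pv + 4 * (dotp n3 Uv Uv + dotp n3 rv rv / 3 + 2 * dotp n3 Uv rv / sqrt 3)"
  proof -
    have "(2 * (Uv k + rv k / sqrt 3))\<^sup>2 = 4 * (Uv k * Uv k + rv k * rv k / 3 + 2 * (Uv k * rv k) / sqrt 3)" for k
      by (simp add: power2_eq_square field_simps)
    then show ?thesis
      unfolding dotp_def by (simp add: power2_eq_square sum_distrib_left sum_divide_distrib sum.distrib algebra_simps)
  qed
  also have "\<dots> = dotp n1 x x * dotp n2 z z + dotp n1 x x * dotp n3 z' z'"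
    using nU nW o by (simp add: algebra_simps)
  also have "\<dots> = dotp n1 x x * dotp (n2 + n3) z z"
    unfolding dotp_def[of "n2 + n3"] sum_lessThan_add by (simp add: dotp_def z'_def algebra_simps)
  finally show "(\<Sum>k<n2 + n3. (\<Sum>i<n1. \<Sum>b<n2 + n3. clifford_coeff i k b * x i * z b)\<^sup>2)
    = dotp n1 x x * dotp (n2 + n3) z z" .
qed

text \<open>The weight is 0 on the diagonal of V2, so the sum is 2 / sqrt 3 times the contribution
  of V3 to the trace of the multiplication by \<open>q i\<close>. That trace vanishes, and V1, V2
  and e contribute nothing to it.\<close>

lemma clifford_coeff_trace:
  assumes i: "i < n1"
  shows "(\<Sum>k<n2 + n3. clifford_coeff i k k) = 0"
proof -
  have qi: "q i = X (unit_fun i)" using comb_unit[of i n1 0] i by simp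
  have rot: "ip u (mul (q i) u) = ip (q i) (mul u u)" for u by (metis ip_mul ip_commute)
  have 1: "ip (q i) (mul (q a) (q a)) = 0" if "a < n1" for a
  proof -
    have "q a = X (unit_fun a)" using comb_unit[of a n1 0] that by simp
    then show ?thesis unfolding qi using XXX_vanishes by simp
  qed
  have 2: "ip (q i) (mul (q (n1 + a)) (q (n1 + a))) = 0" if "a < n2" for a
    unfolding qi comb_unit[OF that, symmetric] by (rule coefficients)
  have "0 = tensor_trace n c (q i)"
    using trace_zero(3)[OF u0, of "q i"] unfolding qi by (simp add: ip_table)
  also have "\<dots> = (\<Sum>a<n1 + n2 + n3 + 1. ip (q i) (mul (q a) (q a)))"
    unfolding trace_q[OF c] rot by (intro sum.cong) (simp_all only: n[symmetric])
  also have "\<dots> = (\<Sum>a<n3. ip (q i) (mul (q (n1 + n2 + a)) (q (n1 + n2 + a))))"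
    unfolding sum_lessThan_add using 1 2 by (simp add: mul_e) (simp add: qi ip_table)
  finally have 3: "(\<Sum>a<n3. ip (q i) (mul (q (n1 + n2 + a)) (q (n1 + n2 + a)))) = 0" by simp
  have "(\<Sum>k<n2 + n3. clifford_coeff i k k) = 2 / sqrt 3 * (\<Sum>a<n3. ip (q i) (mul (q (n1 + n2 + a)) (q (n1 + n2 + a))))"
    unfolding sum_lessThan_add sum_distrib_left by (simp add: clifford_coeff_def weight_def add.assoc)
  then show ?thesis using 3 by simp
qed

text \<open>The mixed term occurs twice with the factor 2, and \<open>\<psi>111\<close> is 6 times
  the trilinear value: 4/6 = 2/3. The pure \<zeta>-term has the factor 2 / sqrt 3, and
  \<open>\<psi>102\<close> is 3 times the trilinear value.\<close>

lemma form_eq: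
  fixes v :: "real vec"
  assumes v: "v \<in> carrier_vec (n1 + (n2 + n3))"
  defines "x \<equiv> \<lambda>i. v $ i" and "y \<equiv> \<lambda>i. v $ (n1 + i)" and "z \<equiv> \<lambda>i. v $ (n1 + n2 + i)"
  shows "form v = 2 / 3 * (\<psi>111 x y z + 1 / sqrt 3 * \<psi>102 x y z)"
proof -
  let ?act = "\<lambda>k. \<Sum>i<n1. \<Sum>b<n2 + n3. clifford_coeff i k b * x i * y b"
  have yz: "(\<lambda>b. y (n2 + b)) = z" unfolding y_def z_def by (simp add: add.assoc)
  have "form v = (\<Sum>k<n2 + n3. y k * ?act k)"
    unfolding form_def sum_distrib_left
    by (subst sum.swap) (intro sum.cong refl, simp add: x_def y_def algebra_simps)
  also have "\<dots> = (\<Sum>k<n2. y k * (2 * ip (mul (X x) (Z z)) (q (n1 + k))))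
      + (\<Sum>k<n3. z k * (2 * (ip (mul (X x) (Y y)) (q (n1 + n2 + k)) + ip (mul (X x) (Z z)) (q (n1 + n2 + k)) / sqrt 3)))"
    unfolding sum_lessThan_add[of _ n2 n3, of "\<lambda>k. y k * _ k"] yz[symmetric]
    by (intro arg_cong2[of _ _ _ _ "(+)"] sum.cong refl) (simp_all only: lessThan_iff clifford_coeff_action)
  also have "\<dots> = 2 * ip (mul (X x) (Z z)) (Y y) + 2 * ip (mul (X x) (Y y)) (Z z) + 2 / sqrt 3 * ip (mul (X x) (Z z)) (Z z)"
    unfolding dotp_comb_left by (simp add: sum_distrib_left sum.distrib algebra_simps)
  also have "\<dots> = 4 * ip (X x) (mul (Y y) (Z z)) + 2 / sqrt 3 * ip (X x) (mul (Z z) (Z z))"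
    using ip_mul[of "X x" "Z z" "Y y"] mul_commute[of "Z z" "Y y"] by (simp add: ip_mul)
  also have "\<dots> = 2 / 3 * (\<psi>111 x y z + 1 / sqrt 3 * \<psi>102 x y z)"
    unfolding coefficients(15)[where x = x and y = y and z = z, symmetric]
      coefficients(16)[where x = x and y = y and z = z, symmetric] by (simp add: algebra_simps)
  finally show ?thesis .
qed

end

section \<open>Nonvanishing of the form and comparison with \<open>clifford_cubic\<close>\<close>

context clifford_tensor
begin

lemma form_eq_act:
  assumes "v \<in> carrier_vec (p + N)"
  shows "form v = dotp N (\<lambda>k. v $ (p + k)) (act (\<lambda>i. v $ i) (\<lambda>k. v $ (p + k)))"
  unfolding form_def dotp_def act_def sum_distrib_left
  by (subst sum.swap) (intro sum.cong refl, simp add: algebra_simps)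

text \<open>If the form vanished, polarization of the symmetric operators would make them all zero,
  against the norm identity at unit vectors.\<close>

lemma form_nonzero:
  assumes "p > 0" "N > 0"
  shows "\<exists>v\<in>carrier_vec (p + N). form v \<noteq> 0"
proof (rule ccontr)
  assume "\<not> ?thesis"
  then have zero: "form v = 0" if "v \<in> carrier_vec (p + N)" for v using that by blast
  have 0: "dotp N z (act x z) = 0" for x z
  proof -
    let ?v = "Matrix.vec (p + N) (\<lambda>i. if i < p then x i else z (i - p))"
    have "form ?v = dotp N (\<lambda>k. ?v $ (p + k)) (act (\<lambda>i. ?v $ i) (\<lambda>k. ?v $ (p + k)))"
      by (rule form_eq_act) simp
    also have "\<dots> = dotp N z (act x z)"
      unfolding dotp_def act_def by (intro sum.cong refl arg_cong2[of _ _ _ _ "(*)"]) auto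
    finally show ?thesis using zero by simp
  qed
  have sym: "dotp N z (act x z') = dotp N z' (act x z)" for x z z'
  proof -
    have "dotp N z (act x z') = (\<Sum>i<p. \<Sum>k<N. \<Sum>b<N. a i k b * x i * z' b * z k)"
      unfolding dotp_def act_def sum_distrib_left by (subst sum.swap) (simp add: algebra_simps)
    also have "\<dots> = (\<Sum>i<p. \<Sum>b<N. \<Sum>k<N. a i k b * x i * z' b * z k)"
      by (intro sum.cong refl sum.swap)
    also have "\<dots> = (\<Sum>i<p. \<Sum>b<N. \<Sum>k<N. a i b k * x i * z k * z' b)"
      by (intro sum.cong refl) (simp add: a_sym)
    also have "\<dots> = dotp N z' (act x z)"
      unfolding dotp_def act_def sum_distrib_left by (subst (2) sum.swap) (simp add: algebra_simps)
    finally show ?thesis .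
  qed
  have "dotp N z (act x z') = 0" for x z z'
  proof -
    have "dotp N (z + z') (act x z + act x z') = 0" using 0[of "z + z'" x] unfolding act_add .
    moreover have "dotp N (z + z') (act x z + act x z')
        = dotp N z (act x z) + dotp N z (act x z') + dotp N z' (act x z) + dotp N z' (act x z')"
      unfolding dotp_def by (simp add: algebra_simps sum.distrib)
    ultimately show ?thesis using 0[of z x] 0[of z' x] sym[of z' x z] by simp
  qed
  from this[of "act (unit_fun 0) (unit_fun 0)" "unit_fun 0" "unit_fun 0"] show False
    using assms unfolding act_norm by (simp add: dotp_unit) (simp add: unit_fun_def)
qed

lemma clifford_cubic_mat:
  assumes "p = q + 1" "N = 2 * m" and v: "v \<in> carrier_vec (p + N)"
  shows "clifford_cubic m q (\<lambda>i. mat N N (\<lambda>(k, b). a i k b)) v = form v"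
proof -
  define y where "y = vec_last v N"
  have y: "y \<in> carrier_vec N" "\<And>k. k < N \<Longrightarrow> y $ k = v $ (p + k)"
    using v unfolding y_def vec_last_def by auto
  have "y \<bullet> (mat N N (\<lambda>(k, b). a i k b) *\<^sub>v y) = (\<Sum>k<N. \<Sum>b<N. a i k b * v $ (p + k) * v $ (p + b))" for i
    using y by (auto simp: scalar_prod_def atLeast0LessThan sum_distrib_left intro!: sum.cong)
  then have "clifford_cubic m q (\<lambda>i. mat N N (\<lambda>(k, b). a i k b)) v
      = (\<Sum>i\<le>q. (\<Sum>k<N. \<Sum>b<N. a i k b * v $ (p + k) * v $ (p + b)) * vec_first v (q + 1) $ i)"
    unfolding clifford_cubic_def Let_def assms(2)[symmetric] y_def[symmetric] by simp
  also have "{..q} = {..<p}" using assms(1) by auto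
  also have "(\<Sum>i<p. (\<Sum>k<N. \<Sum>b<N. a i k b * v $ (p + k) * v $ (p + b)) * vec_first v (q + 1) $ i) = form v"
    unfolding form_def sum_distrib_right using assms(1)
    by (intro sum.cong refl) (auto simp: vec_first_def algebra_simps)
  finally show ?thesis .
qed

end

section \<open>From the given definitions to the algebra\<close>

lemma congruent_cubics_of_eq:
  assumes "\<And>x. x \<in> carrier_vec n \<Longrightarrow> f x = g x"
  shows "congruent_cubics n f g"
proof -
  have "orthonormal_mat n (1\<^sub>m n)" unfolding orthonormal_mat_def by simp
  moreover have "(\<lambda>x. 1\<^sub>m n *\<^sub>v x) ` {x \<in> carrier_vec n. f x = 0} = {x \<in> carrier_vec n. g x = 0}"
    using assms by (auto simp: image_iff)
  ultimately show ?thesis unfolding congruent_cubics_def by blast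
qed

lemma cubic_form_linear_combination:
  assumes "cubic_form n f" "cubic_form n g"
  shows "cubic_form n (\<lambda>x. r * (f x + s * g x))"
proof -
  obtain b where b: "\<forall>x\<in>carrier_vec n. f x = (\<Sum>i<n. \<Sum>j<n. \<Sum>k<n. b i j k * x $ i * x $ j * x $ k)"
    using assms(1) unfolding cubic_form_def by (elim exE)
  obtain c where c: "\<forall>x\<in>carrier_vec n. g x = (\<Sum>i<n. \<Sum>j<n. \<Sum>k<n. c i j k * x $ i * x $ j * x $ k)"
    using assms(2) unfolding cubic_form_def by (elim exE)
  have "r * (f x + s * g x) = (\<Sum>i<n. \<Sum>j<n. \<Sum>k<n. (r * (b i j k + s * c i j k)) * x $ i * x $ j * x $ k)"
    if "x \<in> carrier_vec n" for x
    unfolding b[rule_format, OF that] c[rule_format, OF that] by (simp add: sum_distrib_left sum.distrib algebra_simps)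
  then show ?thesis unfolding cubic_form_def by (intro exI ballI)
qed

text \<open>The hypotheses on f concern carrier vectors, while the algebra lives on all functions;
  these equations carry the radial equation over, since the operations read their arguments only
  below n.\<close>

lemma tensor_cut_off:
  defines "r n x \<equiv> vec_fun (Matrix.vec n x)"
  shows "dotp n (r n x) (r n y) = dotp n x y" "dotp n (r n x) z = dotp n x z" "dotp n z (r n x) = dotp n z x"
    "tensor_mul n c (r n x) (r n y) = tensor_mul n c x y" "tensor_mul n c (r n x) z = tensor_mul n c x z"
    "tensor_mul n c z (r n x) = tensor_mul n c z x"
    "tensor_trace n c (r n x) = tensor_trace n c x"
  unfolding r_def dotp_def tensor_mul_def tensor_trace_def
  by (auto simp: vec_fun_def fun_eq_iff intro!: sum.cong)

lemma radial_eigencubic_tensor: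
  assumes "radial_eigencubic n f"
  shows "\<exists>c \<mu>. symmetric_tensor c \<and>
    (\<forall>x\<in>carrier_vec n. f x = dotp n (vec_fun x) (tensor_mul n c (vec_fun x) (vec_fun x))) \<and>
    (\<forall>x. dotp n (tensor_mul n c x x) (tensor_mul n c x x) * tensor_trace n c x
      - dotp n (tensor_mul n c x x) (tensor_mul n c x (tensor_mul n c x x))
      = \<mu> * dotp n x x * dotp n x (tensor_mul n c x x))"
proof -
  obtain l where l: "\<And>x. x \<in> carrier_vec n \<Longrightarrow> L_op n f x = l * (x \<bullet> x) * f x"
    using assms unfolding radial_eigencubic_def by blast
  obtain c where c: "symmetric_tensor c"
    "\<And>x. x \<in> carrier_vec n \<Longrightarrow> f x = dotp n (vec_fun x) (tensor_mul n c (vec_fun x) (vec_fun x))"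
    using symmetrize_cubic_form assms unfolding radial_eigencubic_def by metis
  have "dotp n (tensor_mul n c x x) (tensor_mul n c x x) * tensor_trace n c x
      - dotp n (tensor_mul n c x x) (tensor_mul n c x (tensor_mul n c x x))
      = l / 54 * dotp n x x * dotp n x (tensor_mul n c x x)" for x
  proof -
    have w: "Matrix.vec n x \<in> carrier_vec n" by simp
    have "l * dotp n x x * dotp n x (tensor_mul n c x x) = L_op n f (Matrix.vec n x)"
      unfolding l[OF w] c(2)[OF w] vec_fun_scalar_prod[OF w w, symmetric] tensor_cut_off ..
    also have "\<dots> = 54 * (dotp n (tensor_mul n c x x) (tensor_mul n c x x) * tensor_trace n c x
      - dotp n (tensor_mul n c x x) (tensor_mul n c x (tensor_mul n c x x)))"
      using L_op_tensor[OF c w] by (simp only: tensor_cut_off)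
    finally show ?thesis by simp
  qed
  then show ?thesis
    by (intro exI[of _ c] exI[of _ "l / 54"] conjI c(1) ballI c(2) allI)
qed

text \<open>The scalars \<alpha>, \<beta>, \<gamma> are moved into the three arguments of the normal
  form, and tri-homogeneity takes them out of the psi's again.\<close>

lemma normal_form_algebra_of_normal_form:
  assumes f: "radial_eigencubic n f" and nf: "normal_form n n1 n2 n3 Q f \<psi>111 \<psi>102 \<psi>012 \<psi>030"
    and n1: "n1 \<ge> 1"
  defines "arg x y z \<equiv> Matrix.vec n1 x @\<^sub>v Matrix.vec n2 y @\<^sub>v Matrix.vec n3 z"
  shows "\<exists>c \<mu>. normal_form_algebra n Q n1 n2 n3 c \<mu> (\<lambda>x y z. \<psi>111 (arg x y z)) (\<lambda>x y z. \<psi>102 (arg x y z))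
    (\<lambda>x y z. \<psi>012 (arg x y z)) (\<lambda>x y z. \<psi>030 (arg x y z))"
proof -
  obtain c \<mu> where c: "symmetric_tensor c"
    "\<And>x. x \<in> carrier_vec n \<Longrightarrow> f x = dotp n (vec_fun x) (tensor_mul n c (vec_fun x) (vec_fun x))"
    "\<And>x. dotp n (tensor_mul n c x x) (tensor_mul n c x x) * tensor_trace n c x
      - dotp n (tensor_mul n c x x) (tensor_mul n c x (tensor_mul n c x x))
      = \<mu> * dotp n x x * dotp n x (tensor_mul n c x x)"
    using radial_eigencubic_tensor[OF f] by blast
  have n: "n = n1 + n2 + n3 + 1" and Q: "orthonormal_mat n Q"
    and tri: "tri_cubic_form n1 n2 n3 1 1 1 \<psi>111" "tri_cubic_form n1 n2 n3 1 0 2 \<psi>102"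
      "tri_cubic_form n1 n2 n3 0 1 2 \<psi>012" "tri_cubic_form n1 n2 n3 0 3 0 \<psi>030"
    and eq: "\<And>\<xi> \<eta> \<zeta> t. \<xi> \<in> carrier_vec n1 \<Longrightarrow> \<eta> \<in> carrier_vec n2 \<Longrightarrow> \<zeta> \<in> carrier_vec n3 \<Longrightarrow>
        f (Q *\<^sub>v ((\<xi> @\<^sub>v \<eta> @\<^sub>v \<zeta>) @\<^sub>v Matrix.vec 1 (\<lambda>_. t))) =
          t ^ 3 - 3 / 2 * t * (2 * (\<xi> \<bullet> \<xi>) + \<eta> \<bullet> \<eta> - \<zeta> \<bullet> \<zeta>)
          + \<psi>111 (\<xi> @\<^sub>v \<eta> @\<^sub>v \<zeta>) + \<psi>102 (\<xi> @\<^sub>v \<eta> @\<^sub>v \<zeta>) + \<psi>012 (\<xi> @\<^sub>v \<eta> @\<^sub>v \<zeta>) + \<psi>030 (\<xi> @\<^sub>v \<eta> @\<^sub>v \<zeta>)"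
    using nf unfolding normal_form_def Let_def by blast+
  interpret orthonormal_columns n Q by standard (rule Q)
  have "normal_form_algebra n Q n1 n2 n3 c \<mu> (\<lambda>x y z. \<psi>111 (arg x y z)) (\<lambda>x y z. \<psi>102 (arg x y z))
    (\<lambda>x y z. \<psi>012 (arg x y z)) (\<lambda>x y z. \<psi>030 (arg x y z))"
  proof
    fix u x y z :: "nat \<Rightarrow> real" and \<alpha> \<beta> \<gamma> s :: real
    assume u: "u = \<alpha> *\<^sub>R comb 0 n1 x + \<beta> *\<^sub>R comb n1 n2 y + \<gamma> *\<^sub>R comb (n1 + n2) n3 z + s *\<^sub>R q (n1 + n2 + n3)"
    define \<xi> where "\<xi> = Matrix.vec n1 x"
    define \<eta> where "\<eta> = Matrix.vec n2 y"
    define \<zeta> where "\<zeta> = Matrix.vec n3 z"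
    define Y where "Y = (\<alpha> \<cdot>\<^sub>v \<xi>) @\<^sub>v (\<beta> \<cdot>\<^sub>v \<eta>) @\<^sub>v (\<gamma> \<cdot>\<^sub>v \<zeta>)"
    define V where "V = Y @\<^sub>v Matrix.vec 1 (\<lambda>_. s)"
    have car: "\<xi> \<in> carrier_vec n1" "\<eta> \<in> carrier_vec n2" "\<zeta> \<in> carrier_vec n3"
      "\<alpha> \<cdot>\<^sub>v \<xi> \<in> carrier_vec n1" "\<beta> \<cdot>\<^sub>v \<eta> \<in> carrier_vec n2" "\<gamma> \<cdot>\<^sub>v \<zeta> \<in> carrier_vec n3"
      unfolding \<xi>_def \<eta>_def \<zeta>_def by auto
    have V: "V \<in> carrier_vec n"
      unfolding V_def Y_def n using car by (auto simp: add.assoc intro!: carrier_vecI)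
    have idx: "a < n1 \<Longrightarrow> V $ a = \<alpha> * x a" "a < n2 \<Longrightarrow> V $ (n1 + a) = \<beta> * y a"
      "a < n3 \<Longrightarrow> V $ (n1 + n2 + a) = \<gamma> * z a" "V $ (n1 + n2 + n3) = s" for a
      unfolding V_def Y_def \<xi>_def \<eta>_def \<zeta>_def by auto
    have "vec_fun (Q *\<^sub>v V) = (\<Sum>a<n1 + n2 + n3 + 1. (V $ a) *\<^sub>R q a)"
      unfolding vec_fun_mult_Q[OF V] by (intro sum.cong) (simp_all only: n[symmetric])
    also have "\<dots> = comb 0 n1 (\<lambda>a. \<alpha> * x a) + comb n1 n2 (\<lambda>a. \<beta> * y a)
        + comb (n1 + n2) n3 (\<lambda>a. \<gamma> * z a) + s *\<^sub>R q (n1 + n2 + n3)"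
      unfolding sum_lessThan_add comb_def using idx by simp
    also have "\<dots> = u" unfolding comb_scale u ..
    finally have Vu: "vec_fun (Q *\<^sub>v V) = u" .
    have sp: "\<xi> \<bullet> \<xi> = dotp n1 x x" "\<eta> \<bullet> \<eta> = dotp n2 y y" "\<zeta> \<bullet> \<zeta> = dotp n3 z z"
      unfolding \<xi>_def \<eta>_def \<zeta>_def dotp_def scalar_prod_def by (auto simp: atLeast0LessThan)
    have "dotp n u (tensor_mul n c u u) = f (Q *\<^sub>v V)"
      using c(2)[OF mult_mat_vec_carrier[OF Q_carrier V]] unfolding Vu by simp
    also have "\<dots> = s ^ 3 - 3 / 2 * s * (2 * ((\<alpha> \<cdot>\<^sub>v \<xi>) \<bullet> (\<alpha> \<cdot>\<^sub>v \<xi>)) + (\<beta> \<cdot>\<^sub>v \<eta>) \<bullet> (\<beta> \<cdot>\<^sub>v \<eta>) - (\<gamma> \<cdot>\<^sub>v \<zeta>) \<bullet> (\<gamma> \<cdot>\<^sub>v \<zeta>))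
        + \<psi>111 Y + \<psi>102 Y + \<psi>012 Y + \<psi>030 Y"
      unfolding V_def Y_def by (rule eq[OF car(4-6)])
    also have "\<psi>111 Y = \<alpha> * \<beta> * \<gamma> * \<psi>111 (\<xi> @\<^sub>v \<eta> @\<^sub>v \<zeta>)"
      using tri(1) car(1-3) unfolding Y_def tri_cubic_form_def by simp
    also have "\<psi>102 Y = \<alpha> * \<gamma>\<^sup>2 * \<psi>102 (\<xi> @\<^sub>v \<eta> @\<^sub>v \<zeta>)"
      using tri(2) car(1-3) unfolding Y_def tri_cubic_form_def by simp
    also have "\<psi>012 Y = \<beta> * \<gamma>\<^sup>2 * \<psi>012 (\<xi> @\<^sub>v \<eta> @\<^sub>v \<zeta>)"
      using tri(3) car(1-3) unfolding Y_def tri_cubic_form_def by simp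
    also have "\<psi>030 Y = \<beta>^3 * \<psi>030 (\<xi> @\<^sub>v \<eta> @\<^sub>v \<zeta>)"
      using tri(4) car(1-3) unfolding Y_def tri_cubic_form_def by simp
    also have "(\<alpha> \<cdot>\<^sub>v \<xi>) \<bullet> (\<alpha> \<cdot>\<^sub>v \<xi>) = \<alpha>\<^sup>2 * dotp n1 x x"
      using car unfolding sp[symmetric] by (simp add: power2_eq_square)
    also have "(\<beta> \<cdot>\<^sub>v \<eta>) \<bullet> (\<beta> \<cdot>\<^sub>v \<eta>) = \<beta>\<^sup>2 * dotp n2 y y"
      using car unfolding sp[symmetric] by (simp add: power2_eq_square)
    also have "(\<gamma> \<cdot>\<^sub>v \<zeta>) \<bullet> (\<gamma> \<cdot>\<^sub>v \<zeta>) = \<gamma>\<^sup>2 * dotp n3 z z"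
      using car unfolding sp[symmetric] by (simp add: power2_eq_square)
    finally show "dotp n u (tensor_mul n c u u) =
        s^3 - 3 / 2 * s * (2 * \<alpha>\<^sup>2 * dotp n1 x x + \<beta>\<^sup>2 * dotp n2 y y - \<gamma>\<^sup>2 * dotp n3 z z)
        + \<alpha> * \<beta> * \<gamma> * \<psi>111 (arg x y z) + \<alpha> * \<gamma>\<^sup>2 * \<psi>102 (arg x y z) + \<beta> * \<gamma>\<^sup>2 * \<psi>012 (arg x y z) + \<beta>^3 * \<psi>030 (arg x y z)"
      unfolding arg_def \<xi>_def[symmetric] \<eta>_def[symmetric] \<zeta>_def[symmetric] by simp
  qed (use n n1 c in auto)
  then show ?thesis by blast
qed

theorem proposition3p3:
  fixes f \<psi>111 \<psi>102 \<psi>012 \<psi>030 :: "real vec \<Rightarrow> real"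
    and Q :: "real mat"
    and n n1 n2 n3 :: nat
  assumes "radial_eigencubic n f"
    and "normal_form n n1 n2 n3 Q f \<psi>111 \<psi>102 \<psi>012 \<psi>030"
  shows "(n1 \<ge> 1 \<and> n1 + n2 \<ge> 2 \<longrightarrow>
            clifford_type (n1 + (2 * n1 + 2 * n2 - 2))
              (\<lambda>v. 2 / 3 * (\<psi>111 v + 1 / sqrt 3 * \<psi>102 v)))
         \<and> int n1 - 1 \<le> int (hurwitz_radon (n2 + n1 - 1))"
proof (cases "n1 \<ge> 1 \<and> n1 + n2 \<ge> 2")
  case False
  \<comment> \<open>In the excluded cases n1 is at most 1, so the left-hand side is at most
    0.\<close>
  then have "int n1 - 1 \<le> int (hurwitz_radon (n2 + n1 - 1))" by linarith
  with False show ?thesis by blast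
next
  case True
  define arg where "arg x y z = Matrix.vec n1 x @\<^sub>v Matrix.vec n2 y @\<^sub>v Matrix.vec n3 z" for x y z :: "nat \<Rightarrow> real"
  obtain c \<mu> where "normal_form_algebra n Q n1 n2 n3 c \<mu> (\<lambda>x y z. \<psi>111 (arg x y z)) (\<lambda>x y z. \<psi>102 (arg x y z))
    (\<lambda>x y z. \<psi>012 (arg x y z)) (\<lambda>x y z. \<psi>030 (arg x y z))"
    using normal_form_algebra_of_normal_form[OF assms] True unfolding arg_def by blast
  then interpret normal_form_algebra n Q n1 n2 n3 c \<mu> "\<lambda>x y z. \<psi>111 (arg x y z)" "\<lambda>x y z. \<psi>102 (arg x y z)"
    "\<lambda>x y z. \<psi>012 (arg x y z)" "\<lambda>x y z. \<psi>030 (arg x y z)" .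
  let ?N = "n2 + n3" and ?m = "n1 + n2 - 1" and ?q = "n1 - 1"
  let ?C = "\<lambda>v. 2 / 3 * (\<psi>111 v + 1 / sqrt 3 * \<psi>102 v)"
  \<comment> \<open>By \<open>dim_V3\<close>, n2 + n3 = 2 (n1 + n2 - 1); so the Clifford matrices
    have even size 2 m with m = n1 + n2 - 1, the argument of the Hurwitz-Radon function.\<close>
  have N: "?N = 2 * ?m" and N': "2 * n1 + 2 * n2 - 2 = ?N" and m: "?m > 0" and q: "n1 = ?q + 1"
    using dim_V3 True by linarith+
  have C: "?C v = form v" if v: "v \<in> carrier_vec (n1 + ?N)" for v
  proof -
    have "arg (\<lambda>i. v $ i) (\<lambda>i. v $ (n1 + i)) (\<lambda>i. v $ (n1 + n2 + i)) = v"
      unfolding arg_def using v by (intro eq_vecI) (auto simp: add.assoc)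
    then show ?thesis using form_eq[OF v] by simp
  qed
  have "cubic_form (n1 + ?N) ?C"
    using assms(2) unfolding normal_form_def tri_cubic_form_def
    by (intro cubic_form_linear_combination) (auto simp: add.assoc)
  moreover have "\<exists>v\<in>carrier_vec (n1 + ?N). ?C v \<noteq> 0"
    using form_nonzero C True N m by auto
  moreover have "L_op (n1 + ?N) ?C v = - 8 * (v \<bullet> v) * ?C v" if v: "v \<in> carrier_vec (n1 + ?N)" for v
    using L_op_cong[OF C v] form_eigencubic[OF clifford_coeff_trace v] C[OF v] by simp
  ultimately have "radial_eigencubic (n1 + ?N) ?C"
    unfolding radial_eigencubic_def by blast
  \<comment> \<open>In these coordinates the two cubics coincide, so the identity matrix serves as
    the isometry.\<close>
  moreover have "congruent_cubics (n1 + ?N) ?C (clifford_cubic ?m ?q (\<lambda>i. mat ?N ?N (\<lambda>(k, b). clifford_coeff i k b)))"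
    by (rule congruent_cubics_of_eq) (simp only: C clifford_cubic_mat[OF q N])
  ultimately have "clifford_type (n1 + ?N) ?C"
    unfolding clifford_type_def using clifford_system_mat[OF q N] q N
    by (intro conjI exI[of _ ?m] exI[of _ ?q] exI) (assumption | simp)+
  moreover have "?q \<le> hurwitz_radon ?m" using hurwitz_radon_bound[OF N m] .
  ultimately show ?thesis
    unfolding N' using True by (simp add: add.commute)
qed

end
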